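(* The assignment sending a smooth map $f:U\to V$ between open subsets of Euclidean spaces to its Fermat extension ${}^\bullet f:{}^\bullet U\to{}^\bullet V$ is a functor $\mathcal S\to\mathcal F$ (in particular each ${}^\bullet f$ is a morphism of $\mathcal F$), and hence it induces a functor ${}^\bullet(-):\mathbf{Diff}\to{}^\bullet\mathcal C^\infty$ given by $$X=\operatorname{colim}_{U\in\mathcal S/X}U\in\mathbf{Diff}\ \longmapsto\ {}^\bullet X=\operatorname{colim}_{U\in\mathcal S/X}{}^\bullet U\in{}^\bullet\mathcal C^\infty .$$
   Context: FERMAT EXTENSIONS. For $U\subseteq\mathbb R^n$ open, a little-oh polynomial on $U$ is a function $x:[0,\epsilon)\to U$ (some $\epsilon>0$, not fixed) such that for some $r\in U$, $k\in\mathbb N$, $\alpha_i\in\mathbb R^n$, $a_i>0$ one has $x(0)=r$ and $\|x(t)-r-\sum_{i=1}^k\alpha_it^{a_i}\|=o(t)$ as $t\to0^+$. Two such $x,y$ are equivalent if $x(0)=y(0)$ and $x(t)-y(t)=o(t)$; ${}^\bullet U$ is the set of equivalence classes, and ${}^\circ x:=x(0)\in U$ is the standard part. Identify ${}^\bullet U=\{x\in{}^\bullet\mathbb R^n: {}^\circ x\in U\}$ and ${}^\bullet(U\times V)={}^\bullet U\times{}^\bullet V$. A smooth map $f:U\to V$ of open subsets of Euclidean spaces has the Fermat extension ${}^\bullet f:{}^\bullet U\to{}^\bullet V$, $[x]\mapsto[f\circ x]$. The Fermat topology on ${}^\bullet\mathbb R^n$ has as open sets exactly the ${}^\bullet U$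 with $U\subseteq\mathbb R^n$ open; subsets carry the subspace topology. For $A\subseteq{}^\bullet\mathbb R^n$, $B\subseteq{}^\bullet\mathbb R^m$, a function $f:A\to B$ is quasi-standard smooth if for every $a\in A$ there are an open neighborhood $U$ of ${}^\circ a$ in $\mathbb R^n$, an open subset $P$ of a Euclidean space, a smooth map $\alpha:P\times U\to\mathbb R^m$ and a point $p\in{}^\bullet P$ with $f(x)={}^\bullet\alpha(p,x)$ for all $x\in A\cap{}^\bullet U$. SITES AND SPACES. $\mathcal S$ is the site of all open subsets of all $\mathbb R^n$, $n\in\mathbb N$, with smooth maps and usual open coverings. $\mathcal F$ is the site of all subsets of all ${}^\bullet\mathbb R^n$, with quasi-standard smooth maps and coverings by Fermat-open subsets. For $\mathcal A=\mathcal S$ or $\mathcal F$, a concrete sheaf $X$ over $\mathcal A$ is a set $|X|$ with, for each object $A$ of $\mathcal A$, a collection of functions $A\to|X|$ called sections, such that constant functions are sections, sections are stable under precomposition with morphisms of $\mathcal A$, and a function that is a section on each member of a cover of $A$ is a section. Morphisms are functions sending sections to sections by composition. Concrete sheaves over $\mathcal S$ are the diffeological spaces (sections: plots; morphisms: smooth maps; category $\mathbf{Diff}$); those over $\mathcal F$ are the Fermat spaces (sections: Fermat plots; morphisms: Fermat maps; category ${}^\bullet\mathcal C^\infty$). Each object of $\mathcal A$ is a concrete sheaf whose sections are the morphisms of $\mathcal A$ into it. PLOT CATEGORY. For a diffeological space $X$, $\mathcal S/X$ has as objects the plots $p:U\to X$ ($U\in\mathcal S$) and as morphisms from $p:U\to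 X$ to $q:V\to X$ the smooth maps $f:U\to V$ with $q\circ f=p$. One has $X=\operatorname{colim}_{U\in\mathcal S/X}U$ in $\mathbf{Diff}$. The colimit defining ${}^\bullet X$ is taken in ${}^\bullet\mathcal C^\infty$ of the diagram $(p:U\to X)\mapsto{}^\bullet U$, $f\mapsto{}^\bullet f$. A smooth map $g:X\to Y$ acts by the functor $\mathcal S/X\to\mathcal S/Y$, $p\mapsto g\circ p$. *)

theory Defs
  imports "HOL-Analysis.Analysis" "HOL-Library.Landau_Symbols"
begin

section \<open>Euclidean spaces and smooth maps\<close>

text \<open>
  Dimensions vary inside the statement, so the space of dimension n is the library's
  \<^term>\<open>Euclidean_space n\<close>: its points are the functions \<^typ>\<open>nat \<Rightarrow> real\<close> that vanish at all
  indices from n on.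
\<close>

type_synonym vec = "nat \<Rightarrow> real"

abbreviation Rn :: "nat \<Rightarrow> vec set"
  where "Rn n \<equiv> topspace (Euclidean_space n)"

definition vnorm :: "nat \<Rightarrow> vec \<Rightarrow> real"
  where "vnorm n v = L2_set v {..<n}"

text \<open>\<open>vjoin k u v\<close> is the point (u,v) of the product of spaces of dimensions k and n,
  identified with the space of dimension k + n.\<close>

definition vjoin :: "nat \<Rightarrow> vec \<Rightarrow> vec \<Rightarrow> vec"
  where "vjoin k u v = (\<lambda>i. if i < k then u i else v (i - k))"

definition vprod :: "nat \<Rightarrow> vec set \<Rightarrow> vec set \<Rightarrow> vec set"
  where "vprod k P U = {vjoin k u v | u v. u \<in> P \<and> v \<in> U}"

text \<open>Class \<open>C\<^sup>r\<close> on an open subset of \<^term>\<open>Euclidean_space n\<close>, by iterated continuous partial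
  derivatives.\<close>

primrec Cr_on :: "nat \<Rightarrow> nat \<Rightarrow> vec set \<Rightarrow> (vec \<Rightarrow> real) \<Rightarrow> bool" where
  "Cr_on 0 n U f \<longleftrightarrow> continuous_map (subtopology (Euclidean_space n) U) euclideanreal f"
| "Cr_on (Suc r) n U f \<longleftrightarrow>
     continuous_map (subtopology (Euclidean_space n) U) euclideanreal f \<and>
     (\<forall>i<n. \<exists>g. (\<forall>x\<in>U. ((\<lambda>s. f (x(i := s))) has_real_derivative g x) (at (x i))) \<and> Cr_on r n U g)"

definition smooth_maps :: "nat \<times> vec set \<Rightarrow> nat \<times> vec set \<Rightarrow> (vec \<Rightarrow> vec) set"
  where "smooth_maps A B =
    {f \<in> snd A \<rightarrow>\<^sub>E snd B. \<forall>j<fst B. \<forall>r. Cr_on r (fst A) (snd A) (\<lambda>x. f x j)}"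


section \<open>Fermat extensions\<close>

text \<open>
  A function on some interval \<open>[0, \<epsilon>)\<close> is represented by an arbitrary total function extending it.
  Equivalence only depends on the germ at 0 from the right, so each class below also contains
  every such extension and the quotient is unaffected.
\<close>

definition little_oh_poly :: "nat \<Rightarrow> vec set \<Rightarrow> (real \<Rightarrow> vec) \<Rightarrow> bool"
  where "little_oh_poly n U x \<longleftrightarrow>
    (\<exists>\<epsilon>>0. \<forall>t\<in>{0..<\<epsilon>}. x t \<in> U) \<and>
    (\<exists>r\<in>U. \<exists>k::nat. \<exists>\<alpha>::nat \<Rightarrow> vec. \<exists>a::nat \<Rightarrow> real.
       (\<forall>i\<in>{1..k}. \<alpha> i \<in> Rn n \<and> a i > 0) \<and> x 0 = r \<and>
       (\<lambda>t. vnorm n (\<lambda>j. x t j - r j - (\<Sum>i=1..k. \<alpha> i j * t powr a i))) \<in> o[at_right 0](\<lambda>t. t))"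

definition fermat_rel :: "nat \<Rightarrow> vec set \<Rightarrow> ((real \<Rightarrow> vec) \<times> (real \<Rightarrow> vec)) set"
  where "fermat_rel n U = {(x, y). little_oh_poly n U x \<and> little_oh_poly n U y \<and> x 0 = y 0 \<and>
    (\<lambda>t. vnorm n (\<lambda>j. x t j - y t j)) \<in> o[at_right 0](\<lambda>t. t)}"

type_synonym fpoint = "(real \<Rightarrow> vec) set"

definition fermat :: "nat \<Rightarrow> vec set \<Rightarrow> fpoint set"
  where "fermat n U = {x. little_oh_poly n U x} // fermat_rel n U"

definition std_part :: "fpoint \<Rightarrow> vec"
  where "std_part a = (THE r. \<exists>x\<in>a. x 0 = r)"

text \<open>The map sending [x] to [f \<open>\<circ>\<close> x], as an extensional function on \<^term>\<open>fermat n U\<close>.\<close>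

definition fermat_ext :: "nat \<times> vec set \<Rightarrow> nat \<times> vec set \<Rightarrow> (vec \<Rightarrow> vec) \<Rightarrow> fpoint \<Rightarrow> fpoint"
  where "fermat_ext A B f =
    (\<lambda>a\<in>fermat (fst A) (snd A). \<Union>x\<in>a. fermat_rel (fst B) (snd B) `` {\<lambda>t. f (x t)})"

text \<open>The point (p,x) under the identification of \<^term>\<open>fermat (k + n) (vprod k P U)\<close> with
  \<^term>\<open>fermat k P \<times> fermat n U\<close>.\<close>

definition fermat_pair :: "nat \<Rightarrow> nat \<Rightarrow> fpoint \<Rightarrow> fpoint \<Rightarrow> fpoint"
  where "fermat_pair k n p x =
    (\<Union>u\<in>p. \<Union>v\<in>x. fermat_rel (k + n) (Rn (k + n)) `` {\<lambda>t. vjoin k (u t) (v t)})"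

definition fermat_topology :: "nat \<Rightarrow> fpoint topology"
  where "fermat_topology n = topology (\<lambda>S. \<exists>U. openin (Euclidean_space n) U \<and> S = fermat n U)"

text \<open>The identification of \<^term>\<open>fermat n U\<close> with the points of \<^term>\<open>fermat n (Rn n)\<close> whose
  standard part lies in \<^term>\<open>U\<close> is a literal equality of sets of classes.\<close>

lemma little_oh_poly_coord_tendsto:
  assumes x: "little_oh_poly n (Rn n) x"
  shows "((\<lambda>t. x t j) \<longlongrightarrow> x 0 j) (at_right 0)"
proof (cases "j < n")
  case True
  obtain k :: nat and \<alpha> :: "nat \<Rightarrow> vec" and a :: "nat \<Rightarrow> real"
    where a: "\<forall>i\<in>{1..k}. \<alpha> i \<in> Rn n \<and> a i > 0"
      and o: "(\<lambda>t. vnorm n (\<lambda>j. x t j - x 0 j - (\<Sum>i=1..k. \<alpha> i j * t powr a i))) \<in> o[at_right 0](\<lambda>t. t)"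
    using x unfolding little_oh_poly_def by blast
  let ?e = "\<lambda>t. x t j - x 0 j - (\<Sum>i=1..k. \<alpha> i j * t powr a i)"
  have "(\<lambda>t::real. t) \<in> o[at_right 0](\<lambda>_. 1)"
    by (intro smalloI_tendsto) (auto intro!: tendsto_eq_intros)
  with o have "(\<lambda>t. vnorm n (\<lambda>j. x t j - x 0 j - (\<Sum>i=1..k. \<alpha> i j * t powr a i))) \<in> o[at_right 0](\<lambda>_. 1)"
    by (rule landau_o.small_trans)
  then have v0: "((\<lambda>t. vnorm n (\<lambda>j. x t j - x 0 j - (\<Sum>i=1..k. \<alpha> i j * t powr a i))) \<longlongrightarrow> 0) (at_right 0)"
    by (auto dest: smalloD_tendsto)
  have "(?e \<longlongrightarrow> 0) (at_right 0)"
  proof (rule Lim_null_comparison[OF _ v0], rule always_eventually, rule allI)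
    fix t
    have "\<bar>?e t\<bar> = L2_set (\<lambda>j. x t j - x 0 j - (\<Sum>i=1..k. \<alpha> i j * t powr a i)) {j}"
      by (simp add: L2_set_def)
    also have "\<dots> \<le> vnorm n (\<lambda>j. x t j - x 0 j - (\<Sum>i=1..k. \<alpha> i j * t powr a i))"
      unfolding vnorm_def L2_set_def using True
      by (intro real_sqrt_le_mono sum_mono2) auto
    finally show "norm (?e t) \<le> vnorm n (\<lambda>j. x t j - x 0 j - (\<Sum>i=1..k. \<alpha> i j * t powr a i))"
      by simp
  qed
  moreover have "((\<lambda>t. \<Sum>i=1..k. \<alpha> i j * t powr a i) \<longlongrightarrow> (\<Sum>i=1..k. \<alpha> i j * 0)) (at_right 0)"
  proof (intro tendsto_sum tendsto_mult tendsto_const)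
    fix i assume "i \<in> {1..k}"
    with a have "a i > 0" by blast
    then show "((\<lambda>t::real. t powr a i) \<longlongrightarrow> 0) (at_right 0)"
      by (intro tendsto_eq_rhs[OF tendsto_powr'[OF tendsto_ident_at tendsto_const]])
         (auto simp: eventually_at_filter)
  qed
  ultimately have "((\<lambda>t. x 0 j + (?e t + (\<Sum>i=1..k. \<alpha> i j * t powr a i))) \<longlongrightarrow> x 0 j + (0 + (\<Sum>i=1..k. \<alpha> i j * 0))) (at_right 0)"
    by (intro tendsto_add tendsto_const)
  then show ?thesis by simp
next
  case False
  obtain \<epsilon> where e: "\<epsilon> > 0" "\<forall>t\<in>{0..<\<epsilon>}. x t \<in> Rn n"
    using x unfolding little_oh_poly_def by blast
  then have z: "x t j = 0" if "t \<in> {0..<\<epsilon>}" for t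
    using False that by (auto simp: topspace_Euclidean_space)
  have "eventually (\<lambda>t. x t j = x 0 j) (at_right 0)"
    unfolding eventually_at_right_field using e(1) z by (intro exI[of _ \<epsilon>]) auto
  then show ?thesis by (rule tendsto_eventually)
qed

lemma little_oh_poly_open:
  assumes U: "openin (Euclidean_space n) U"
  shows "little_oh_poly n U x \<longleftrightarrow> little_oh_poly n (Rn n) x \<and> x 0 \<in> U"
proof
  assume "little_oh_poly n U x"
  then show "little_oh_poly n (Rn n) x \<and> x 0 \<in> U"
    using openin_subset[OF U] unfolding little_oh_poly_def by blast
next
  assume x: "little_oh_poly n (Rn n) x \<and> x 0 \<in> U"
  obtain \<epsilon> where e: "\<epsilon> > 0" "\<forall>t\<in>{0..<\<epsilon>}. x t \<in> Rn n"
    using x unfolding little_oh_poly_def by blast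
  obtain V where V: "openin (powertop_real UNIV) V" "U = V \<inter> {x. \<forall>i\<ge>n. x i = 0}"
    using U unfolding Euclidean_space_def openin_subtopology by blast
  have "limitin (powertop_real UNIV) x (x 0) (at_right 0)"
    unfolding limitin_componentwise using x little_oh_poly_coord_tendsto by auto
  then have "eventually (\<lambda>t. x t \<in> V) (at_right 0)"
    using V x unfolding limitin_def by blast
  then obtain d where d: "d > 0" "\<forall>t>0. t < d \<longrightarrow> x t \<in> V"
    unfolding eventually_at_right_field by auto
  have "\<forall>t\<in>{0..<min \<epsilon> d}. x t \<in> U"
  proof
    fix t assume "t \<in> {0..<min \<epsilon> d}"
    then show "x t \<in> U"
      using d(2) e(2) x V(2) by (cases "t = 0") (auto simp: topspace_Euclidean_space)
  qed
  then have "\<exists>\<epsilon>>0. \<forall>t\<in>{0..<\<epsilon>}. x t \<in> U"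
    using e(1) d(1) by (intro exI[of _ "min \<epsilon> d"]) auto
  then show "little_oh_poly n U x"
    using x unfolding little_oh_poly_def by blast
qed

lemma fermat_rel_refl: "little_oh_poly n U x \<Longrightarrow> (x, x) \<in> fermat_rel n U"
  by (simp add: fermat_rel_def vnorm_def L2_set_def)

lemma fermat_rel_open:
  assumes U: "openin (Euclidean_space n) U" and x: "little_oh_poly n U x"
  shows "fermat_rel n U `` {x} = fermat_rel n (Rn n) `` {x}"
proof (rule set_eqI)
  fix y
  have "little_oh_poly n (Rn n) x" "x 0 \<in> U"
    using x little_oh_poly_open[OF U, of x] by blast+
  moreover have "little_oh_poly n U y \<longleftrightarrow> little_oh_poly n (Rn n) y \<and> y 0 \<in> U"
    by (rule little_oh_poly_open[OF U])
  ultimately show "y \<in> fermat_rel n U `` {x} \<longleftrightarrow> y \<in> fermat_rel n (Rn n) `` {x}"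
    unfolding fermat_rel_def Image_singleton_iff mem_Collect_eq case_prod_conv
    using x by metis
qed

lemma std_part_class:
  assumes "little_oh_poly n U x"
  shows "std_part (fermat_rel n U `` {x}) = x 0"
  unfolding std_part_def
proof (rule the_equality)
  show "\<exists>y\<in>fermat_rel n U `` {x}. y 0 = x 0"
    using fermat_rel_refl[OF assms] by blast
  show "r = x 0" if "\<exists>y\<in>fermat_rel n U `` {x}. y 0 = r" for r
    using that unfolding fermat_rel_def Image_singleton_iff by force
qed

lemma fermat_open:
  assumes U: "openin (Euclidean_space n) U"
  shows "fermat n U = {a \<in> fermat n (Rn n). std_part a \<in> U}"
proof (rule set_eqI, rule iffI)
  fix a assume "a \<in> fermat n U"
  then obtain x where x: "little_oh_poly n U x" and a: "a = fermat_rel n U `` {x}"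
    unfolding fermat_def by (auto elim: quotientE)
  have x': "little_oh_poly n (Rn n) x" and x0: "x 0 \<in> U"
    using x little_oh_poly_open[OF U, of x] by blast+
  have "a \<in> fermat n (Rn n)"
    unfolding a fermat_rel_open[OF U x] fermat_def using x' by (intro quotientI) simp
  moreover have "std_part a \<in> U"
    unfolding a std_part_class[OF x] by (rule x0)
  ultimately show "a \<in> {a \<in> fermat n (Rn n). std_part a \<in> U}"
    by simp
next
  fix a assume a': "a \<in> {a \<in> fermat n (Rn n). std_part a \<in> U}"
  then obtain x where x: "little_oh_poly n (Rn n) x" and a: "a = fermat_rel n (Rn n) `` {x}"
    unfolding fermat_def by (auto elim: quotientE)
  have "x 0 \<in> U"
    using a' std_part_class[OF x] by (simp add: a)
  then have xU: "little_oh_poly n U x"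
    using x little_oh_poly_open[OF U, of x] by blast
  show "a \<in> fermat n U"
    unfolding a fermat_rel_open[OF U xU, symmetric] fermat_def using xU by (intro quotientI) simp
qed

lemma istopology_fermat:
  "istopology (\<lambda>S. \<exists>U. openin (Euclidean_space n) U \<and> S = fermat n U)"
  unfolding istopology_def
proof (intro conjI allI impI)
  fix S T
  assume "\<exists>U. openin (Euclidean_space n) U \<and> S = fermat n U"
    and "\<exists>U. openin (Euclidean_space n) U \<and> T = fermat n U"
  then obtain U V where op: "openin (Euclidean_space n) U" "openin (Euclidean_space n) V"
      and eq: "S = fermat n U" "T = fermat n V"
    by blast
  have "S \<inter> T = fermat n (U \<inter> V)"
    unfolding eq fermat_open[OF op(1)] fermat_open[OF op(2)] fermat_open[OF openin_Int[OF op]]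
    by blast
  then show "\<exists>U. openin (Euclidean_space n) U \<and> S \<inter> T = fermat n U"
    using openin_Int[OF op] by blast
next
  fix \<K>
  assume "\<forall>K\<in>\<K>. \<exists>U. openin (Euclidean_space n) U \<and> K = fermat n U"
  then obtain u where u: "\<And>K. K \<in> \<K> \<Longrightarrow> openin (Euclidean_space n) (u K)"
      and K: "\<And>K. K \<in> \<K> \<Longrightarrow> K = fermat n (u K)"
    by metis
  have op: "openin (Euclidean_space n) (\<Union>K\<in>\<K>. u K)"
    using u by (intro openin_Union) auto
  have mem: "a \<in> K \<longleftrightarrow> a \<in> fermat n (Rn n) \<and> std_part a \<in> u K" if "K \<in> \<K>" for a K
    by (subst K[OF that], subst fermat_open[OF u[OF that]]) (rule mem_Collect_eq)
  have "\<Union>\<K> = {a \<in> fermat n (Rn n). std_part a \<in> (\<Union>K\<in>\<K>. u K)}"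
    using mem by blast
  also have "\<dots> = fermat n (\<Union>K\<in>\<K>. u K)"
    by (rule fermat_open[OF op, symmetric])
  finally show "\<exists>U. openin (Euclidean_space n) U \<and> \<Union>\<K> = fermat n U"
    using op by blast
qed

lemma openin_fermat_topology:
  "openin (fermat_topology n) S \<longleftrightarrow> (\<exists>U. openin (Euclidean_space n) U \<and> S = fermat n U)"
  by (simp add: fermat_topology_def topology_inverse'[OF istopology_fermat])

definition qs_smooth_maps :: "nat \<times> fpoint set \<Rightarrow> nat \<times> fpoint set \<Rightarrow> (fpoint \<Rightarrow> fpoint) set"
  where "qs_smooth_maps A B = {f \<in> snd A \<rightarrow>\<^sub>E snd B.
    \<forall>a\<in>snd A. \<exists>U k P \<alpha>. \<exists>p\<in>fermat k P.
      openin (Euclidean_space (fst A)) U \<and> std_part a \<in> U \<and>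
      openin (Euclidean_space k) P \<and>
      \<alpha> \<in> smooth_maps (k + fst A, vprod k P U) (fst B, Rn (fst B)) \<and>
      (\<forall>x\<in>snd A \<inter> fermat (fst A) U.
         f x = fermat_ext (k + fst A, vprod k P U) (fst B, Rn (fst B)) \<alpha>
                 (fermat_pair k (fst A) p x))}"


section \<open>Categories, functors and sites\<close>

text \<open>Hom-sets consist of extensional functions throughout, so that equality of morphisms is
  equality in HOL. \<open>Comp C X Y Z g f\<close> is the composite of \<open>f : X \<rightarrow> Y\<close> and \<open>g : Y \<rightarrow> Z\<close>.\<close>

record ('o, 'm) category =
  Obj :: "'o set"
  Hom :: "'o \<Rightarrow> 'o \<Rightarrow> 'm set"
  Ident :: "'o \<Rightarrow> 'm"
  Comp :: "'o \<Rightarrow> 'o \<Rightarrow> 'o \<Rightarrow> 'm \<Rightarrow> 'm \<Rightarrow> 'm"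

definition is_category :: "('o, 'm, 'z) category_scheme \<Rightarrow> bool"
  where "is_category C \<longleftrightarrow>
    (\<forall>X\<in>Obj C. Ident C X \<in> Hom C X X) \<and>
    (\<forall>X\<in>Obj C. \<forall>Y\<in>Obj C. \<forall>Z\<in>Obj C. \<forall>f\<in>Hom C X Y. \<forall>g\<in>Hom C Y Z.
       Comp C X Y Z g f \<in> Hom C X Z) \<and>
    (\<forall>X\<in>Obj C. \<forall>Y\<in>Obj C. \<forall>f\<in>Hom C X Y.
       Comp C X X Y f (Ident C X) = f \<and> Comp C X Y Y (Ident C Y) f = f) \<and>
    (\<forall>W\<in>Obj C. \<forall>X\<in>Obj C. \<forall>Y\<in>Obj C. \<forall>Z\<in>Obj C.
       \<forall>f\<in>Hom C W X. \<forall>g\<in>Hom C X Y. \<forall>h\<in>Hom C Y Z.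
       Comp C W X Z (Comp C X Y Z h g) f = Comp C W Y Z h (Comp C W X Y g f))"

definition is_functor ::
    "('o, 'm, 'z) category_scheme \<Rightarrow> ('p, 'n, 'y) category_scheme \<Rightarrow>
     ('o \<Rightarrow> 'p) \<Rightarrow> ('o \<Rightarrow> 'o \<Rightarrow> 'm \<Rightarrow> 'n) \<Rightarrow> bool"
  where "is_functor C D Fo Fm \<longleftrightarrow>
    is_category C \<and> is_category D \<and>
    (\<forall>X\<in>Obj C. Fo X \<in> Obj D) \<and>
    (\<forall>X\<in>Obj C. \<forall>Y\<in>Obj C. \<forall>f\<in>Hom C X Y. Fm X Y f \<in> Hom D (Fo X) (Fo Y)) \<and>
    (\<forall>X\<in>Obj C. Fm X X (Ident C X) = Ident D (Fo X)) \<and>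
    (\<forall>X\<in>Obj C. \<forall>Y\<in>Obj C. \<forall>Z\<in>Obj C. \<forall>f\<in>Hom C X Y. \<forall>g\<in>Hom C Y Z.
       Fm X Z (Comp C X Y Z g f) = Comp D (Fo X) (Fo Y) (Fo Z) (Fm Y Z g) (Fm X Y f))"

text \<open>The two sites have as objects pairs (n,A) of a dimension and a set of points. A cover of an
  object is given by subobjects, with the inclusions as covering maps.\<close>

record 'p site = "(nat \<times> 'p set, 'p \<Rightarrow> 'p) category" +
  Cov :: "nat \<times> 'p set \<Rightarrow> (nat \<times> 'p set) set set"

definition smooth_site :: "vec site"
  where "smooth_site =
    \<lparr>Obj = {(n, U). openin (Euclidean_space n) U},
     Hom = smooth_maps,
     Ident = (\<lambda>A. \<lambda>x\<in>snd A. x),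
     Comp = (\<lambda>A B C g f. compose (snd A) g f),
     Cov = (\<lambda>(n, U). {Pair n ` \<U> | \<U>. (\<forall>V\<in>\<U>. openin (Euclidean_space n) V) \<and> \<Union>\<U> = U})\<rparr>"

definition fermat_site :: "fpoint site"
  where "fermat_site =
    \<lparr>Obj = {(n, A). A \<subseteq> fermat n (Rn n)},
     Hom = qs_smooth_maps,
     Ident = (\<lambda>A. \<lambda>x\<in>snd A. x),
     Comp = (\<lambda>A B C g f. compose (snd A) g f),
     Cov = (\<lambda>(n, A). {Pair n ` \<B> | \<B>.
              (\<forall>B\<in>\<B>. openin (subtopology (fermat_topology n) A) B) \<and> \<Union>\<B> = A})\<rparr>"

definition fermat_obj :: "nat \<times> vec set \<Rightarrow> nat \<times> fpoint set"
  where "fermat_obj A = (fst A, fermat (fst A) (snd A))"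


section \<open>Concrete sheaves\<close>

record ('p, 'a) csheaf =
  Pts :: "'a set"
  Sec :: "nat \<times> 'p set \<Rightarrow> ('p \<Rightarrow> 'a) set"

text \<open>The clause for non-objects only normalises the record, so that a concrete sheaf is
  determined by its points and its sections on objects.\<close>

definition is_csheaf :: "'p site \<Rightarrow> ('p, 'a) csheaf \<Rightarrow> bool"
  where "is_csheaf \<A> X \<longleftrightarrow>
    (\<forall>A. A \<notin> Obj \<A> \<longrightarrow> Sec X A = {}) \<and>
    (\<forall>A\<in>Obj \<A>. Sec X A \<subseteq> snd A \<rightarrow>\<^sub>E Pts X) \<and>
    (\<forall>A\<in>Obj \<A>. \<forall>c\<in>Pts X. (\<lambda>_\<in>snd A. c) \<in> Sec X A) \<and>
    (\<forall>A\<in>Obj \<A>. \<forall>B\<in>Obj \<A>. \<forall>f\<in>Hom \<A> B A. \<forall>s\<in>Sec X A. compose (snd B) s f \<in> Sec X B) \<and>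
    (\<forall>A\<in>Obj \<A>. \<forall>\<C>\<in>Cov \<A> A. \<forall>s\<in>snd A \<rightarrow>\<^sub>E Pts X.
       (\<forall>B\<in>\<C>. restrict s (snd B) \<in> Sec X B) \<longrightarrow> s \<in> Sec X A)"

definition csheaf_maps :: "'p site \<Rightarrow> ('p, 'a) csheaf \<Rightarrow> ('p, 'b) csheaf \<Rightarrow> ('a \<Rightarrow> 'b) set"
  where "csheaf_maps \<A> X Y =
    {f \<in> Pts X \<rightarrow>\<^sub>E Pts Y. \<forall>A\<in>Obj \<A>. \<forall>s\<in>Sec X A. compose (snd A) f s \<in> Sec Y A}"

definition csheaf_category :: "'p site \<Rightarrow> (('p, 'a) csheaf, 'a \<Rightarrow> 'a) category"
  where "csheaf_category \<A> =
    \<lparr>Obj = {X. is_csheaf \<A> X},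
     Hom = csheaf_maps \<A>,
     Ident = (\<lambda>X. \<lambda>x\<in>Pts X. x),
     Comp = (\<lambda>X Y Z g f. compose (Pts X) g f)\<rparr>"

type_synonym 'a diffeology = "(vec, 'a) csheaf"
type_synonym 'a fermat_space = "(fpoint, 'a) csheaf"

abbreviation Diff :: "('a diffeology, 'a \<Rightarrow> 'a) category"
  where "Diff \<equiv> csheaf_category smooth_site"

abbreviation FermatSpaces :: "('a fermat_space, 'a \<Rightarrow> 'a) category"
  where "FermatSpaces \<equiv> csheaf_category fermat_site"

definition representable :: "'p site \<Rightarrow> nat \<times> 'p set \<Rightarrow> ('p, 'p) csheaf"
  where "representable \<A> A =
    \<lparr>Pts = snd A, Sec = (\<lambda>B. if B \<in> Obj \<A> then Hom \<A> B A else {})\<rparr>"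


section \<open>Colimits of concrete sheaves\<close>

text \<open>A diagram of shape J is given by its object part \<open>Do\<close> and its morphism part \<open>Dm\<close>. The test
  objects of the universal property may live on any type \<open>'c\<close>, independent of the type carrying the
  colimit; as HOL cannot quantify over types inside a formula, \<open>'c\<close> is an explicit parameter.\<close>

definition is_cocone ::
    "'p site \<Rightarrow> ('o, 'm) category \<Rightarrow> ('o \<Rightarrow> ('p, 'd) csheaf) \<Rightarrow> ('o \<Rightarrow> 'o \<Rightarrow> 'm \<Rightarrow> 'd \<Rightarrow> 'd) \<Rightarrow>
     ('p, 'a) csheaf \<Rightarrow> ('o \<Rightarrow> 'd \<Rightarrow> 'a) \<Rightarrow> bool"
  where "is_cocone \<A> J Do Dm L \<iota> \<longleftrightarrow>
    is_csheaf \<A> L \<and>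
    (\<forall>i\<in>Obj J. \<iota> i \<in> csheaf_maps \<A> (Do i) L) \<and>
    (\<forall>i\<in>Obj J. \<forall>j\<in>Obj J. \<forall>f\<in>Hom J i j. compose (Pts (Do i)) (\<iota> j) (Dm i j f) = \<iota> i)"

definition is_colimit ::
    "'c itself \<Rightarrow> 'p site \<Rightarrow> ('o, 'm) category \<Rightarrow> ('o \<Rightarrow> ('p, 'd) csheaf) \<Rightarrow>
     ('o \<Rightarrow> 'o \<Rightarrow> 'm \<Rightarrow> 'd \<Rightarrow> 'd) \<Rightarrow> ('p, 'a) csheaf \<Rightarrow> ('o \<Rightarrow> 'd \<Rightarrow> 'a) \<Rightarrow> bool"
  where "is_colimit (_ :: 'c itself) \<A> J Do Dm L \<iota> \<longleftrightarrow>
    is_cocone \<A> J Do Dm L \<iota> \<and>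
    (\<forall>(Z :: ('p, 'c) csheaf) \<kappa>. is_cocone \<A> J Do Dm Z \<kappa> \<longrightarrow>
       (\<exists>!h. h \<in> csheaf_maps \<A> L Z \<and> (\<forall>i\<in>Obj J. compose (Pts (Do i)) h (\<iota> i) = \<kappa> i)))"

text \<open>The standard model of the colimit: the colimit of the sets of points, with the functions
  that locally lift to a section of some member of the diagram as sections.\<close>

definition colim_rel ::
    "('o, 'm) category \<Rightarrow> ('o \<Rightarrow> ('p, 'd) csheaf) \<Rightarrow> ('o \<Rightarrow> 'o \<Rightarrow> 'm \<Rightarrow> 'd \<Rightarrow> 'd) \<Rightarrow>
     (('o \<times> 'd) \<times> ('o \<times> 'd)) set"
  where "colim_rel J Do Dm = {(u, v). equivclp (\<lambda>(i, x) (j, y).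
     i \<in> Obj J \<and> j \<in> Obj J \<and> x \<in> Pts (Do i) \<and> (\<exists>f\<in>Hom J i j. y = Dm i j f x)) u v}"

definition colim_in ::
    "('o, 'm) category \<Rightarrow> ('o \<Rightarrow> ('p, 'd) csheaf) \<Rightarrow> ('o \<Rightarrow> 'o \<Rightarrow> 'm \<Rightarrow> 'd \<Rightarrow> 'd) \<Rightarrow>
     'o \<Rightarrow> 'd \<Rightarrow> ('o \<times> 'd) set"
  where "colim_in J Do Dm i = (\<lambda>x\<in>Pts (Do i). colim_rel J Do Dm `` {(i, x)})"

definition colim ::
    "'p site \<Rightarrow> ('o, 'm) category \<Rightarrow> ('o \<Rightarrow> ('p, 'd) csheaf) \<Rightarrow> ('o \<Rightarrow> 'o \<Rightarrow> 'm \<Rightarrow> 'd \<Rightarrow> 'd) \<Rightarrow>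
     ('p, ('o \<times> 'd) set) csheaf"
  where "colim \<A> J Do Dm =
    \<lparr>Pts = (SIGMA i:Obj J. Pts (Do i)) // colim_rel J Do Dm,
     Sec = (\<lambda>A. if A \<in> Obj \<A>
       then {s \<in> extensional (snd A). \<exists>\<C>\<in>Cov \<A> A. \<forall>B\<in>\<C>. \<exists>i\<in>Obj J. \<exists>\<sigma>\<in>Sec (Do i) B.
               restrict s (snd B) = compose (snd B) (colim_in J Do Dm i) \<sigma>}
       else {})\<rparr>"


section \<open>The plot category and the Fermat extension of a diffeological space\<close>

type_synonym 'a plot = "(nat \<times> vec set) \<times> (vec \<Rightarrow> 'a)"

definition plot_category :: "'a diffeology \<Rightarrow> ('a plot, vec \<Rightarrow> vec) category"
  where "plot_category X =
    \<lparr>Obj = {(U, p). U \<in> Obj smooth_site \<and> p \<in> Sec X U},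
     Hom = (\<lambda>(U, p) (V, q). {f \<in> Hom smooth_site U V. compose (snd U) q f = p}),
     Ident = (\<lambda>(U, p). Ident smooth_site U),
     Comp = (\<lambda>(U, p) (V, q) (W, r). Comp smooth_site U V W)\<rparr>"

text \<open>The tautological diagram of the domains of the plots of X, and its image under the Fermat
  extension.\<close>

definition plot_dom :: "'a plot \<Rightarrow> vec diffeology"
  where "plot_dom j = representable smooth_site (fst j)"

definition fermat_plot_dom :: "'a plot \<Rightarrow> fpoint fermat_space"
  where "fermat_plot_dom j = representable fermat_site (fermat_obj (fst j))"

definition fermat_plot_map :: "'a plot \<Rightarrow> 'a plot \<Rightarrow> (vec \<Rightarrow> vec) \<Rightarrow> fpoint \<Rightarrow> fpoint"
  where "fermat_plot_map i j f = fermat_ext (fst i) (fst j) f"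

definition fermat_space :: "'a diffeology \<Rightarrow> ('a plot \<times> fpoint) set fermat_space"
  where "fermat_space X = colim fermat_site (plot_category X) fermat_plot_dom fermat_plot_map"

definition fermat_in :: "'a diffeology \<Rightarrow> 'a plot \<Rightarrow> fpoint \<Rightarrow> ('a plot \<times> fpoint) set"
  where "fermat_in X = colim_in (plot_category X) fermat_plot_dom fermat_plot_map"

definition plot_comp :: "('a \<Rightarrow> 'b) \<Rightarrow> 'a plot \<Rightarrow> 'b plot"
  where "plot_comp g j = (fst j, compose (snd (fst j)) g (snd j))"

definition fermat_map ::
    "'a diffeology \<Rightarrow> 'b diffeology \<Rightarrow> ('a \<Rightarrow> 'b) \<Rightarrow> ('a plot \<times> fpoint) set \<Rightarrow> ('b plot \<times> fpoint) set"
  where "fermat_map X Y g = (THE h. h \<in> csheaf_maps fermat_site (fermat_space X) (fermat_space Y) \<and>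
    (\<forall>j\<in>Obj (plot_category X).
       compose (Pts (fermat_plot_dom j)) h (fermat_in X j) = fermat_in Y (plot_comp g j)))"

end

theory Submission
  imports Defs
begin

text \<open>
  The proof has an analytic and a formal half.

  The analytic half rests on one fact: composition with a smooth function carries little-oh
  polynomials to little-oh polynomials and preserves the relation \<open>x - y = o(t)\<close>. A curve x that
  stays in its domain near 0 is a little-oh polynomial exactly if every coordinate of \<open>x - x 0\<close> is, up to \<open>o(t)\<close>, a finite sum of
  terms \<open>c * t powr a\<close> with \<open>a > 0\<close> (\<open>little_oh_poly_iff_frac_germ\<close>). Such germs are closed under sums
  and products, and each of them is \<open>O(t powr b)\<close> for some \<open>b > 0\<close>. In the Taylor expansion of f at
  \<open>x 0\<close> in the direction \<open>x t - x 0\<close> the terms of positive order are therefore germs of the same kind,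
  and the remainder of order N is \<open>O(t powr (b * N))\<close>, which is \<open>o(t)\<close> as soon as \<open>b * N > 1\<close>
  (\<open>smooth_fn_little_oh_poly\<close>). The relation is preserved because a smooth function is locally
  Lipschitz (\<open>smooth_fn_smallo\<close>). Hence the Fermat extension of f is composition with f on
  representatives (\<open>fermat_ext_fermat_class\<close>), which makes its functoriality evident; it is quasi-standard
  smooth with a one-point parameter space. The quasi-standard smooth maps compose because the
  parameters p and q of two maps can be joined to the single parameter (q,p), once the domains have
  been shrunk so that the composite of the two families is defined (\<open>qs_smooth_compose\<close>).

  The formal half holds over any site of sets and functions. The quotient of the disjoint union of
  the points of a diagram, with the functions that lift locally to a member of the diagram as
  sections, is a colimit (\<open>colim_is_colimit\<close>): a cocone \<open>\<kappa>\<close> induces the map sending the class of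
  (i,x) to \<open>\<kappa> i x\<close>, and the sheaf condition of its vertex turns local lifts into sections. Over the
  Fermat site this gives the universal property of the Fermat extension of X. That X itself is the
  colimit of its plots holds because every section of X is an object of the diagram, and the constant
  plots on the one-point space reach every point. The map induced by \<open>g : X \<rightarrow> Y\<close> is
  the one determined by the cocone of the plots \<open>g \<circ> p\<close> of Y, and uniqueness of such maps yields
  functoriality.
\<close>

section \<open>Cubes and continuity in Euclidean spaces\<close>

text \<open>
  The open ball of the maximum norm in the space of dimension n. Membership is a condition on each
  coordinate separately, so it can be checked after changing the coordinates of a point one at a
  time, and the product of two cubes of equal radius is again a cube.
\<close>

definition open_cube :: "nat \<Rightarrow> vec \<Rightarrow> real \<Rightarrow> vec set"
  where "open_cube n c d = {y \<in> Rn n. \<forall>i<n. \<bar>y i - c i\<bar> < d}"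

lemma Rn_iff: "x \<in> Rn n \<longleftrightarrow> (\<forall>i\<ge>n. x i = 0)"
  by (simp add: topspace_Euclidean_space)

lemma centre_in_open_cube: "c \<in> Rn n \<Longrightarrow> 0 < d \<Longrightarrow> c \<in> open_cube n c d"
  by (simp add: open_cube_def)

lemma openin_open_cube: "openin (Euclidean_space n) (open_cube n c d)"
proof -
  have "openin (powertop_real UNIV) (\<Pi>\<^sub>E i\<in>UNIV. if i < n then ball (c i) d else UNIV)"
    by (rule product_topology_basis) auto
  moreover have "open_cube n c d = (\<Pi>\<^sub>E i\<in>UNIV. if i < n then ball (c i) d else UNIV) \<inter> {x. \<forall>i\<ge>n. x i = 0}"
    by (auto simp: open_cube_def Rn_iff dist_real_def abs_minus_commute PiE_iff split: if_splits)
  ultimately show ?thesis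
    unfolding Euclidean_space_def openin_subtopology by blast
qed

text \<open>
  The topology is inherited from a product of countably many lines. A basic open set around a point of
  the space contains every point of the space that is close to it in the first n coordinates, since
  all further coordinates agree.
\<close>

lemma openin_iff_open_cube:
  "openin (Euclidean_space n) U \<longleftrightarrow> U \<subseteq> Rn n \<and> (\<forall>c\<in>U. \<exists>d>0. open_cube n c d \<subseteq> U)"
proof (intro iffI conjI ballI)
  assume U: "openin (Euclidean_space n) U"
  show "U \<subseteq> Rn n" using openin_subset[OF U] .
  fix c assume c: "c \<in> U"
  obtain V where V: "openin (powertop_real UNIV) V" "U = V \<inter> {x. \<forall>i\<ge>n. x i = 0}"
    using U unfolding Euclidean_space_def openin_subtopology by blast
  obtain B where B: "\<forall>i. open (B i)" "c \<in> (\<Pi>\<^sub>E i\<in>UNIV. B i)" "(\<Pi>\<^sub>E i\<in>UNIV. B i) \<subseteq> V"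
    using V(1) c V(2) unfolding openin_product_topology_alt by (auto 0 3)
  have "\<exists>d>0. ball (c i) d \<subseteq> B i" for i
    using B by (auto simp: open_contains_ball PiE_iff)
  then obtain d where d: "\<And>i. d i > 0" "\<And>i. ball (c i) (d i) \<subseteq> B i" by metis
  define e where "e = Min (insert 1 (d ` {..<n}))"
  have e: "e > 0" "\<And>i. i < n \<Longrightarrow> e \<le> d i"
    unfolding e_def using d(1) by (auto simp: Min_gr_iff)
  have "open_cube n c e \<subseteq> U"
  proof
    fix y assume y: "y \<in> open_cube n c e"
    have "y i \<in> B i" for i
    proof (cases "i < n")
      case True
      then have "y i \<in> ball (c i) (d i)"
        using y e(2)[OF True] by (force simp: open_cube_def dist_real_def abs_minus_commute)
      then show ?thesis using d(2) by blast
    next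
      case False
      then show ?thesis using y B(2) c V(2) by (force simp: open_cube_def Rn_iff PiE_iff)
    qed
    then show "y \<in> U" using B(3) y by (auto simp: V(2) open_cube_def Rn_iff PiE_iff)
  qed
  with e(1) show "\<exists>d>0. open_cube n c d \<subseteq> U" by blast
next
  assume U: "U \<subseteq> Rn n \<and> (\<forall>c\<in>U. \<exists>d>0. open_cube n c d \<subseteq> U)"
  show "openin (Euclidean_space n) U"
  proof (subst openin_subopen, intro ballI)
    fix c assume c: "c \<in> U"
    then obtain d where "d > 0" "open_cube n c d \<subseteq> U" using U by metis
    moreover have "c \<in> open_cube n c d"
      using U c \<open>d > 0\<close> by (intro centre_in_open_cube) auto
    ultimately show "\<exists>T. openin (Euclidean_space n) T \<and> c \<in> T \<and> T \<subseteq> U"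
      by (intro exI[of _ "open_cube n c d"] conjI openin_open_cube)
  qed
qed

lemma openin_Rn: "openin (Euclidean_space n) (Rn n)"
  by (rule openin_topspace)

text \<open>
  Stated for an arbitrary filter, so that it covers both difference quotients at a point and germs of
  curves at 0 from the right.
\<close>

definition coord_tendsto :: "nat \<Rightarrow> ('a \<Rightarrow> vec) \<Rightarrow> vec \<Rightarrow> 'a filter \<Rightarrow> bool"
  where "coord_tendsto n \<gamma> c F \<longleftrightarrow> (\<forall>i<n. ((\<lambda>s. \<gamma> s i) \<longlongrightarrow> c i) F)"

lemma eventually_in_open_cube:
  assumes "coord_tendsto n \<gamma> c F" "eventually (\<lambda>s. \<gamma> s \<in> Rn n) F" "d > 0"
  shows "eventually (\<lambda>s. \<gamma> s \<in> open_cube n c d) F"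
proof -
  have "eventually (\<lambda>s. \<forall>i\<in>{..<n}. \<bar>\<gamma> s i - c i\<bar> < d) F"
    using assms(1,3) unfolding coord_tendsto_def
    by (intro eventually_ball_finite) (auto simp: tendsto_iff dist_real_def)
  with assms(2) show ?thesis by eventually_elim (simp add: open_cube_def)
qed

lemma continuous_tendsto:
  assumes f: "continuous_map (subtopology (Euclidean_space n) U) euclideanreal f"
    and U: "openin (Euclidean_space n) U" and c: "c \<in> U"
    and \<gamma>: "coord_tendsto n \<gamma> c F" "eventually (\<lambda>s. \<gamma> s \<in> U) F"
  shows "((\<lambda>s. f (\<gamma> s)) \<longlongrightarrow> f c) F"
proof (rule tendstoI)
  fix e :: real assume e: "e > 0"
  have "openin (Euclidean_space n) {y \<in> U. f y \<in> ball (f c) e}"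
    using openin_continuous_map_preimage[OF f, of "ball (f c) e"] openin_subset[OF U]
    by (simp add: topspace_subtopology inf_absorb2 openin_open_subtopology[OF U])
  then obtain d where d: "d > 0" "open_cube n c d \<subseteq> {y \<in> U. f y \<in> ball (f c) e}"
    using c e unfolding openin_iff_open_cube by auto
  have "eventually (\<lambda>s. \<gamma> s \<in> Rn n) F"
    using \<gamma>(2) by eventually_elim (use openin_subset[OF U] in blast)
  from eventually_in_open_cube[OF \<gamma>(1) this d(1)]
  show "eventually (\<lambda>s. dist (f (\<gamma> s)) (f c) < e) F"
    by eventually_elim (use d(2) in \<open>auto simp: dist_commute\<close>)
qed

lemma continuous_map_into_open:
  assumes \<phi>: "\<phi> \<in> topspace X \<rightarrow> V" and V: "V \<subseteq> Rn m"
    and co: "\<And>j. j < m \<Longrightarrow> continuous_map X euclideanreal (\<lambda>x. \<phi> x j)"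
  shows "continuous_map X (subtopology (Euclidean_space m) V) \<phi>"
proof -
  have "continuous_map X euclideanreal (\<lambda>x. \<phi> x j)" for j
  proof (cases "j < m")
    case False
    then have "\<phi> x j = 0" if "x \<in> topspace X" for x
      using \<phi> V that by (force simp: Rn_iff)
    then show ?thesis by (auto intro: continuous_map_eq[where f = "\<lambda>_. 0"])
  qed (rule co)
  then show ?thesis
    using \<phi> V unfolding Euclidean_space_def
    by (auto simp: continuous_map_in_subtopology continuous_map_componentwise_UNIV Rn_iff)
qed

lemma openin_preimage:
  assumes V: "openin (Euclidean_space m) V" and U: "openin (Euclidean_space n) U"
    and D: "V' \<subseteq> Rn m" and \<phi>: "\<phi> \<in> U \<rightarrow> V'"
    and co: "\<And>j. j < m \<Longrightarrow> continuous_map (subtopology (Euclidean_space n) U) euclideanreal (\<lambda>x. \<phi> x j)"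
  shows "openin (Euclidean_space n) {x \<in> U. \<phi> x \<in> V}"
proof -
  have tU: "topspace (subtopology (Euclidean_space n) U) = U"
    using openin_subset[OF U] by auto
  have "continuous_map (subtopology (Euclidean_space n) U) (subtopology (Euclidean_space m) (Rn m)) \<phi>"
    using \<phi> D tU by (intro continuous_map_into_open co) auto
  then have "continuous_map (subtopology (Euclidean_space n) U) (Euclidean_space m) \<phi>"
    by simp
  from openin_continuous_map_preimage[OF this V]
  show ?thesis unfolding tU openin_open_subtopology[OF U] by blast
qed

lemma coordinate_continuous: "continuous_map (subtopology (Euclidean_space n) U) euclideanreal (\<lambda>x. x j)"
  unfolding Euclidean_space_def subtopology_subtopology
  by (intro continuous_map_from_subtopology continuous_map_product_projection) simp

lemma subset_Rn: "openin (Euclidean_space n) U \<Longrightarrow> U \<subseteq> Rn n"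
  by (rule openin_subset)

section \<open>The calculus of functions of class \<open>C\<^sup>r\<close>\<close>

lemma eventually_fun_upd:
  assumes U: "openin (Euclidean_space n) U" and x: "x \<in> U" and i: "i < n"
  shows "eventually (\<lambda>s. x(i := s) \<in> U) (nhds (x i))"
proof -
  obtain d where d: "d > 0" "open_cube n x d \<subseteq> U"
    using U x unfolding openin_iff_open_cube by blast
  have "x(i := s) \<in> U" if "dist s (x i) < d" for s
    using that d i x subset_Rn[OF U]
    by (intro subsetD[OF d(2)]) (auto simp: open_cube_def Rn_iff dist_real_def subset_iff)
  then show ?thesis using d(1) by (auto simp: eventually_nhds_metric)
qed

lemma Cr_on_continuous: "Cr_on r n U f \<Longrightarrow> continuous_map (subtopology (Euclidean_space n) U) euclideanreal f"
  by (cases r) auto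

text \<open>
  Since U is open, the partial difference quotients at a point of U eventually only involve values
  on U.
\<close>

lemma Cr_on_cong:
  assumes U: "openin (Euclidean_space n) U" and eq: "\<And>x. x \<in> U \<Longrightarrow> f x = g x" and f: "Cr_on r n U f"
  shows "Cr_on r n U g"
proof -
  have cg: "continuous_map (subtopology (Euclidean_space n) U) euclideanreal g"
    using Cr_on_continuous[OF f] by (rule continuous_map_eq) (simp add: eq)
  show ?thesis
  proof (cases r)
    case 0 then show ?thesis using cg by simp
  next
    case (Suc k)
    have "\<exists>g'. (\<forall>x\<in>U. ((\<lambda>s. g (x(i := s))) has_real_derivative g' x) (at (x i))) \<and> Cr_on k n U g'"
      if i: "i < n" for i
    proof -
      obtain f' where f': "\<forall>x\<in>U. ((\<lambda>s. f (x(i := s))) has_real_derivative f' x) (at (x i))" "Cr_on k n U f'"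
        using f i unfolding Suc by auto
      have "((\<lambda>s. g (x(i := s))) has_real_derivative f' x) (at (x i))" if x: "x \<in> U" for x
      proof -
        have "eventually (\<lambda>s. f (x(i := s)) = g (x(i := s))) (nhds (x i))"
          using eventually_fun_upd[OF U x i] by eventually_elim (rule eq)
        from DERIV_cong_ev[OF refl this refl] f'(1) x show ?thesis by blast
      qed
      with f'(2) show ?thesis by blast
    qed
    then show ?thesis using cg by (simp add: Suc)
  qed
qed

lemma Cr_on_subset:
  assumes "Cr_on r n U f" "V \<subseteq> U"
  shows "Cr_on r n V f"
  using assms(1)
proof (induction r arbitrary: f)
  case (Suc r)
  then show ?case using assms(2)
    by (auto intro: continuous_map_from_subtopology_mono) (meson subsetD)
qed (use assms(2) continuous_map_from_subtopology_mono in auto)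

lemma Cr_on_Suc_imp: "Cr_on (Suc r) n U f \<Longrightarrow> Cr_on r n U f"
proof (induction r arbitrary: f)
  case (Suc r)
  show ?case
    unfolding Cr_on.simps(2)[of r]
  proof (intro conjI allI impI)
    show "continuous_map (subtopology (Euclidean_space n) U) euclideanreal f"
      by (rule Cr_on_continuous[OF Suc.prems])
    fix i assume "i < n"
    with Suc.prems obtain g where "\<forall>x\<in>U. ((\<lambda>s. f (x(i := s))) has_real_derivative g x) (at (x i))"
      "Cr_on (Suc r) n U g" unfolding Cr_on.simps(2)[of "Suc r"] by blast
    with Suc.IH show "\<exists>g. (\<forall>x\<in>U. ((\<lambda>s. f (x(i := s))) has_real_derivative g x) (at (x i))) \<and> Cr_on r n U g"
      by blast
  qed
qed simp

text \<open>
  A function of class \<open>C\<^sup>r\<close> comes with the mere existence of its partial derivatives. Naming them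
  makes iterated derivatives available as terms.
\<close>

definition partial_deriv :: "nat \<Rightarrow> (vec \<Rightarrow> real) \<Rightarrow> vec \<Rightarrow> real"
  where "partial_deriv i f x = deriv (\<lambda>s. f (x(i := s))) (x i)"

lemma Cr_on_SucD:
  assumes U: "openin (Euclidean_space n) U" and f: "Cr_on (Suc r) n U f" and i: "i < n"
  shows "Cr_on r n U (partial_deriv i f)"
    and "x \<in> U \<Longrightarrow> ((\<lambda>s. f (x(i := s))) has_real_derivative partial_deriv i f x) (at (x i))"
proof -
  obtain g where g: "\<forall>x\<in>U. ((\<lambda>s. f (x(i := s))) has_real_derivative g x) (at (x i))" "Cr_on r n U g"
    using f i by auto
  have eq: "g x = partial_deriv i f x" if "x \<in> U" for x
    using g(1) that unfolding partial_deriv_def by (metis DERIV_imp_deriv)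
  show "Cr_on r n U (partial_deriv i f)" using Cr_on_cong[OF U eq g(2)] .
  show "((\<lambda>s. f (x(i := s))) has_real_derivative partial_deriv i f x) (at (x i))" if "x \<in> U"
    using g(1) that eq by metis
qed

lemma Cr_on_SucI:
  assumes "continuous_map (subtopology (Euclidean_space n) U) euclideanreal f"
    and "\<And>i x. i < n \<Longrightarrow> x \<in> U \<Longrightarrow> ((\<lambda>s. f (x(i := s))) has_real_derivative g i x) (at (x i))"
    and "\<And>i. i < n \<Longrightarrow> Cr_on r n U (g i)"
  shows "Cr_on (Suc r) n U f"
  using assms by auto

lemma Cr_on_const: "Cr_on r n U (\<lambda>_. c)"
proof (induction r arbitrary: c)
  case (Suc r)
  show ?case by (rule Cr_on_SucI[where g = "\<lambda>_ _. 0"]) (auto simp: Suc)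
qed simp

lemma Cr_on_coordinate: "Cr_on r n U (\<lambda>x. x j)"
proof (cases r)
  case (Suc k)
  show ?thesis unfolding Suc
    by (rule Cr_on_SucI[where g = "\<lambda>i _. if i = j then 1 else 0"])
      (auto simp: coordinate_continuous Cr_on_const)
qed (simp add: coordinate_continuous)

lemma Cr_on_add:
  assumes "openin (Euclidean_space n) U" "Cr_on r n U f" "Cr_on r n U g"
  shows "Cr_on r n U (\<lambda>x. f x + g x)"
  using assms(2,3)
proof (induction r arbitrary: f g)
  case (Suc r)
  note D = Cr_on_SucD[OF assms(1)]
  show ?case
  proof (rule Cr_on_SucI[where g = "\<lambda>i x. partial_deriv i f x + partial_deriv i g x"])
    show "continuous_map (subtopology (Euclidean_space n) U) euclideanreal (\<lambda>x. f x + g x)"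
      by (rule continuous_map_add[OF Cr_on_continuous[OF Suc.prems(1)] Cr_on_continuous[OF Suc.prems(2)]])
    show "((\<lambda>s. f (x(i := s)) + g (x(i := s))) has_real_derivative partial_deriv i f x + partial_deriv i g x) (at (x i))"
      if "i < n" "x \<in> U" for i x
      by (rule DERIV_add[OF D(2)[OF Suc.prems(1) that] D(2)[OF Suc.prems(2) that]])
    show "Cr_on r n U (\<lambda>x. partial_deriv i f x + partial_deriv i g x)" if "i < n" for i
      by (rule Suc.IH[OF D(1)[OF Suc.prems(1) that] D(1)[OF Suc.prems(2) that]])
  qed
qed (auto intro: continuous_map_add)

lemma Cr_on_mult:
  assumes "openin (Euclidean_space n) U" "Cr_on r n U f" "Cr_on r n U g"
  shows "Cr_on r n U (\<lambda>x. f x * g x)"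
  using assms(2,3)
proof (induction r arbitrary: f g)
  case (Suc r)
  note D = Cr_on_SucD[OF assms(1)]
  show ?case
  proof (rule Cr_on_SucI[where g = "\<lambda>i x. partial_deriv i f x * g x + partial_deriv i g x * f x"])
    show "continuous_map (subtopology (Euclidean_space n) U) euclideanreal (\<lambda>x. f x * g x)"
      by (intro continuous_map_real_mult Cr_on_continuous[OF Suc.prems(1)] Cr_on_continuous[OF Suc.prems(2)])
    show "((\<lambda>s. f (x(i := s)) * g (x(i := s))) has_real_derivative partial_deriv i f x * g x + partial_deriv i g x * f x) (at (x i))"
      if "i < n" "x \<in> U" for i x
      using DERIV_mult[OF D(2)[OF Suc.prems(1) that] D(2)[OF Suc.prems(2) that]]
      unfolding fun_upd_triv .
    show "Cr_on r n U (\<lambda>x. partial_deriv i f x * g x + partial_deriv i g x * f x)" if "i < n" for i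
      by (rule Cr_on_add[OF assms(1) Suc.IH[OF D(1)[OF Suc.prems(1) that] Cr_on_Suc_imp[OF Suc.prems(2)]]
            Suc.IH[OF D(1)[OF Suc.prems(2) that] Cr_on_Suc_imp[OF Suc.prems(1)]]])
  qed
qed (auto intro: continuous_map_real_mult)

lemma Cr_on_sum:
  assumes U: "openin (Euclidean_space n) U" and "\<And>j. j \<in> S \<Longrightarrow> Cr_on r n U (f j)"
  shows "Cr_on r n U (\<lambda>x. \<Sum>j\<in>S. f j x)"
  using assms(2) by (induction S rule: infinite_finite_induct) (simp_all add: Cr_on_const Cr_on_add[OF U])

text \<open>
  Replace the coordinates of z by those of y one after the other and apply the mean value theorem to
  each replacement. The intermediate points are, coordinate by coordinate, no farther from c than
  y and z are, so they converge to c whenever y and z do. This one formula gives the chain rule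
  below as well as the local Lipschitz estimate used for Fermat extensions.
\<close>

lemma increment_formula:
  assumes V: "openin (Euclidean_space n) V" and f: "Cr_on (Suc 0) n V f"
    and box: "open_cube n c d \<subseteq> V" and y: "y \<in> open_cube n c d" and z: "z \<in> open_cube n c d"
  shows "\<exists>\<xi>. (\<forall>j<n. \<xi> j \<in> Rn n \<and> (\<forall>i<n. \<bar>\<xi> j i - c i\<bar> \<le> max \<bar>y i - c i\<bar> \<bar>z i - c i\<bar>)) \<and>
     f y - f z = (\<Sum>j<n. partial_deriv j f (\<xi> j) * (y j - z j))"
proof -
  \<comment> \<open>the corners of the path from z to y: after j replacements\<close>
  define w where "w j = (\<lambda>i. if i < j then y i else z i)" for j
  have yz: "y i = 0" "z i = 0" if "i \<ge> n" for i
    using y z that by (auto simp: open_cube_def Rn_iff)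
  have w_ends: "w 0 = z" "w n = y" using yz by (auto simp: w_def fun_eq_iff)
  have seg: "(w j)(j := s) \<in> Rn n \<and> (\<forall>i<n. \<bar>((w j)(j := s)) i - c i\<bar> \<le> max \<bar>y i - c i\<bar> \<bar>z i - c i\<bar>)"
    if "j < n" "min (y j) (z j) \<le> s" "s \<le> max (y j) (z j)" for j s
    using that yz by (auto simp: w_def Rn_iff)
  have inV: "x \<in> V" if "x \<in> Rn n \<and> (\<forall>i<n. \<bar>x i - c i\<bar> \<le> max \<bar>y i - c i\<bar> \<bar>z i - c i\<bar>)" for x
    using that y z by (intro subsetD[OF box]) (force simp: open_cube_def)
  have step: "\<exists>\<xi>. (\<xi> \<in> Rn n \<and> (\<forall>i<n. \<bar>\<xi> i - c i\<bar> \<le> max \<bar>y i - c i\<bar> \<bar>z i - c i\<bar>)) \<and>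
      f (w (Suc j)) - f (w j) = partial_deriv j f \<xi> * (y j - z j)" if j: "j < n" for j
  proof -
    have w1: "w (Suc j) = (w j)(j := y j)" "w j = (w j)(j := z j)"
      by (auto simp: w_def fun_eq_iff)
    have D: "((\<lambda>s. f ((w j)(j := s))) has_real_derivative partial_deriv j f ((w j)(j := s))) (at s)"
      if "min (y j) (z j) \<le> s" "s \<le> max (y j) (z j)" for s
      using Cr_on_SucD(2)[OF V f j inV[OF seg[OF j that]]] by simp
    have "\<exists>s. min (y j) (z j) \<le> s \<and> s \<le> max (y j) (z j) \<and>
      f ((w j)(j := y j)) - f ((w j)(j := z j)) = partial_deriv j f ((w j)(j := s)) * (y j - z j)"
    proof (cases "y j" "z j" rule: linorder_cases)
      case less
      from MVT2[OF this, of "\<lambda>s. f ((w j)(j := s))" "\<lambda>s. partial_deriv j f ((w j)(j := s))"] D less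
      obtain s where "y j < s" "s < z j"
        "f ((w j)(j := z j)) - f ((w j)(j := y j)) = (z j - y j) * partial_deriv j f ((w j)(j := s))" by auto
      then show ?thesis using less by (intro exI[of _ s]) (auto simp: algebra_simps)
    next
      case greater
      from MVT2[OF this, of "\<lambda>s. f ((w j)(j := s))" "\<lambda>s. partial_deriv j f ((w j)(j := s))"] D greater
      obtain s where "z j < s" "s < y j"
        "f ((w j)(j := y j)) - f ((w j)(j := z j)) = (y j - z j) * partial_deriv j f ((w j)(j := s))" by auto
      then show ?thesis using greater by (intro exI[of _ s]) (auto simp: algebra_simps)
    qed auto
    then obtain s where s: "min (y j) (z j) \<le> s" "s \<le> max (y j) (z j)"
      "f (w (Suc j)) - f (w j) = partial_deriv j f ((w j)(j := s)) * (y j - z j)"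
      using w1 by metis
    from seg[OF j s(1,2)] s(3) show ?thesis by blast
  qed
  then have "\<forall>j. \<exists>\<xi>. j < n \<longrightarrow> (\<xi> \<in> Rn n \<and> (\<forall>i<n. \<bar>\<xi> i - c i\<bar> \<le> max \<bar>y i - c i\<bar> \<bar>z i - c i\<bar>)) \<and>
      f (w (Suc j)) - f (w j) = partial_deriv j f \<xi> * (y j - z j)" by blast
  from choice[OF this] obtain \<xi> where \<xi>: "\<And>j. j < n \<Longrightarrow> (\<xi> j \<in> Rn n \<and> (\<forall>i<n. \<bar>\<xi> j i - c i\<bar> \<le> max \<bar>y i - c i\<bar> \<bar>z i - c i\<bar>)) \<and>
      f (w (Suc j)) - f (w j) = partial_deriv j f (\<xi> j) * (y j - z j)"
    by blast
  have "f y - f z = (\<Sum>j<n. f (w (Suc j)) - f (w j))"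
    using sum_lessThan_telescope[of "\<lambda>j. f (w j)" n] by (simp add: w_ends)
  also have "\<dots> = (\<Sum>j<n. partial_deriv j f (\<xi> j) * (y j - z j))"
    using \<xi> by (intro sum.cong) auto
  finally show ?thesis using \<xi> by blast
qed

text \<open>
  Divide the increment formula for the points \<open>\<gamma> s\<close> and \<open>\<gamma> s0\<close> by \<open>s - s0\<close>: the intermediate points
  tend to \<open>\<gamma> s0\<close>, and the partial derivatives of f are continuous there.
\<close>

lemma chain_rule_along_curve:
  assumes V: "openin (Euclidean_space m) V" and f: "Cr_on (Suc 0) m V f"
    and c: "\<gamma> s0 \<in> V" and ev: "eventually (\<lambda>s. \<gamma> s \<in> V) (at s0)"
    and \<gamma>: "\<And>j. j < m \<Longrightarrow> ((\<lambda>s. \<gamma> s j) has_real_derivative \<gamma>' j) (at s0)"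
  shows "((\<lambda>s. f (\<gamma> s)) has_real_derivative (\<Sum>j<m. partial_deriv j f (\<gamma> s0) * \<gamma>' j)) (at s0)"
proof -
  define c where "c = \<gamma> s0"
  have cV: "c \<in> V" using c by (simp add: c_def)
  obtain d where d: "d > 0" "open_cube m c d \<subseteq> V"
    using V c unfolding openin_iff_open_cube c_def by blast
  have tc: "coord_tendsto m \<gamma> c (at s0)"
    unfolding coord_tendsto_def c_def using \<gamma> DERIV_isCont isCont_def by blast
  have evR: "eventually (\<lambda>s. \<gamma> s \<in> Rn m) (at s0)"
    using ev by eventually_elim (use subset_Rn[OF V] in blast)
  have evb: "eventually (\<lambda>s. \<gamma> s \<in> open_cube m c d) (at s0)"
    by (rule eventually_in_open_cube[OF tc evR d(1)])
  have cb: "c \<in> open_cube m c d"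
    using cV subset_Rn[OF V] d(1) by (intro centre_in_open_cube) auto
  have "\<forall>s. \<exists>\<xi>. \<gamma> s \<in> open_cube m c d \<longrightarrow>
     (\<forall>j<m. \<xi> j \<in> Rn m \<and> (\<forall>i<m. \<bar>\<xi> j i - c i\<bar> \<le> \<bar>\<gamma> s i - c i\<bar>)) \<and>
     f (\<gamma> s) - f c = (\<Sum>j<m. partial_deriv j f (\<xi> j) * (\<gamma> s j - c j))"
    using increment_formula[OF V f d(2) _ cb] by fastforce
  from choice[OF this] obtain \<xi> where \<xi>: "\<And>s. \<gamma> s \<in> open_cube m c d \<Longrightarrow>
     (\<forall>j<m. \<xi> s j \<in> Rn m \<and> (\<forall>i<m. \<bar>\<xi> s j i - c i\<bar> \<le> \<bar>\<gamma> s i - c i\<bar>)) \<and>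
     f (\<gamma> s) - f c = (\<Sum>j<m. partial_deriv j f (\<xi> s j) * (\<gamma> s j - c j))"
    by blast
  have lim: "((\<lambda>s. partial_deriv j f (\<xi> s j)) \<longlongrightarrow> partial_deriv j f c) (at s0)" if j: "j < m" for j
  proof (rule continuous_tendsto[OF Cr_on_continuous[OF Cr_on_SucD(1)[OF V f j]] V cV])
    show "coord_tendsto m (\<lambda>s. \<xi> s j) c (at s0)"
      unfolding coord_tendsto_def
    proof (intro allI impI)
      fix i assume i: "i < m"
      have "((\<lambda>s. \<gamma> s i - c i) \<longlongrightarrow> 0) (at s0)"
        using tc i unfolding coord_tendsto_def by (simp add: LIM_zero)
      then have z: "((\<lambda>s. \<bar>\<gamma> s i - c i\<bar>) \<longlongrightarrow> 0) (at s0)"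
        by (rule tendsto_rabs_zero)
      have "((\<lambda>s. \<xi> s j i - c i) \<longlongrightarrow> 0) (at s0)"
        by (rule Lim_null_comparison[OF _ z], use evb in eventually_elim) (use \<xi> i j in auto)
      then show "((\<lambda>s. \<xi> s j i) \<longlongrightarrow> c i) (at s0)" by (rule LIM_zero_cancel)
    qed
    show "eventually (\<lambda>s. \<xi> s j \<in> V) (at s0)"
      using evb
    proof eventually_elim
      case (elim s)
      then have "\<xi> s j \<in> open_cube m c d"
        using \<xi>[OF elim] j unfolding open_cube_def by fastforce
      then show ?case using d(2) by blast
    qed
  qed
  have "((\<lambda>s. \<Sum>j<m. partial_deriv j f (\<xi> s j) * ((\<gamma> s j - c j) / (s - s0))) \<longlongrightarrow> (\<Sum>j<m. partial_deriv j f c * \<gamma>' j)) (at s0)"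
    using \<gamma> unfolding has_field_derivative_iff c_def
    by (intro tendsto_sum tendsto_mult lim[unfolded c_def]) auto
  moreover have "eventually (\<lambda>s. (\<Sum>j<m. partial_deriv j f (\<xi> s j) * ((\<gamma> s j - c j) / (s - s0))) =
      (f (\<gamma> s) - f (\<gamma> s0)) / (s - s0)) (at s0)"
    using evb by eventually_elim (use \<xi> in \<open>simp add: c_def sum_divide_distrib\<close>)
  ultimately show ?thesis
    unfolding has_field_derivative_iff using tendsto_cong by (fastforce simp: c_def)
qed

text \<open>
  By the chain rule a partial derivative of the composite is a sum of products of functions of one
  class less, to which the induction hypothesis and the closure under sums and products apply.
\<close>

lemma Cr_on_compose:
  assumes V: "openin (Euclidean_space m) V" and U: "openin (Euclidean_space n) U"
    and \<phi>: "\<phi> \<in> U \<rightarrow> V" and f: "Cr_on r m V f" and co: "\<And>j. j < m \<Longrightarrow> Cr_on r n U (\<lambda>x. \<phi> x j)"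
  shows "Cr_on r n U (\<lambda>x. f (\<phi> x))"
  using f co
proof (induction r arbitrary: f)
  case 0
  have "continuous_map (subtopology (Euclidean_space n) U) (subtopology (Euclidean_space m) V) \<phi>"
    using \<phi> subset_Rn[OF U] subset_Rn[OF V] 0
    by (intro continuous_map_into_open) (auto simp: Pi_iff)
  from continuous_map_compose[OF this, of _ f] show ?case using 0 by (simp add: o_def)
next
  case (Suc r)
  have c: "continuous_map (subtopology (Euclidean_space n) U) euclideanreal (\<lambda>x. f (\<phi> x))"
  proof -
    have "continuous_map (subtopology (Euclidean_space n) U) (subtopology (Euclidean_space m) V) \<phi>"
      using \<phi> subset_Rn[OF U] subset_Rn[OF V] Cr_on_continuous[OF Suc.prems(2)]
      by (intro continuous_map_into_open) (auto simp: Pi_iff)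
    from continuous_map_compose[OF this, of _ f] Cr_on_continuous[OF Suc.prems(1)]
    show ?thesis by (simp add: o_def)
  qed
  have f1: "Cr_on (Suc 0) m V f"
    using Suc.prems(1) by (induction r) (auto simp del: Cr_on.simps intro: Cr_on_Suc_imp)
  show ?case
  proof (rule Cr_on_SucI[OF c, where g = "\<lambda>i x. \<Sum>j<m. partial_deriv j f (\<phi> x) * partial_deriv i (\<lambda>x. \<phi> x j) x"])
    fix i x assume i: "i < n" and x: "x \<in> U"
    have ev: "eventually (\<lambda>s. \<phi> (x(i := s)) \<in> V) (at (x i))"
      using eventually_fun_upd[OF U x i] \<phi> unfolding eventually_at_filter
      by (auto elim!: eventually_mono)
    have "((\<lambda>s. f (\<phi> (x(i := s)))) has_real_derivative
        (\<Sum>j<m. partial_deriv j f (\<phi> (x(i := x i))) * partial_deriv i (\<lambda>x. \<phi> x j) x)) (at (x i))"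
    proof (rule chain_rule_along_curve[OF V f1 _ ev])
      show "\<phi> (x(i := x i)) \<in> V" using \<phi> x by auto
      show "((\<lambda>s. \<phi> (x(i := s)) j) has_real_derivative partial_deriv i (\<lambda>x. \<phi> x j) x) (at (x i))" if "j < m" for j
        by (rule Cr_on_SucD(2)[OF U Suc.prems(2)[OF that] i x])
    qed
    then show "((\<lambda>s. f (\<phi> (x(i := s)))) has_real_derivative
        (\<Sum>j<m. partial_deriv j f (\<phi> x) * partial_deriv i (\<lambda>x. \<phi> x j) x)) (at (x i))" by simp
  next
    fix i assume i: "i < n"
    show "Cr_on r n U (\<lambda>x. \<Sum>j<m. partial_deriv j f (\<phi> x) * partial_deriv i (\<lambda>x. \<phi> x j) x)"
    proof (rule Cr_on_sum[OF U], rule Cr_on_mult[OF U])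
      fix j assume "j \<in> {..<m}"
      then have j: "j < m" by simp
      show "Cr_on r n U (\<lambda>x. partial_deriv j f (\<phi> x))"
        by (rule Suc.IH[OF Cr_on_SucD(1)[OF V Suc.prems(1) j] Cr_on_Suc_imp[OF Suc.prems(2)]])
      show "Cr_on r n U (partial_deriv i (\<lambda>x. \<phi> x j))"
        by (rule Cr_on_SucD(1)[OF U Suc.prems(2)[OF j] i])
    qed
  qed
qed

section \<open>Germs of sums of fractional powers\<close>

lemma vnorm_smallo_iff:
  "(\<lambda>t. vnorm n (w t)) \<in> o[F](g) \<longleftrightarrow> (\<forall>j<n. (\<lambda>t. w t j) \<in> o[F](g))"
proof (intro iffI allI impI)
  fix j assume v: "(\<lambda>t. vnorm n (w t)) \<in> o[F](g)" and j: "j < n"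
  have "\<bar>w t j\<bar> \<le> vnorm n (w t)" for t
    unfolding vnorm_def L2_set_def using j
    by (intro real_le_rsqrt) (simp add: member_le_sum[where f = "\<lambda>i. (w t i)\<^sup>2"])
  then have "(\<lambda>t. w t j) \<in> O[F](\<lambda>t. vnorm n (w t))"
    by (intro bigoI[where c = 1] always_eventually) (simp add: vnorm_def L2_set_nonneg)
  with v show "(\<lambda>t. w t j) \<in> o[F](g)" by (rule landau_o.big_small_trans[rotated])
next
  assume w: "\<forall>j<n. (\<lambda>t. w t j) \<in> o[F](g)"
  have "(\<lambda>t. \<Sum>j<n. \<bar>w t j\<bar>) \<in> o[F](g)"
    using w by (intro big_sum_in_smallo) auto
  moreover have "norm (vnorm n (w t)) \<le> 1 * norm (\<Sum>j<n. \<bar>w t j\<bar>)" for t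
    using L2_set_le_sum_abs[of "w t" "{..<n}"] by (simp add: vnorm_def L2_set_nonneg sum_nonneg)
  then have "(\<lambda>t. vnorm n (w t)) \<in> O[F](\<lambda>t. \<Sum>j<n. \<bar>w t j\<bar>)"
    by (intro bigoI[where c = 1] always_eventually) simp
  ultimately show "(\<lambda>t. vnorm n (w t)) \<in> o[F](g)" by (rule landau_o.big_small_trans[rotated])
qed

text \<open>
  Behaviour at 0 from the right of a finite sum of positive powers of t, up to an error \<open>o(t)\<close>. The
  generation by rules lets products and scalar multiples be treated by induction; the sum itself is
  recovered in the normal form below.
\<close>

inductive frac_germ :: "(real \<Rightarrow> real) \<Rightarrow> bool" where
  powr: "0 < a \<Longrightarrow> frac_germ (\<lambda>t. c * t powr a)"
| add: "frac_germ g \<Longrightarrow> frac_germ h \<Longrightarrow> frac_germ (\<lambda>t. g t + h t)"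
| small: "h \<in> o[at_right 0](\<lambda>t. t) \<Longrightarrow> frac_germ h"

lemma powr_tendsto_0: "0 < a \<Longrightarrow> ((\<lambda>t::real. t powr a) \<longlongrightarrow> 0) (at_right 0)"
  by (intro tendsto_eq_rhs[OF tendsto_powr'[OF tendsto_ident_at tendsto_const]])
     (auto simp: eventually_at_filter)

lemma powr_smallo_id:
  assumes "1 < a" shows "(\<lambda>t::real. t powr a) \<in> o[at_right 0](\<lambda>t. t)"
proof (rule smalloI_tendsto)
  have "((\<lambda>t::real. t powr (a - 1)) \<longlongrightarrow> 0) (at_right 0)"
    using assms by (intro powr_tendsto_0) simp
  moreover have "eventually (\<lambda>t::real. t powr (a - 1) = t powr a / t) (at_right 0)"
    by (auto simp: eventually_at_filter powr_diff)
  ultimately show "((\<lambda>t::real. t powr a / t) \<longlongrightarrow> 0) (at_right 0)"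
    using tendsto_cong by fast
qed (auto simp: eventually_at_filter)

lemma powr_bigo_mono:
  assumes "a \<le> b" shows "(\<lambda>t::real. t powr b) \<in> O[at_right 0](\<lambda>t. t powr a)"
proof (rule bigoI[where c = 1])
  have "eventually (\<lambda>t::real. 0 < t \<and> t < 1) (at_right 0)"
    unfolding eventually_at_right_field by (intro exI[of _ 1]) auto
  then show "eventually (\<lambda>t::real. norm (t powr b) \<le> 1 * norm (t powr a)) (at_right 0)"
    by eventually_elim (use assms in \<open>simp add: powr_mono'\<close>)
qed

text \<open>
  The smallest exponent of the sum will do, or 1 if that is smaller, to account for the error term.
\<close>

lemma frac_germ_bigo:
  assumes "frac_germ h" shows "\<exists>b>0. h \<in> O[at_right 0](\<lambda>t. t powr b)"
  using assms
proof induction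
  case (powr a c)
  have "(\<lambda>t. c * t powr a) \<in> O[at_right 0](\<lambda>t. t powr a)" by simp
  then show ?case using powr by blast
next
  case (add g h)
  then obtain a b where ab: "0 < a" "g \<in> O[at_right 0](\<lambda>t. t powr a)"
      "0 < b" "h \<in> O[at_right 0](\<lambda>t. t powr b)" by blast
  have "g \<in> O[at_right 0](\<lambda>t. t powr min a b)" "h \<in> O[at_right 0](\<lambda>t. t powr min a b)"
    by (rule landau_o.big_trans[OF ab(2)], rule powr_bigo_mono, simp)
       (rule landau_o.big_trans[OF ab(4)], rule powr_bigo_mono, simp)
  then show ?case using ab(1,3) by (intro exI[of _ "min a b"]) (simp add: sum_in_bigo)
next
  case (small h)
  have "(\<lambda>t::real. t) \<in> O[at_right 0](\<lambda>t. t powr 1)"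
    by (rule bigoI[where c = 1]) (auto simp: eventually_at_filter)
  with small have "h \<in> O[at_right 0](\<lambda>t. t powr 1)"
    using landau_o.small_imp_big landau_o.big_trans by blast
  then show ?case by (intro exI[of _ 1]) simp
qed

lemma frac_germ_tendsto_0:
  assumes "frac_germ h" shows "(h \<longlongrightarrow> 0) (at_right 0)"
proof -
  obtain b where b: "0 < b" "h \<in> O[at_right 0](\<lambda>t. t powr b)"
    using frac_germ_bigo[OF assms] by blast
  have "(\<lambda>t::real. t powr b) \<in> o[at_right 0](\<lambda>_. 1)"
    using powr_tendsto_0[OF b(1)] by (intro smalloI_tendsto) auto
  with b(2) have "h \<in> o[at_right 0](\<lambda>_. 1)"
    by (rule landau_o.big_small_trans)
  then show ?thesis by (auto dest: smalloD_tendsto)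
qed

lemma frac_germ_cong:
  assumes "frac_germ g" "eventually (\<lambda>t. g t = h t) (at_right 0)"
  shows "frac_germ h"
proof -
  have "(\<lambda>t. h t - g t) \<in> o[at_right 0](\<lambda>t. t)"
    using assms(2) by (subst landau_o.small.in_cong[where g = "\<lambda>_. 0"]) (auto elim: eventually_mono)
  from frac_germ.add[OF assms(1) frac_germ.small[OF this]] show ?thesis by simp
qed

lemma frac_germ_cmult: "frac_germ h \<Longrightarrow> frac_germ (\<lambda>t. c * h t)"
proof (induction rule: frac_germ.induct)
  case (powr a d)
  from frac_germ.powr[OF this, of "c * d"] show ?case by (simp add: mult.assoc)
next
  case (add g h)
  from frac_germ.add[OF add.IH] show ?case by (simp add: distrib_left)
qed (auto intro: frac_germ.small)

lemma frac_germ_zero: "frac_germ (\<lambda>_. 0)"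
  by (rule frac_germ.small) simp

lemma frac_germ_sum:
  "(\<And>i. i \<in> S \<Longrightarrow> frac_germ (h i)) \<Longrightarrow> frac_germ (\<lambda>t. \<Sum>i\<in>S. h i t)"
  by (induction S rule: infinite_finite_induct) (auto intro: frac_germ.add frac_germ_zero)

text \<open>
  A germ of this kind tends to 0, hence is bounded, so that it does not spoil an error \<open>o(t)\<close>.
\<close>

lemma small_mult_frac_germ:
  assumes "h \<in> o[at_right 0](\<lambda>t. t)" "frac_germ g" shows "frac_germ (\<lambda>t. h t * g t)"
proof -
  have "g \<in> O[at_right 0](\<lambda>_. 1)"
    using frac_germ_tendsto_0[OF assms(2)] by (intro bigoI_tendsto[where c = 0]) auto
  from landau_o.small_big_mult[OF assms(1) this] show ?thesis by (intro frac_germ.small) simp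
qed

lemma frac_germ_mult:
  assumes "frac_germ g" "frac_germ h" shows "frac_germ (\<lambda>t. g t * h t)"
  using assms(1)
proof induction
  case (powr a c)
  from assms(2) show ?case
  proof induction
    case (powr b d)
    have "frac_germ (\<lambda>t. c * d * t powr (a + b))"
      using \<open>0 < a\<close> powr by (intro frac_germ.powr) simp
    then show ?case by (simp add: powr_add mult_ac)
  next
    case (add p q)
    from frac_germ.add[OF add.IH] show ?case by (simp add: distrib_left)
  next
    case (small e)
    from small_mult_frac_germ[OF small frac_germ.powr[OF \<open>0 < a\<close>, of c]]
    show ?case by (simp add: mult.commute)
  qed
next
  case (add p q)
  from frac_germ.add[OF add.IH] show ?case by (simp add: distrib_right)
next
  case (small e)
  from small_mult_frac_germ[OF small assms(2)] show ?case .
qed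

text \<open>
  A finite set of exponents with a coefficient function, rather than an indexed family of terms, has
  the advantage that two sums are added by uniting their exponent sets.
\<close>

lemma frac_germ_normal_form:
  assumes "frac_germ h"
  shows "\<exists>E c. finite E \<and> E \<subseteq> {0<..} \<and> (\<lambda>t. h t - (\<Sum>a\<in>E. c a * t powr a)) \<in> o[at_right 0](\<lambda>t. t)"
  using assms
proof induction
  case (powr a c)
  then show ?case by (intro exI[of _ "{a}"] exI[of _ "\<lambda>_. c"]) simp
next
  case (add g h)
  then obtain E c F d where E: "finite E" "E \<subseteq> {0<..}"
      "(\<lambda>t. g t - (\<Sum>a\<in>E. c a * t powr a)) \<in> o[at_right 0](\<lambda>t. t)"
    and F: "finite F" "F \<subseteq> {0<..}"
      "(\<lambda>t. h t - (\<Sum>a\<in>F. d a * t powr a)) \<in> o[at_right 0](\<lambda>t. t)" by blast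
  define e where "e a = (if a \<in> E then c a else 0) + (if a \<in> F then d a else 0)" for a
  have "(\<Sum>a\<in>E \<union> F. e a * t powr a) = (\<Sum>a\<in>E. c a * t powr a) + (\<Sum>a\<in>F. d a * t powr a)" for t
    using E(1) F(1)
    by (simp add: e_def distrib_right sum.distrib if_distrib[of "\<lambda>x. x * _"] sum.If_cases Int_absorb1 Int_absorb2 Int_Un_distrib2 cong: if_cong)
  then have "(\<lambda>t. g t + h t - (\<Sum>a\<in>E \<union> F. e a * t powr a)) \<in> o[at_right 0](\<lambda>t. t)"
    using sum_in_smallo(1)[OF E(3) F(3)] by (simp add: algebra_simps)
  then show ?case using E(1,2) F(1,2) by (intro exI[of _ "E \<union> F"] exI[of _ e]) auto
next
  case (small h)
  then show ?case by (intro exI[of _ "{}"]) simp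
qed

text \<open>
  A little-oh polynomial has one family of exponents for all of its coordinates. Conversely, when the
  coordinates have expansions with exponents of their own, the union of the exponent sets serves
  for all of them, with coefficient 0 where an exponent does not occur.
\<close>

lemma little_oh_poly_iff_frac_germ:
  "little_oh_poly n U x \<longleftrightarrow> (\<exists>\<epsilon>>0. \<forall>t\<in>{0..<\<epsilon>}. x t \<in> U) \<and> (\<forall>j<n. frac_germ (\<lambda>t. x t j - x 0 j))"
proof (intro iffI conjI allI impI)
  assume x: "little_oh_poly n U x"
  then show "\<exists>\<epsilon>>0. \<forall>t\<in>{0..<\<epsilon>}. x t \<in> U" by (simp add: little_oh_poly_def)
  fix j assume j: "j < n"
  obtain k :: nat and \<alpha> :: "nat \<Rightarrow> vec" and a :: "nat \<Rightarrow> real"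
    where a: "\<forall>i\<in>{1..k}. \<alpha> i \<in> Rn n \<and> a i > 0"
      and o: "(\<lambda>t. vnorm n (\<lambda>j. x t j - x 0 j - (\<Sum>i=1..k. \<alpha> i j * t powr a i))) \<in> o[at_right 0](\<lambda>t. t)"
    using x unfolding little_oh_poly_def by blast
  have "frac_germ (\<lambda>t. x t j - x 0 j - (\<Sum>i=1..k. \<alpha> i j * t powr a i))"
    using o j unfolding vnorm_smallo_iff by (intro frac_germ.small) blast
  moreover have "frac_germ (\<lambda>t. \<Sum>i=1..k. \<alpha> i j * t powr a i)"
    using a by (intro frac_germ_sum frac_germ.powr) blast
  ultimately have "frac_germ (\<lambda>t. (x t j - x 0 j - (\<Sum>i=1..k. \<alpha> i j * t powr a i)) + (\<Sum>i=1..k. \<alpha> i j * t powr a i))"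
    by (rule frac_germ.add)
  then show "frac_germ (\<lambda>t. x t j - x 0 j)" by simp
next
  assume x: "(\<exists>\<epsilon>>0. \<forall>t\<in>{0..<\<epsilon>}. x t \<in> U) \<and> (\<forall>j<n. frac_germ (\<lambda>t. x t j - x 0 j))"
  then have "\<forall>j\<in>{..<n}. \<exists>E c. finite E \<and> E \<subseteq> {0<..} \<and>
      (\<lambda>t. x t j - x 0 j - (\<Sum>a\<in>E. c a * t powr a)) \<in> o[at_right 0](\<lambda>t. t)"
    by (intro ballI frac_germ_normal_form) simp
  from bchoice[OF this] obtain E where "\<forall>j\<in>{..<n}. \<exists>c. finite (E j) \<and> E j \<subseteq> {0<..} \<and>
      (\<lambda>t. x t j - x 0 j - (\<Sum>a\<in>E j. c a * t powr a)) \<in> o[at_right 0](\<lambda>t. t)" by blast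
  from bchoice[OF this] obtain c where c: "\<forall>j\<in>{..<n}. finite (E j) \<and> E j \<subseteq> {0<..} \<and>
      (\<lambda>t. x t j - x 0 j - (\<Sum>a\<in>E j. c j a * t powr a)) \<in> o[at_right 0](\<lambda>t. t)" by blast
  have E: "finite (E j)" "E j \<subseteq> {0<..}"
      "(\<lambda>t. x t j - x 0 j - (\<Sum>a\<in>E j. c j a * t powr a)) \<in> o[at_right 0](\<lambda>t. t)" if "j < n" for j
    using c that by simp_all
  define F where "F = (\<Union>j<n. E j)"
  have F: "finite F" "F \<subseteq> {0<..}" using E(1,2) by (auto simp: F_def)
  obtain e where e: "bij_betw e {1..card F} F"
    using ex_bij_betw_nat_finite_1[OF F(1)] by blast
  define \<alpha> :: "nat \<Rightarrow> vec" where "\<alpha> i j = (if j < n \<and> e i \<in> E j then c j (e i) else 0)" for i j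
  have "(\<Sum>i=1..card F. \<alpha> i j * t powr e i) = (\<Sum>a\<in>E j. c j a * t powr a)" if j: "j < n" for j t
  proof -
    have "(\<Sum>i=1..card F. \<alpha> i j * t powr e i) = (\<Sum>a\<in>F. (if a \<in> E j then c j a else 0) * t powr a)"
      using j by (intro sum.reindex_bij_betw[OF e, THEN trans[rotated]] sum.cong) (auto simp: \<alpha>_def)
    also have "\<dots> = (\<Sum>a\<in>E j. c j a * t powr a)"
      using j F(1) by (intro sum.mono_neutral_cong_right) (auto simp: F_def)
    finally show ?thesis .
  qed
  then have "(\<lambda>t. vnorm n (\<lambda>j. x t j - x 0 j - (\<Sum>i=1..card F. \<alpha> i j * t powr e i))) \<in> o[at_right 0](\<lambda>t. t)"
    unfolding vnorm_smallo_iff using E(3) by simp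
  moreover have "\<forall>i\<in>{1..card F}. \<alpha> i \<in> Rn n \<and> e i > 0"
    using F(2) bij_betwE[OF e] by (auto simp: \<alpha>_def Rn_iff)
  moreover have "x 0 \<in> U" using x by force
  ultimately show "little_oh_poly n U x"
    using x unfolding little_oh_poly_def by blast
qed

section \<open>Smooth functions of little-oh polynomials\<close>

definition smooth_fn :: "nat \<Rightarrow> vec set \<Rightarrow> (vec \<Rightarrow> real) \<Rightarrow> bool"
  where "smooth_fn n U f \<longleftrightarrow> (\<forall>r. Cr_on r n U f)"

lemma smooth_fnD: "smooth_fn n U f \<Longrightarrow> Cr_on r n U f"
  by (simp add: smooth_fn_def)

lemma smooth_fn_continuous:
  "smooth_fn n U f \<Longrightarrow> continuous_map (subtopology (Euclidean_space n) U) euclideanreal f"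
  by (rule Cr_on_continuous[OF smooth_fnD])

lemma smooth_fn_partial_deriv: "openin (Euclidean_space n) U \<Longrightarrow> smooth_fn n U f \<Longrightarrow> i < n \<Longrightarrow> smooth_fn n U (partial_deriv i f)"
  unfolding smooth_fn_def using Cr_on_SucD(1) by blast

lemma little_oh_poly_coord_limit:
  assumes "little_oh_poly n U x"
  shows "coord_tendsto n x (x 0) (at_right 0)"
  using assms unfolding coord_tendsto_def little_oh_poly_iff_frac_germ
  by (auto intro: LIM_zero_cancel frac_germ_tendsto_0)

lemma little_oh_poly_eventually:
  assumes "little_oh_poly n U x"
  shows "eventually (\<lambda>t. x t \<in> U) (at_right 0)"
proof -
  obtain \<epsilon> where "\<epsilon> > 0" "\<forall>t\<in>{0..<\<epsilon>}. x t \<in> U" using assms unfolding little_oh_poly_def by blast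
  then show ?thesis unfolding eventually_at_right_field by (intro exI[of _ \<epsilon>]) auto
qed

lemma little_oh_poly_start:
  assumes "little_oh_poly n U x" shows "x 0 \<in> U"
  using assms unfolding little_oh_poly_def by blast

text \<open>
  The k-th derivative of f at y in the direction v, that is \<open>(v\<^sub>0 \<partial>\<^sub>0 + \<dots>)\<^sup>k f\<close> evaluated at y. The
  recursion exhibits it as a homogeneous polynomial of degree k in the coordinates of v whose coefficients
  are partial derivatives of f at y; both the growth in v and the type of germ obtained for a
  variable direction v can be read off from that.
\<close>

primrec dir_deriv :: "nat \<Rightarrow> nat \<Rightarrow> (vec \<Rightarrow> real) \<Rightarrow> vec \<Rightarrow> vec \<Rightarrow> real" where
  "dir_deriv n 0 f v y = f y"
| "dir_deriv n (Suc k) f v y = (\<Sum>j<n. v j * dir_deriv n k (partial_deriv j f) v y)"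

text \<open>
  For \<open>k = 0\<close> this is the chain rule along a line. The directional derivative of higher order is a
  combination, with coefficients independent of s, of directional derivatives of the functions
  \<open>\<partial>\<^sub>j f\<close> of order one less.
\<close>

lemma dir_deriv_along_line:
  assumes U: "openin (Euclidean_space n) U" and r: "r \<in> Rn n" and v: "v \<in> Rn n"
    and s: "(\<lambda>i. r i + s * v i) \<in> U" and f: "smooth_fn n U f"
  shows "((\<lambda>s. dir_deriv n k f v (\<lambda>i. r i + s * v i)) has_real_derivative
     dir_deriv n (Suc k) f v (\<lambda>i. r i + s * v i)) (at s)"
  using f
proof (induction k arbitrary: f)
  case 0
  have t: "coord_tendsto n (\<lambda>s i. r i + s * v i) (\<lambda>i. r i + s * v i) (at s)"
    unfolding coord_tendsto_def by (auto intro!: tendsto_intros)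
  obtain d where d: "d > 0" "open_cube n (\<lambda>i. r i + s * v i) d \<subseteq> U"
    using U s unfolding openin_iff_open_cube by blast
  have "eventually (\<lambda>s. (\<lambda>i. r i + s * v i) \<in> U) (at s)"
    by (rule eventually_mono[OF eventually_in_open_cube[OF t _ d(1)]]) (use r v d(2) in \<open>auto simp: Rn_iff\<close>)
  then have "((\<lambda>s. f (\<lambda>i. r i + s * v i)) has_real_derivative
      (\<Sum>j<n. partial_deriv j f (\<lambda>i. r i + s * v i) * v j)) (at s)"
    by (rule chain_rule_along_curve[where \<gamma> = "\<lambda>s i. r i + s * v i", OF U smooth_fnD[OF 0] s]) (auto intro!: derivative_eq_intros)
  then show ?case by (simp add: mult.commute)
next
  case (Suc k)
  have "((\<lambda>s. \<Sum>j<n. v j * dir_deriv n k (partial_deriv j f) v (\<lambda>i. r i + s * v i)) has_real_derivative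
      (\<Sum>j<n. v j * dir_deriv n (Suc k) (partial_deriv j f) v (\<lambda>i. r i + s * v i))) (at s)"
    using Suc.IH[OF smooth_fn_partial_deriv[OF U Suc.prems]] by (intro DERIV_sum DERIV_cmult) (auto simp del: dir_deriv.simps)
  then show ?case by simp
qed

text \<open>
  A homogeneous polynomial of positive degree in germs of the same kind. The degree is at least 1,
  so no constant term occurs.
\<close>

lemma dir_deriv_frac_germ:
  assumes "\<And>j. j < n \<Longrightarrow> frac_germ (\<lambda>t. v t j)"
  shows "frac_germ (\<lambda>t. dir_deriv n (Suc k) f (v t) r)"
proof (induction k arbitrary: f)
  case 0
  have "frac_germ (\<lambda>t. \<Sum>j<n. partial_deriv j f r * v t j)"
    using assms by (intro frac_germ_sum frac_germ_cmult) simp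
  then show ?case by (simp add: mult.commute)
next
  case (Suc k)
  have "frac_germ (\<lambda>t. \<Sum>j<n. v t j * dir_deriv n (Suc k) (partial_deriv j f) (v t) r)"
    using assms Suc.IH by (intro frac_germ_sum frac_germ_mult) auto
  then show ?case by simp
qed

text \<open>
  The coefficients of this homogeneous polynomial of degree k in v are continuous functions of y,
  hence bounded as y tends to r.
\<close>

lemma dir_deriv_bigo:
  assumes U: "openin (Euclidean_space n) U" and r: "r \<in> U"
    and y: "coord_tendsto n y r F" "eventually (\<lambda>t. y t \<in> U) F"
    and v: "\<And>j. j < n \<Longrightarrow> (\<lambda>t. v t j) \<in> O[F](g)" and f: "smooth_fn n U f"
  shows "(\<lambda>t. dir_deriv n k f (v t) (y t)) \<in> O[F](\<lambda>t. g t ^ k)"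
  using f
proof (induction k arbitrary: f)
  case 0
  have "((\<lambda>t. f (y t)) \<longlongrightarrow> f r) F"
    by (rule continuous_tendsto[OF smooth_fn_continuous[OF 0] U r y])
  then show ?case by (auto intro: bigoI_tendsto)
next
  case (Suc k)
  have "(\<lambda>t. \<Sum>j<n. v t j * dir_deriv n k (partial_deriv j f) (v t) (y t)) \<in> O[F](\<lambda>t. g t * g t ^ k)"
    using v Suc.IH[OF smooth_fn_partial_deriv[OF U Suc.prems]]
    by (intro big_sum_in_bigo landau_o.big_mult) auto
  then show ?case by simp
qed

lemma uniform_exponent:
  assumes "finite S" "\<And>j. j \<in> S \<Longrightarrow> frac_germ (h j)"
  shows "\<exists>b>0. \<forall>j\<in>S. h j \<in> O[at_right 0](\<lambda>t. t powr b)"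
  using assms
proof (induction S rule: finite_induct)
  case empty
  show ?case by (intro exI[of _ 1]) simp
next
  case (insert j S)
  obtain a where a: "0 < a" "\<forall>j\<in>S. h j \<in> O[at_right 0](\<lambda>t. t powr a)" using insert by auto
  obtain b where b: "0 < b" "h j \<in> O[at_right 0](\<lambda>t. t powr b)" using insert.prems frac_germ_bigo by blast
  have "h i \<in> O[at_right 0](\<lambda>t. t powr min a b)" if "i \<in> insert j S" for i
  proof (cases "i = j")
    case True
    show ?thesis unfolding True by (rule landau_o.big_trans[OF b(2)], rule powr_bigo_mono, simp)
  next
    case False
    then have "i \<in> S" using that by simp
    then show ?thesis
      by (intro landau_o.big_trans[OF bspec[OF a(2)]] powr_bigo_mono) simp_all
  qed
  then show ?case using a(1) b(1) by (intro exI[of _ "min a b"]) simp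
qed

text \<open>
  Expand f at \<open>x 0\<close> along the segment to \<open>x t\<close>. The order of the expansion is chosen so large that
  the Lagrange remainder is \<open>o(t)\<close>; the other terms of positive order are polynomials in the coordinates of
  \<open>x t - x 0\<close>.
\<close>

proposition smooth_fn_little_oh_poly:
  assumes U: "openin (Euclidean_space n) U" and f: "smooth_fn n U f" and x: "little_oh_poly n U x"
  shows "frac_germ (\<lambda>t. f (x t) - f (x 0))"
proof -
  define v where "v t = (\<lambda>i. x t i - x 0 i)" for t
  have v: "frac_germ (\<lambda>t. v t j)" if "j < n" for j
    using x that unfolding little_oh_poly_iff_frac_germ v_def by blast
  obtain b where b: "b > 0" "\<And>j. j < n \<Longrightarrow> (\<lambda>t. v t j) \<in> O[at_right 0](\<lambda>t. t powr b)"
    using uniform_exponent[of "{..<n}" "\<lambda>j t. v t j"] v by auto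
  \<comment> \<open>each term of the remainder of order Suc N0 contains Suc N0 factors that are O(t powr b)\<close>
  obtain N0 where "1 / b < real N0" using reals_Archimedean2 by blast
  then have N: "1 < b * real (Suc N0)" using b(1) by (simp add: field_simps)
  have xU: "x 0 \<in> U" by (rule little_oh_poly_start[OF x])
  have xR: "x 0 \<in> Rn n" using xU subset_Rn[OF U] by blast
  obtain d where d: "d > 0" "open_cube n (x 0) d \<subseteq> U"
    using U xU unfolding openin_iff_open_cube by blast
  have evR: "eventually (\<lambda>t. x t \<in> Rn n) (at_right 0)"
    using little_oh_poly_eventually[OF x] by eventually_elim (use subset_Rn[OF U] in blast)
  have evb: "eventually (\<lambda>t. x t \<in> open_cube n (x 0) d) (at_right 0)"
    by (rule eventually_in_open_cube[OF little_oh_poly_coord_limit[OF x] evR d(1)])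
  have box: "(\<lambda>i. x 0 i + s * v t i) \<in> open_cube n (x 0) d"
    if "x t \<in> open_cube n (x 0) d" "0 \<le> s" "s \<le> 1" for s t
  proof -
    have "\<bar>s * v t i\<bar> < d" if i: "i < n" for i
    proof -
      have "\<bar>s * v t i\<bar> \<le> \<bar>v t i\<bar>" using \<open>0 \<le> s\<close> \<open>s \<le> 1\<close>
        by (simp add: abs_mult mult_left_le_one_le)
      also have "\<dots> < d" using \<open>x t \<in> open_cube n (x 0) d\<close> i by (simp add: open_cube_def v_def)
      finally show ?thesis .
    qed
    then show ?thesis using that(1) xR by (auto simp: open_cube_def Rn_iff v_def)
  qed
  have taylor: "\<exists>\<theta>. 0 < \<theta> \<and> \<theta> < 1 \<and> f (x t) =
      (\<Sum>m<Suc N0. dir_deriv n m f (v t) (x 0) / fact m) +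
      dir_deriv n (Suc N0) f (v t) (\<lambda>i. x 0 i + \<theta> * v t i) / fact (Suc N0)"
    if t: "x t \<in> open_cube n (x 0) d" for t
  proof -
    have vR: "v t \<in> Rn n" using t xR by (auto simp: open_cube_def Rn_iff v_def)
    have "\<forall>m s. m < Suc N0 \<and> 0 \<le> s \<and> s \<le> 1 \<longrightarrow>
       ((\<lambda>s. dir_deriv n m f (v t) (\<lambda>i. x 0 i + s * v t i)) has_real_derivative
         dir_deriv n (Suc m) f (v t) (\<lambda>i. x 0 i + s * v t i)) (at s)"
      using dir_deriv_along_line[OF U xR vR _ f] box[OF t] d(2) by blast
    from Maclaurin[OF _ _ refl this]
    show ?thesis by (auto simp: v_def simp del: fact_Suc dir_deriv.simps(2))
  qed
  have "\<forall>t. \<exists>\<theta>. x t \<in> open_cube n (x 0) d \<longrightarrow> 0 < \<theta> \<and> \<theta> < 1 \<and> f (x t) =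
      (\<Sum>m<Suc N0. dir_deriv n m f (v t) (x 0) / fact m) +
      dir_deriv n (Suc N0) f (v t) (\<lambda>i. x 0 i + \<theta> * v t i) / fact (Suc N0)"
    using taylor by blast
  from choice[OF this] obtain \<theta> where \<theta>: "\<And>t. x t \<in> open_cube n (x 0) d \<Longrightarrow> 0 < \<theta> t \<and> \<theta> t < 1 \<and> f (x t) =
      (\<Sum>m<Suc N0. dir_deriv n m f (v t) (x 0) / fact m) +
      dir_deriv n (Suc N0) f (v t) (\<lambda>i. x 0 i + \<theta> t * v t i) / fact (Suc N0)"
    by blast
  \<comment> \<open>the point at which the Lagrange remainder R is evaluated; it stays on the segment, so it tends to x 0\<close>
  define y where "y t = (\<lambda>i. x 0 i + \<theta> t * v t i)" for t
  define R where "R t = dir_deriv n (Suc N0) f (v t) (y t)" for t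
  have ty: "coord_tendsto n y (x 0) (at_right 0)"
    unfolding coord_tendsto_def
  proof (intro allI impI)
    fix i assume i: "i < n"
    have z: "((\<lambda>t. \<bar>v t i\<bar>) \<longlongrightarrow> 0) (at_right 0)"
      using frac_germ_tendsto_0[OF v[OF i]] by (rule tendsto_rabs_zero)
    have "((\<lambda>t. y t i - x 0 i) \<longlongrightarrow> 0) (at_right 0)"
    proof (rule Lim_null_comparison[OF _ z], use evb in eventually_elim)
      case (elim t)
      then show ?case using \<theta>[OF elim] by (simp add: y_def abs_mult mult_left_le_one_le)
    qed
    then show "((\<lambda>t. y t i) \<longlongrightarrow> x 0 i) (at_right 0)" by (rule LIM_zero_cancel)
  qed
  have yU: "eventually (\<lambda>t. y t \<in> U) (at_right 0)"
    using evb
  proof eventually_elim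
    case (elim t)
    then show ?case using box[OF elim, of "\<theta> t"] \<theta>[OF elim] d(2) unfolding y_def by auto
  qed
  have "R \<in> O[at_right 0](\<lambda>t. (t powr b) ^ Suc N0)"
    unfolding R_def by (rule dir_deriv_bigo[OF U xU ty yU b(2) f])
  also have "(\<lambda>t. (t powr b) ^ Suc N0) = (\<lambda>t. t powr (b * real (Suc N0)))"
  proof (rule ext)
    show "(t powr b) ^ Suc N0 = t powr (b * real (Suc N0))" for t
      by (cases "t = 0") (simp_all add: powr_power mult.commute del: power_Suc of_nat_Suc)
  qed
  finally have "R \<in> o[at_right 0](\<lambda>t. t)"
    using powr_smallo_id[OF N] by (rule landau_o.big_small_trans)
  then have germR: "frac_germ (\<lambda>t. 1 / fact (Suc N0) * R t)"
    by (intro frac_germ_cmult frac_germ.small)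
  have "frac_germ (\<lambda>t. \<Sum>m<N0. 1 / fact (Suc m) * dir_deriv n (Suc m) f (v t) (x 0))"
    by (intro frac_germ_sum frac_germ_cmult dir_deriv_frac_germ v)
  from frac_germ.add[OF this germR] show ?thesis
  proof (rule frac_germ_cong, use evb in eventually_elim)
    case (elim t)
    have "f (x t) = f (x 0) + (\<Sum>m<N0. dir_deriv n (Suc m) f (v t) (x 0) / fact (Suc m)) + R t / fact (Suc N0)"
      using \<theta>[OF elim] unfolding R_def y_def sum.lessThan_Suc_shift by simp
    then show ?case by (simp del: fact_Suc dir_deriv.simps(2))
  qed
qed

text \<open>
  By the increment formula \<open>f (x t) - f (y t)\<close> is a combination of the \<open>o(t)\<close> differences of the
  coordinates, with coefficients that converge because the intermediate points tend to
  \<open>x 0\<close>.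
\<close>

proposition smooth_fn_smallo:
  assumes U: "openin (Euclidean_space n) U" and f: "smooth_fn n U f"
    and x: "little_oh_poly n U x" and y: "little_oh_poly n U y" and xy: "x 0 = y 0"
    and o: "\<And>j. j < n \<Longrightarrow> (\<lambda>t. x t j - y t j) \<in> o[at_right 0](\<lambda>t. t)"
  shows "(\<lambda>t. f (x t) - f (y t)) \<in> o[at_right 0](\<lambda>t. t)"
proof -
  have xU: "x 0 \<in> U" by (rule little_oh_poly_start[OF x])
  obtain d where d: "d > 0" "open_cube n (x 0) d \<subseteq> U"
    using U xU unfolding openin_iff_open_cube by blast
  have evb: "eventually (\<lambda>t. z t \<in> open_cube n (x 0) d) (at_right 0)"
    if z: "little_oh_poly n U z" "z 0 = x 0" for z
  proof -
    have "eventually (\<lambda>t. z t \<in> Rn n) (at_right 0)"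
      using little_oh_poly_eventually[OF z(1)] by eventually_elim (use subset_Rn[OF U] in blast)
    from eventually_in_open_cube[OF little_oh_poly_coord_limit[OF z(1)] this d(1)] show ?thesis by (simp add: z(2))
  qed
  note evx = evb[OF x refl] and evy = evb[OF y xy[symmetric]]
  have "\<forall>t. \<exists>\<xi>. x t \<in> open_cube n (x 0) d \<and> y t \<in> open_cube n (x 0) d \<longrightarrow>
     (\<forall>j<n. \<xi> j \<in> Rn n \<and> (\<forall>i<n. \<bar>\<xi> j i - x 0 i\<bar> \<le> max \<bar>x t i - x 0 i\<bar> \<bar>y t i - x 0 i\<bar>)) \<and>
     f (x t) - f (y t) = (\<Sum>j<n. partial_deriv j f (\<xi> j) * (x t j - y t j))"
    using increment_formula[OF U smooth_fnD[OF f] d(2)] by blast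
  from choice[OF this] obtain \<xi> where \<xi>: "\<And>t. x t \<in> open_cube n (x 0) d \<Longrightarrow> y t \<in> open_cube n (x 0) d \<Longrightarrow>
     (\<forall>j<n. \<xi> t j \<in> Rn n \<and> (\<forall>i<n. \<bar>\<xi> t j i - x 0 i\<bar> \<le> max \<bar>x t i - x 0 i\<bar> \<bar>y t i - x 0 i\<bar>)) \<and>
     f (x t) - f (y t) = (\<Sum>j<n. partial_deriv j f (\<xi> t j) * (x t j - y t j))"
    by blast
  have "(\<lambda>t. partial_deriv j f (\<xi> t j)) \<in> O[at_right 0](\<lambda>_. 1)" if j: "j < n" for j
  proof -
    have "coord_tendsto n (\<lambda>t. \<xi> t j) (x 0) (at_right 0)"
      unfolding coord_tendsto_def
    proof (intro allI impI)
      fix i assume i: "i < n"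
      have "((\<lambda>t. max \<bar>x t i - x 0 i\<bar> \<bar>y t i - x 0 i\<bar>) \<longlongrightarrow> max \<bar>x 0 i - x 0 i\<bar> \<bar>y 0 i - x 0 i\<bar>) (at_right 0)"
        using little_oh_poly_coord_limit[OF x] little_oh_poly_coord_limit[OF y] i
        unfolding coord_tendsto_def by (intro tendsto_intros) auto
      then have z: "((\<lambda>t. max \<bar>x t i - x 0 i\<bar> \<bar>y t i - x 0 i\<bar>) \<longlongrightarrow> 0) (at_right 0)"
        by (simp add: xy)
      have "((\<lambda>t. \<xi> t j i - x 0 i) \<longlongrightarrow> 0) (at_right 0)"
        by (rule Lim_null_comparison[OF _ z], use evx evy in eventually_elim) (use \<xi> i j in auto)
      then show "((\<lambda>t. \<xi> t j i) \<longlongrightarrow> x 0 i) (at_right 0)" by (rule LIM_zero_cancel)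
    qed
    moreover have "eventually (\<lambda>t. \<xi> t j \<in> U) (at_right 0)"
      using evx evy
    proof eventually_elim
      case (elim t)
      then have "\<xi> t j \<in> open_cube n (x 0) d"
        using \<xi>[OF elim] j unfolding open_cube_def by fastforce
      then show ?case using d(2) by blast
    qed
    ultimately have "((\<lambda>t. partial_deriv j f (\<xi> t j)) \<longlongrightarrow> partial_deriv j f (x 0)) (at_right 0)"
      by (rule continuous_tendsto[OF smooth_fn_continuous[OF smooth_fn_partial_deriv[OF U f j]] U xU])
    then show ?thesis by (auto intro: bigoI_tendsto)
  qed
  then have "(\<lambda>t. \<Sum>j<n. partial_deriv j f (\<xi> t j) * (x t j - y t j)) \<in> o[at_right 0](\<lambda>t. 1 * t)"
    using o by (intro big_sum_in_smallo landau_o.big_small_mult) auto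
  moreover have "eventually (\<lambda>t. (\<Sum>j<n. partial_deriv j f (\<xi> t j) * (x t j - y t j)) = f (x t) - f (y t)) (at_right 0)"
    using evx evy by eventually_elim (simp add: \<xi>)
  ultimately show ?thesis using landau_o.small.in_cong by fastforce
qed

section \<open>Fermat classes and Fermat extensions\<close>

text \<open>
  The content of \<^const>\<open>smooth_maps\<close> without extensionality, so that smoothness of a composite or of a
  coordinate projection can be stated for the plain function.
\<close>

definition smooth_into :: "nat \<Rightarrow> vec set \<Rightarrow> nat \<Rightarrow> vec set \<Rightarrow> (vec \<Rightarrow> vec) \<Rightarrow> bool"
  where "smooth_into n U m V f \<longleftrightarrow> f \<in> U \<rightarrow> V \<and> (\<forall>j<m. smooth_fn n U (\<lambda>x. f x j))"

lemma smooth_maps_iff: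
  "f \<in> smooth_maps (n, U) (m, V) \<longleftrightarrow> f \<in> extensional U \<and> smooth_into n U m V f"
  by (auto simp: smooth_maps_def smooth_into_def smooth_fn_def PiE_def)

lemma smooth_into_cong:
  assumes "openin (Euclidean_space n) U" "smooth_into n U m V f" "\<And>x. x \<in> U \<Longrightarrow> f x = g x"
  shows "smooth_into n U m V g"
  unfolding smooth_into_def smooth_fn_def
proof (intro conjI allI impI)
  show "g \<in> U \<rightarrow> V" using assms(2,3) by (auto simp: smooth_into_def Pi_iff)
  show "Cr_on r n U (\<lambda>x. g x j)" if "j < m" for j r
    by (rule Cr_on_cong[OF assms(1), of "\<lambda>x. f x j"])
       (use assms that in \<open>auto simp: smooth_into_def smooth_fn_def\<close>)
qed

lemma smooth_into_restrict:
  "openin (Euclidean_space n) U \<Longrightarrow> smooth_into n U m V f \<Longrightarrow> restrict f U \<in> smooth_maps (n, U) (m, V)"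
  unfolding smooth_maps_iff using smooth_into_cong[of n U m V f "restrict f U"] by simp

lemma smooth_into_subset:
  assumes "smooth_into n U m V f" "U' \<subseteq> U" "f \<in> U' \<rightarrow> V'"
  shows "smooth_into n U' m V' f"
  using assms unfolding smooth_into_def smooth_fn_def by (blast intro: Cr_on_subset)

lemma smooth_into_compose:
  assumes "openin (Euclidean_space n) U" "openin (Euclidean_space m) V"
    and f: "smooth_into n U m V f" and g: "smooth_into m V l W g"
  shows "smooth_into n U l W (\<lambda>x. g (f x))"
  using f g unfolding smooth_into_def smooth_fn_def
  by (auto intro!: Cr_on_compose[OF assms(2,1), where f = "\<lambda>y. g y _"])

lemma smooth_into_const: "c \<in> V \<Longrightarrow> smooth_into n U m V (\<lambda>_. c)"
  by (simp add: smooth_into_def smooth_fn_def Cr_on_const)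

lemma smooth_into_ident: "smooth_into n U n U (\<lambda>x. x)"
  by (simp add: smooth_into_def smooth_fn_def Cr_on_coordinate)

lemma smooth_into_preimage_open:
  assumes "openin (Euclidean_space n) U" "openin (Euclidean_space m) V" "V' \<subseteq> Rn m" "smooth_into n U m V' f"
  shows "openin (Euclidean_space n) {x \<in> U. f x \<in> V}"
  using assms(4) unfolding smooth_into_def
  by (intro openin_preimage[OF assms(2,1,3)] smooth_fn_continuous) auto

lemma smooth_into_little_oh_poly:
  assumes "openin (Euclidean_space n) U" "smooth_into n U m V f" "little_oh_poly n U x"
  shows "little_oh_poly m V (\<lambda>t. f (x t))"
  using assms smooth_fn_little_oh_poly[OF assms(1) _ assms(3)]
  unfolding little_oh_poly_iff_frac_germ smooth_into_def by (auto simp: Pi_iff)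

text \<open>
  The class is taken in the whole Euclidean space. For a curve in an open set U it is literally the
  same set as the class relative to U (\<open>fermat_rel_open\<close>), so one notation serves all domains.
\<close>

definition fermat_class :: "nat \<Rightarrow> (real \<Rightarrow> vec) \<Rightarrow> fpoint"
  where "fermat_class n x = fermat_rel n (Rn n) `` {x}"

lemma fermat_rel_iff:
  "(x, y) \<in> fermat_rel n U \<longleftrightarrow> little_oh_poly n U x \<and> little_oh_poly n U y \<and> x 0 = y 0 \<and>
     (\<forall>j<n. (\<lambda>t. x t j - y t j) \<in> o[at_right 0](\<lambda>t. t))"
  by (simp add: fermat_rel_def vnorm_smallo_iff)

lemma equiv_fermat_rel: "equiv {x. little_oh_poly n U x} (fermat_rel n U)"
proof (rule equivI)
  show "fermat_rel n U \<subseteq> {x. little_oh_poly n U x} \<times> {x. little_oh_poly n U x}"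
    by (auto simp: fermat_rel_iff)
  show "refl_on {x. little_oh_poly n U x} (fermat_rel n U)"
    by (auto simp: refl_on_def fermat_rel_iff)
  have "(\<lambda>t. y t j - x t j) \<in> o[at_right 0](\<lambda>t. t)" if "(\<lambda>t. x t j - y t j) \<in> o[at_right 0](\<lambda>t. t)"
    for x y :: "real \<Rightarrow> vec" and j
    using that by (subst landau_o.small.uminus_in_iff[symmetric]) simp
  then show "sym (fermat_rel n U)" by (auto simp: sym_def fermat_rel_iff)
  have "(\<lambda>t. x t j - z t j) \<in> o[at_right 0](\<lambda>t. t)"
    if "(\<lambda>t. x t j - y t j) \<in> o[at_right 0](\<lambda>t. t)" "(\<lambda>t. y t j - z t j) \<in> o[at_right 0](\<lambda>t. t)"
    for x y z :: "real \<Rightarrow> vec" and j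
    using sum_in_smallo(1)[OF that] by simp
  then show "trans (fermat_rel n U)" by (auto simp: trans_def fermat_rel_iff)
qed

lemma little_oh_poly_Rn: "openin (Euclidean_space n) U \<Longrightarrow> little_oh_poly n U x \<Longrightarrow> little_oh_poly n (Rn n) x"
  using little_oh_poly_open by blast

lemma little_oh_poly_openI:
  "openin (Euclidean_space n) U \<Longrightarrow> little_oh_poly n (Rn n) x \<Longrightarrow> x 0 \<in> U \<Longrightarrow> little_oh_poly n U x"
  by (simp add: little_oh_poly_open[of n U])

lemma fermat_class_eq_iff:
  assumes "little_oh_poly n (Rn n) x" "little_oh_poly n (Rn n) y"
  shows "fermat_class n x = fermat_class n y \<longleftrightarrow> x 0 = y 0 \<and> (\<forall>j<n. (\<lambda>t. x t j - y t j) \<in> o[at_right 0](\<lambda>t. t))"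
  using eq_equiv_class_iff[OF equiv_fermat_rel, of x n "Rn n" y] assms
  by (simp add: fermat_class_def fermat_rel_iff)

lemma mem_fermat_class:
  "y \<in> fermat_class n x \<Longrightarrow> little_oh_poly n (Rn n) y \<and> fermat_class n y = fermat_class n x \<and> y 0 = x 0"
  using equiv_class_eq[OF equiv_fermat_rel, of x y n "Rn n"] by (auto simp: fermat_class_def fermat_rel_iff)

lemma fermat_class_self: "little_oh_poly n (Rn n) x \<Longrightarrow> x \<in> fermat_class n x"
  by (simp add: fermat_class_def fermat_rel_refl)

lemma mem_fermat_iff:
  assumes "openin (Euclidean_space n) U"
  shows "a \<in> fermat n U \<longleftrightarrow> (\<exists>x. little_oh_poly n U x \<and> a = fermat_class n x)"
  using fermat_rel_open[OF assms] by (auto simp: fermat_def quotient_def fermat_class_def)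

lemma fermat_class_in_fermat_iff:
  assumes "openin (Euclidean_space n) U" "little_oh_poly n (Rn n) x"
  shows "fermat_class n x \<in> fermat n U \<longleftrightarrow> little_oh_poly n U x"
proof
  assume "fermat_class n x \<in> fermat n U"
  then obtain y where y: "little_oh_poly n U y" "fermat_class n x = fermat_class n y"
    using mem_fermat_iff[OF assms(1)] by blast
  then have "x 0 = y 0" using fermat_class_self[OF assms(2)] mem_fermat_class by metis
  then show "little_oh_poly n U x"
    using y(1) assms(2) little_oh_poly_open[OF assms(1)] by metis
qed (use mem_fermat_iff[OF assms(1)] in blast)

lemma std_part_fermat_class: "little_oh_poly n (Rn n) x \<Longrightarrow> std_part (fermat_class n x) = x 0"
  unfolding fermat_class_def by (rule std_part_class)

lemma fermat_subset: "openin (Euclidean_space n) U \<Longrightarrow> fermat n U \<subseteq> fermat n (Rn n)"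
  using fermat_open by blast

text \<open>
  A class depends only on the values near 0, the value at 0 included. It is used for curves y and z
  built from x by formulas that agree only as long as x stays in U.
\<close>

lemma fermat_class_cong:
  assumes x: "little_oh_poly n U x" and eq: "\<And>t. x t \<in> U \<Longrightarrow> y t = z t"
    and y: "little_oh_poly m (Rn m) y"
  shows "fermat_class m y = fermat_class m z"
proof -
  obtain \<epsilon> where \<epsilon>: "\<epsilon> > 0" "\<forall>t\<in>{0..<\<epsilon>}. x t \<in> U" using x unfolding little_oh_poly_def by blast
  obtain \<delta> where \<delta>: "\<delta> > 0" "\<forall>t\<in>{0..<\<delta>}. y t \<in> Rn m" using y unfolding little_oh_poly_def by blast
  have 0: "y 0 = z 0" using eq[OF little_oh_poly_start[OF x]] by simp
  have yz: "eventually (\<lambda>t. y t = z t) (at_right 0)"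
    using little_oh_poly_eventually[OF x] by eventually_elim (use eq in simp)
  have "\<forall>t\<in>{0..<min \<epsilon> \<delta>}. z t \<in> Rn m"
    using \<epsilon>(2) \<delta>(2) eq by (metis atLeastLessThan_iff min_less_iff_conj)
  moreover have "frac_germ (\<lambda>t. z t j - z 0 j)" if "j < m" for j
  proof (rule frac_germ_cong)
    show "frac_germ (\<lambda>t. y t j - y 0 j)" using y that unfolding little_oh_poly_iff_frac_germ by blast
    show "eventually (\<lambda>t. y t j - y 0 j = z t j - z 0 j) (at_right 0)"
      using yz by eventually_elim (simp add: 0)
  qed
  ultimately have z: "little_oh_poly m (Rn m) z"
    unfolding little_oh_poly_iff_frac_germ using \<epsilon>(1) \<delta>(1) by (metis min_less_iff_conj)
  have "(\<lambda>t. y t j - z t j) \<in> o[at_right 0](\<lambda>t. t)" for j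
    using yz by (subst landau_o.small.in_cong[where g = "\<lambda>_. 0"]) (auto elim: eventually_mono)
  then show ?thesis using 0 by (simp add: fermat_class_eq_iff[OF y z])
qed

lemma fermat_class_smooth_well_defined:
  assumes U: "openin (Euclidean_space n) U" and V: "openin (Euclidean_space m) V" and f: "smooth_into n U m V f"
    and x: "little_oh_poly n U x" and y: "little_oh_poly n U y" and xy: "fermat_class n x = fermat_class n y"
  shows "fermat_class m (\<lambda>t. f (x t)) = fermat_class m (\<lambda>t. f (y t))"
proof -
  note R = little_oh_poly_Rn[OF U x] little_oh_poly_Rn[OF U y]
  have e: "x 0 = y 0" "\<And>j. j < n \<Longrightarrow> (\<lambda>t. x t j - y t j) \<in> o[at_right 0](\<lambda>t. t)"
    using xy fermat_class_eq_iff[OF R] by auto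
  show ?thesis
    using f smooth_fn_smallo[OF U _ x y e] smooth_into_little_oh_poly[OF U f x]
      smooth_into_little_oh_poly[OF U f y] little_oh_poly_Rn[OF V] e(1)
    by (subst fermat_class_eq_iff) (auto simp: smooth_into_def)
qed

text \<open>
  This reduces statements about Fermat extensions to statements about representatives.
\<close>

lemma fermat_ext_fermat_class:
  assumes U: "openin (Euclidean_space n) U" and V: "openin (Euclidean_space m) V"
    and f: "smooth_into n U m V f" and x: "little_oh_poly n U x"
  shows "fermat_ext (n, U) (m, V) f (fermat_class n x) = fermat_class m (\<lambda>t. f (x t))"
proof -
  have xR: "little_oh_poly n (Rn n) x" by (rule little_oh_poly_Rn[OF U x])
  have "fermat_rel m V `` {\<lambda>t. f (y t)} = fermat_class m (\<lambda>t. f (x t))" if y: "y \<in> fermat_class n x" for y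
  proof -
    have yU: "little_oh_poly n U y"
      using mem_fermat_class[OF y] little_oh_poly_open[OF U] little_oh_poly_start[OF x] by metis
    have "fermat_rel m V `` {\<lambda>t. f (y t)} = fermat_class m (\<lambda>t. f (y t))"
      unfolding fermat_class_def by (rule fermat_rel_open[OF V smooth_into_little_oh_poly[OF U f yU]])
    then show ?thesis
      using fermat_class_smooth_well_defined[OF U V f yU x] mem_fermat_class[OF y] by simp
  qed
  then show ?thesis
    using fermat_class_self[OF xR] fermat_class_in_fermat_iff[OF U xR] x by (auto simp: fermat_ext_def)
qed

section \<open>Products of domains\<close>

lemma vjoin_in_Rn: "u \<in> Rn k \<Longrightarrow> v \<in> Rn n \<Longrightarrow> vjoin k u v \<in> Rn (k + n)"
  by (auto simp: Rn_iff vjoin_def)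

text \<open>
  The inverse of \<^const>\<open>vjoin\<close>. The first part is padded by zeros, as points of a space of dimension k
  have to be.
\<close>

definition vtake :: "nat \<Rightarrow> vec \<Rightarrow> vec" where "vtake k w = (\<lambda>i. if i < k then w i else 0)"
definition vdrop :: "nat \<Rightarrow> vec \<Rightarrow> vec" where "vdrop k w = (\<lambda>i. w (i + k))"

lemma vjoin_take_drop: "vjoin k (vtake k w) (vdrop k w) = w"
  by (auto simp: vjoin_def vtake_def vdrop_def fun_eq_iff)

lemma vtake_vjoin: "u \<in> Rn k \<Longrightarrow> vtake k (vjoin k u v) = u"
  by (auto simp: vjoin_def vtake_def Rn_iff fun_eq_iff)

lemma vdrop_vjoin: "vdrop k (vjoin k u v) = v"
  by (auto simp: vjoin_def vdrop_def fun_eq_iff)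

lemma vjoin_assoc: "vjoin (k + l) (vjoin k u v) w = vjoin k u (vjoin l v w)"
  by (auto simp: vjoin_def fun_eq_iff)

lemma vjoin_in_vprod: "u \<in> P \<Longrightarrow> v \<in> U \<Longrightarrow> vjoin k u v \<in> vprod k P U"
  by (auto simp: vprod_def)

lemma mem_vprod_iff:
  assumes "P \<subseteq> Rn k"
  shows "w \<in> vprod k P U \<longleftrightarrow> vtake k w \<in> P \<and> vdrop k w \<in> U"
proof
  assume "w \<in> vprod k P U"
  then obtain u v where "u \<in> P" "v \<in> U" "w = vjoin k u v" by (auto simp: vprod_def)
  then show "vtake k w \<in> P \<and> vdrop k w \<in> U"
    using assms vtake_vjoin vdrop_vjoin by auto
next
  assume "vtake k w \<in> P \<and> vdrop k w \<in> U"
  then show "w \<in> vprod k P U" unfolding vprod_def using vjoin_take_drop[of k w] by force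
qed

lemma vprod_open_cube:
  assumes "u \<in> Rn k"
  shows "vprod k (open_cube k u d) (open_cube n v d) = open_cube (k + n) (vjoin k u v) d"
proof (rule set_eqI)
  fix w
  have "vtake k w \<in> open_cube k u d \<longleftrightarrow> (\<forall>i<k. \<bar>w i - u i\<bar> < d)"
    by (auto simp: open_cube_def vtake_def Rn_iff)
  moreover have "vdrop k w \<in> open_cube n v d \<longleftrightarrow> w \<in> Rn (k + n) \<and> (\<forall>i<n. \<bar>w (i + k) - v i\<bar> < d)"
  proof -
    have "(\<forall>i\<ge>n. w (i + k) = 0) \<longleftrightarrow> (\<forall>i\<ge>k + n. w i = 0)"
      by (metis add.commute add_le_mono1 le_add_diff_inverse2 le_add2 le_trans nat_add_left_cancel_le add_le_imp_le_right)
    then show ?thesis by (simp add: open_cube_def vdrop_def Rn_iff)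
  qed
  moreover have "(\<forall>i<k + n. \<bar>w i - vjoin k u v i\<bar> < d) \<longleftrightarrow>
      (\<forall>i<k. \<bar>w i - u i\<bar> < d) \<and> (\<forall>i<n. \<bar>w (i + k) - v i\<bar> < d)"
  proof (intro iffI conjI allI impI)
    fix i assume a: "\<forall>i<k + n. \<bar>w i - vjoin k u v i\<bar> < d"
    show "\<bar>w i - u i\<bar> < d" if "i < k" using a[rule_format, of i] that by (simp add: vjoin_def)
    show "\<bar>w (i + k) - v i\<bar> < d" if "i < n" using a[rule_format, of "i + k"] that by (simp add: vjoin_def)
  next
    fix i assume a: "(\<forall>i<k. \<bar>w i - u i\<bar> < d) \<and> (\<forall>i<n. \<bar>w (i + k) - v i\<bar> < d)" and i: "i < k + n"
    show "\<bar>w i - vjoin k u v i\<bar> < d"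
    proof (cases "i < k")
      case True then show ?thesis using a by (simp add: vjoin_def)
    next
      case False
      then show ?thesis using conjunct2[OF a, rule_format, of "i - k"] i by (simp add: vjoin_def)
    qed
  qed
  ultimately show "w \<in> vprod k (open_cube k u d) (open_cube n v d) \<longleftrightarrow> w \<in> open_cube (k + n) (vjoin k u v) d"
    using mem_vprod_iff[of "open_cube k u d" k w "open_cube n v d"] by (auto simp: open_cube_def)
qed

lemma vprod_mono: "P \<subseteq> P' \<Longrightarrow> U \<subseteq> U' \<Longrightarrow> vprod k P U \<subseteq> vprod k P' U'"
  by (auto simp: vprod_def)

lemma open_cube_mono: "d \<le> e \<Longrightarrow> open_cube n c d \<subseteq> open_cube n c e"
  by (auto simp: open_cube_def)

lemma openin_vprod:
  assumes P: "openin (Euclidean_space k) P" and U: "openin (Euclidean_space n) U"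
  shows "openin (Euclidean_space (k + n)) (vprod k P U)"
  unfolding openin_iff_open_cube
proof (intro conjI ballI)
  show "vprod k P U \<subseteq> Rn (k + n)"
    using subset_Rn[OF P] subset_Rn[OF U] unfolding vprod_def by (blast intro: vjoin_in_Rn)
  fix w assume "w \<in> vprod k P U"
  then obtain u v where uv: "u \<in> P" "v \<in> U" "w = vjoin k u v" by (auto simp: vprod_def)
  obtain d where d: "d > 0" "open_cube k u d \<subseteq> P" using P uv(1) unfolding openin_iff_open_cube by blast
  obtain e where e: "e > 0" "open_cube n v e \<subseteq> U" using U uv(2) unfolding openin_iff_open_cube by blast
  have "u \<in> Rn k" using uv(1) subset_Rn[OF P] by blast
  then have "open_cube (k + n) w (min d e) = vprod k (open_cube k u (min d e)) (open_cube n v (min d e))"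
    by (simp add: uv(3) vprod_open_cube)
  also have "\<dots> \<subseteq> vprod k P U"
    using d(2) e(2) open_cube_mono[of "min d e" d k u] open_cube_mono[of "min d e" e n v] by (intro vprod_mono) auto
  finally show "\<exists>d>0. open_cube (k + n) w d \<subseteq> vprod k P U"
    using d(1) e(1) by (intro exI[of _ "min d e"]) simp
qed

lemma little_oh_poly_vjoin:
  assumes u: "little_oh_poly k P u" and v: "little_oh_poly n U v"
  shows "little_oh_poly (k + n) (vprod k P U) (\<lambda>t. vjoin k (u t) (v t))"
  unfolding little_oh_poly_iff_frac_germ
proof (intro conjI allI impI)
  obtain \<epsilon> \<delta> where *: "\<epsilon> > 0" "\<forall>t\<in>{0..<\<epsilon>}. u t \<in> P" "\<delta> > 0" "\<forall>t\<in>{0..<\<delta>}. v t \<in> U"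
    using u v unfolding little_oh_poly_def by blast
  then show "\<exists>\<epsilon>>0. \<forall>t\<in>{0..<\<epsilon>}. vjoin k (u t) (v t) \<in> vprod k P U"
    by (intro exI[of _ "min \<epsilon> \<delta>"]) (auto intro: vjoin_in_vprod)
  fix j assume "j < k + n"
  then show "frac_germ (\<lambda>t. vjoin k (u t) (v t) j - vjoin k (u 0) (v 0) j)"
    using u v unfolding little_oh_poly_iff_frac_germ by (cases "j < k") (auto simp: vjoin_def)
qed

lemma vprod_Rn: "vprod k (Rn k) (Rn n) = Rn (k + n)"
proof
  show "Rn (k + n) \<subseteq> vprod k (Rn k) (Rn n)"
    by (auto simp: mem_vprod_iff Rn_iff vtake_def vdrop_def)
qed (auto simp: vprod_def intro: vjoin_in_Rn)

text \<open>
  The identification of pairs of Fermat points with Fermat points of the product is the pairing of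
  representatives.
\<close>

lemma fermat_pair_fermat_class:
  assumes u: "little_oh_poly k (Rn k) u" and v: "little_oh_poly n (Rn n) v"
  shows "fermat_pair k n (fermat_class k u) (fermat_class n v) = fermat_class (k + n) (\<lambda>t. vjoin k (u t) (v t))"
proof -
  have "fermat_class (k + n) (\<lambda>t. vjoin k (u' t) (v' t)) = fermat_class (k + n) (\<lambda>t. vjoin k (u t) (v t))"
    if u': "u' \<in> fermat_class k u" and v': "v' \<in> fermat_class n v" for u' v'
  proof -
    have lu: "little_oh_poly k (Rn k) u'" "fermat_class k u' = fermat_class k u"
      and lv: "little_oh_poly n (Rn n) v'" "fermat_class n v' = fermat_class n v"
      using mem_fermat_class[OF u'] mem_fermat_class[OF v'] by auto
    note L = little_oh_poly_vjoin[OF lu(1) lv(1), unfolded vprod_Rn] little_oh_poly_vjoin[OF u v, unfolded vprod_Rn]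
    have "u' 0 = u 0" "v' 0 = v 0"
      and o: "\<forall>j<k. (\<lambda>t. u' t j - u t j) \<in> o[at_right 0](\<lambda>t. t)" "\<forall>j<n. (\<lambda>t. v' t j - v t j) \<in> o[at_right 0](\<lambda>t. t)"
      using lu(2) lv(2) fermat_class_eq_iff[OF lu(1) u] fermat_class_eq_iff[OF lv(1) v] by auto
    moreover have "(\<lambda>t. vjoin k (u' t) (v' t) j - vjoin k (u t) (v t) j) \<in> o[at_right 0](\<lambda>t. t)" if "j < k + n" for j
      using o that by (cases "j < k") (auto simp: vjoin_def)
    ultimately show ?thesis unfolding fermat_class_eq_iff[OF L] by simp
  qed
  moreover have "fermat_class k u \<noteq> {}" "fermat_class n v \<noteq> {}"
    using fermat_class_self[OF u] fermat_class_self[OF v] by auto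
  ultimately show ?thesis
    unfolding fermat_pair_def fermat_class_def[of "k + n", symmetric]
    by (intro SUP_eq_const) assumption+
qed

section \<open>Quasi-standard smooth maps\<close>

lemma smooth_into_vtake: "P \<subseteq> Rn k \<Longrightarrow> smooth_into (k + n) (vprod k P U) k P (vtake k)"
  by (auto simp: smooth_into_def smooth_fn_def mem_vprod_iff vtake_def Cr_on_coordinate)

lemma smooth_into_vdrop: "P \<subseteq> Rn k \<Longrightarrow> smooth_into (k + n) (vprod k P U) n U (vdrop k)"
  by (auto simp: smooth_into_def smooth_fn_def mem_vprod_iff) (simp add: vdrop_def Cr_on_coordinate)

lemma smooth_into_vjoin:
  assumes "smooth_into n U k P \<phi>" "smooth_into n U l Q \<psi>"
  shows "smooth_into n U (k + l) (vprod k P Q) (\<lambda>x. vjoin k (\<phi> x) (\<psi> x))"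
  unfolding smooth_into_def
proof (intro conjI allI impI)
  show "(\<lambda>x. vjoin k (\<phi> x) (\<psi> x)) \<in> U \<rightarrow> vprod k P Q"
    using assms unfolding smooth_into_def by (auto intro: vjoin_in_vprod)
  fix j assume "j < k + l"
  then show "smooth_fn n U (\<lambda>x. vjoin k (\<phi> x) (\<psi> x) j)"
    using assms unfolding smooth_into_def by (cases "j < k") (auto simp: vjoin_def)
qed

text \<open>
  The local condition in the definition of a quasi-standard smooth map at the class of x. The
  parameter and the points of the domain are given by representatives, and \<open>\<alpha>\<close> is any smooth function
  on the product, extensional or not.
\<close>

definition parametrised_at :: "nat \<Rightarrow> fpoint set \<Rightarrow> nat \<Rightarrow> (fpoint \<Rightarrow> fpoint) \<Rightarrow> (real \<Rightarrow> vec) \<Rightarrow> bool"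
  where "parametrised_at n A m f x \<longleftrightarrow> (\<exists>U k P \<alpha> u.
    openin (Euclidean_space n) U \<and> x 0 \<in> U \<and> openin (Euclidean_space k) P \<and> little_oh_poly k P u \<and>
    smooth_into (k + n) (vprod k P U) m (Rn m) \<alpha> \<and>
    (\<forall>y. little_oh_poly n U y \<longrightarrow> fermat_class n y \<in> A \<longrightarrow> f (fermat_class n y) = fermat_class m (\<lambda>t. \<alpha> (vjoin k (u t) (y t)))))"

lemma fermat_ext_pair:
  assumes U: "openin (Euclidean_space n) U" and P: "openin (Euclidean_space k) P"
    and \<alpha>: "smooth_into (k + n) (vprod k P U) m (Rn m) \<alpha>"
    and u: "little_oh_poly k P u" and y: "little_oh_poly n U y"
  shows "fermat_ext (k + n, vprod k P U) (m, Rn m) \<alpha> (fermat_pair k n (fermat_class k u) (fermat_class n y)) =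
    fermat_class m (\<lambda>t. \<alpha> (vjoin k (u t) (y t)))"
  unfolding fermat_pair_fermat_class[OF little_oh_poly_Rn[OF P u] little_oh_poly_Rn[OF U y]]
  by (rule fermat_ext_fermat_class[OF openin_vprod[OF P U] openin_Rn \<alpha> little_oh_poly_vjoin[OF u y]])

lemma qs_smooth_maps_iff:
  assumes A: "A \<subseteq> fermat n (Rn n)"
  shows "f \<in> qs_smooth_maps (n, A) (m, B) \<longleftrightarrow> f \<in> A \<rightarrow>\<^sub>E B \<and>
    (\<forall>x. little_oh_poly n (Rn n) x \<longrightarrow> fermat_class n x \<in> A \<longrightarrow> parametrised_at n A m f x)"
proof (intro iffI conjI allI impI)
  assume f: "f \<in> qs_smooth_maps (n, A) (m, B)"
  then show "f \<in> A \<rightarrow>\<^sub>E B" by (simp add: qs_smooth_maps_def)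
  fix x assume x: "little_oh_poly n (Rn n) x" "fermat_class n x \<in> A"
  obtain U k P \<alpha> p where *: "p \<in> fermat k P" "openin (Euclidean_space n) U" "std_part (fermat_class n x) \<in> U"
      "openin (Euclidean_space k) P" "\<alpha> \<in> smooth_maps (k + n, vprod k P U) (m, Rn m)"
      "\<forall>x\<in>A \<inter> fermat n U. f x = fermat_ext (k + n, vprod k P U) (m, Rn m) \<alpha> (fermat_pair k n p x)"
    using f x(2) unfolding qs_smooth_maps_def fst_conv snd_conv by blast
  obtain u where u: "little_oh_poly k P u" "p = fermat_class k u"
    using *(1) mem_fermat_iff[OF *(4)] by blast
  have \<alpha>: "smooth_into (k + n) (vprod k P U) m (Rn m) \<alpha>"
    using *(5) by (simp add: smooth_maps_iff)
  show "parametrised_at n A m f x"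
    unfolding parametrised_at_def
  proof (intro exI conjI allI impI)
    show "x 0 \<in> U" using *(3) by (simp add: std_part_fermat_class[OF x(1)])
    fix y assume y: "little_oh_poly n U y" "fermat_class n y \<in> A"
    then have "fermat_class n y \<in> A \<inter> fermat n U" using mem_fermat_iff[OF *(2)] by blast
    with *(6) show "f (fermat_class n y) = fermat_class m (\<lambda>t. \<alpha> (vjoin k (u t) (y t)))"
      using fermat_ext_pair[OF *(2,4) \<alpha> u(1) y(1)] by (simp add: u(2))
  qed (fact *(2) *(4) u(1) \<alpha>)+
next
  assume f: "f \<in> A \<rightarrow>\<^sub>E B \<and>
    (\<forall>x. little_oh_poly n (Rn n) x \<longrightarrow> fermat_class n x \<in> A \<longrightarrow> parametrised_at n A m f x)"
  show "f \<in> qs_smooth_maps (n, A) (m, B)"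
    unfolding qs_smooth_maps_def fst_conv snd_conv
  proof (intro CollectI conjI ballI)
    show "f \<in> A \<rightarrow>\<^sub>E B" using f by blast
    fix a assume a: "a \<in> A"
    then obtain x where x: "little_oh_poly n (Rn n) x" "a = fermat_class n x"
      using A mem_fermat_iff[OF openin_Rn] by blast
    then have "parametrised_at n A m f x" using f a by blast
    then obtain U k P \<alpha> u where *: "openin (Euclidean_space n) U" "x 0 \<in> U" "openin (Euclidean_space k) P"
      "little_oh_poly k P u" "smooth_into (k + n) (vprod k P U) m (Rn m) \<alpha>"
      "\<And>y. little_oh_poly n U y \<Longrightarrow> fermat_class n y \<in> A \<Longrightarrow> f (fermat_class n y) = fermat_class m (\<lambda>t. \<alpha> (vjoin k (u t) (y t)))"
      unfolding parametrised_at_def by blast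
    define \<alpha>' where "\<alpha>' = restrict \<alpha> (vprod k P U)"
    have \<alpha>': "\<alpha>' \<in> smooth_maps (k + n, vprod k P U) (m, Rn m)"
      unfolding \<alpha>'_def by (rule smooth_into_restrict[OF openin_vprod[OF *(3,1)] *(5)])
    show "\<exists>U k P \<alpha>. \<exists>p\<in>fermat k P. openin (Euclidean_space n) U \<and> std_part a \<in> U \<and>
      openin (Euclidean_space k) P \<and> \<alpha> \<in> smooth_maps (k + n, vprod k P U) (m, Rn m) \<and>
      (\<forall>x\<in>A \<inter> fermat n U. f x =
         fermat_ext (k + n, vprod k P U) (m, Rn m) \<alpha> (fermat_pair k n p x))"
    proof (intro exI bexI conjI ballI)
      show "fermat_class k u \<in> fermat k P" using *(4) mem_fermat_iff[OF *(3)] by blast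
      show "std_part a \<in> U" using *(2) by (simp add: x(2) std_part_fermat_class[OF x(1)])
      fix b assume b: "b \<in> A \<inter> fermat n U"
      then obtain y where y: "little_oh_poly n U y" "b = fermat_class n y" using mem_fermat_iff[OF *(1)] by blast
      have s: "smooth_into (k + n) (vprod k P U) m (Rn m) \<alpha>'"
        using \<alpha>' by (simp add: smooth_maps_iff)
      have "f b = fermat_class m (\<lambda>t. \<alpha> (vjoin k (u t) (y t)))" using b y *(6) by simp
      also have "\<dots> = fermat_class m (\<lambda>t. \<alpha>' (vjoin k (u t) (y t)))"
        by (rule fermat_class_cong[OF little_oh_poly_vjoin[OF *(4) y(1)]])
          (simp_all add: \<alpha>'_def smooth_into_little_oh_poly[OF openin_vprod[OF *(3,1)] *(5) little_oh_poly_vjoin[OF *(4) y(1)]])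
      also have "\<dots> = fermat_ext (k + n, vprod k P U) (m, Rn m) \<alpha>' (fermat_pair k n (fermat_class k u) b)"
        using fermat_ext_pair[OF *(1,3) s *(4) y(1)] by (simp add: y(2))
      finally show "f b = fermat_ext (k + n, vprod k P U) (m, Rn m) \<alpha>' (fermat_pair k n (fermat_class k u) b)" .
    qed (fact *(1) *(3) \<alpha>')+
  qed
qed

text \<open>
  A standard smooth map is a family over the space of dimension 0, whose only point serves as
  parameter.
\<close>

lemma parametrised_at_standard:
  assumes U: "openin (Euclidean_space n) U" and x: "x 0 \<in> U" and g: "smooth_into n U m (Rn m) g"
    and eq: "\<And>y. little_oh_poly n U y \<Longrightarrow> fermat_class n y \<in> A \<Longrightarrow> f (fermat_class n y) = fermat_class m (\<lambda>t. g (y t))"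
  shows "parametrised_at n A m f x"
  unfolding parametrised_at_def
proof (intro exI conjI allI impI)
  have "vprod 0 (Rn 0) U = U"
    by (auto simp: mem_vprod_iff vtake_def vdrop_def Rn_iff)
  then show "smooth_into (0 + n) (vprod 0 (Rn 0) U) m (Rn m) g" using g by simp
  show "little_oh_poly 0 (Rn 0) (\<lambda>_ _. 0)"
    by (auto simp: little_oh_poly_iff_frac_germ Rn_iff intro: exI[of _ 1])
  show "f (fermat_class n y) = fermat_class m (\<lambda>t. g (vjoin 0 ((\<lambda>_ _. 0) t) (y t)))"
    if "little_oh_poly n U y" "fermat_class n y \<in> A" for y
    using eq[OF that] by (simp add: vjoin_def)
qed (fact U x openin_Rn)+

lemma qs_smooth_fermat_ext:
  assumes U: "openin (Euclidean_space n) U" and V: "openin (Euclidean_space m) V" and f: "smooth_into n U m V f"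
  shows "fermat_ext (n, U) (m, V) f \<in> qs_smooth_maps (n, fermat n U) (m, fermat m V)"
proof -
  have "fermat_ext (n, U) (m, V) f \<in> fermat n U \<rightarrow>\<^sub>E fermat m V"
  proof
    show "fermat_ext (n, U) (m, V) f a \<in> fermat m V" if "a \<in> fermat n U" for a
      using that fermat_ext_fermat_class[OF U V f] smooth_into_little_oh_poly[OF U f]
      unfolding mem_fermat_iff[OF U] mem_fermat_iff[OF V] by blast
    show "fermat_ext (n, U) (m, V) f a = undefined" if "a \<notin> fermat n U" for a
      using that by (simp add: fermat_ext_def)
  qed
  moreover have "parametrised_at n (fermat n U) m (fermat_ext (n, U) (m, V) f) x"
    if x: "little_oh_poly n (Rn n) x" "fermat_class n x \<in> fermat n U" for x
  proof (rule parametrised_at_standard[OF U])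
    show "x 0 \<in> U" using x fermat_class_in_fermat_iff[OF U x(1)] little_oh_poly_start by blast
    show "smooth_into n U m (Rn m) f"
      using f subset_Rn[OF V] unfolding smooth_into_def by blast
  qed (rule fermat_ext_fermat_class[OF U V f])
  ultimately show ?thesis
    unfolding qs_smooth_maps_iff[OF fermat_subset[OF U]] by blast
qed

lemma qs_smooth_inclusion:
  assumes A: "A \<subseteq> fermat n (Rn n)" and AB: "A \<subseteq> B"
  shows "(\<lambda>x\<in>A. x) \<in> qs_smooth_maps (n, A) (n, B)"
  unfolding qs_smooth_maps_iff[OF A]
  using AB by (auto simp: Rn_iff intro!: parametrised_at_standard[OF openin_Rn _ smooth_into_ident] dest: little_oh_poly_start)

text \<open>
  A point c of the Fermat extension is in general no standard point. It is therefore used as the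
  parameter itself, with the first projection as family of maps.
\<close>

lemma qs_smooth_const:
  assumes A: "A \<subseteq> fermat n (Rn n)" and B: "B \<subseteq> fermat m (Rn m)" and c: "c \<in> B"
  shows "(\<lambda>_\<in>A. c) \<in> qs_smooth_maps (n, A) (m, B)"
proof -
  obtain u where u: "little_oh_poly m (Rn m) u" "c = fermat_class m u"
    using B c mem_fermat_iff[OF openin_Rn] by blast
  have "parametrised_at n A m (\<lambda>_\<in>A. c) x" if x: "little_oh_poly n (Rn n) x" "fermat_class n x \<in> A" for x
    unfolding parametrised_at_def
  proof (intro exI conjI allI impI)
    show "smooth_into (m + n) (vprod m (Rn m) (Rn n)) m (Rn m) (vtake m)"
      by (rule smooth_into_vtake) simp
    show "x 0 \<in> Rn n" by (rule little_oh_poly_start[OF x(1)])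
    fix y assume "fermat_class n y \<in> A"
    moreover have "fermat_class m u = fermat_class m (\<lambda>t. vtake m (vjoin m (u t) (y t)))"
      by (rule fermat_class_cong[OF u(1) _ u(1)]) (simp add: vtake_vjoin)
    ultimately show "(\<lambda>_\<in>A. c) (fermat_class n y) = fermat_class m (\<lambda>t. vtake m (vjoin m (u t) (y t)))"
      by (simp add: u(2))
  qed (fact openin_Rn u(1))+
  then show ?thesis unfolding qs_smooth_maps_iff[OF A] using c by auto
qed

lemma vprod_assoc:
  "vprod (l + k) (vprod l Q P) U = vprod l Q (vprod k P U)"
proof (intro set_eqI iffI)
  fix w
  assume "w \<in> vprod (l + k) (vprod l Q P) U"
  then obtain a b u where "a \<in> Q" "b \<in> P" "u \<in> U" "w = vjoin (l + k) (vjoin l a b) u"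
    unfolding vprod_def by blast
  then show "w \<in> vprod l Q (vprod k P U)"
    by (auto simp: vjoin_assoc intro!: vjoin_in_vprod)
next
  fix w
  assume "w \<in> vprod l Q (vprod k P U)"
  then obtain a b u where "a \<in> Q" "b \<in> P" "u \<in> U" "w = vjoin l a (vjoin k b u)"
    unfolding vprod_def by blast
  then show "w \<in> vprod (l + k) (vprod l Q P) U"
    by (auto simp: vjoin_assoc[symmetric] intro!: vjoin_in_vprod)
qed

text \<open>
  If f is locally \<open>\<alpha>(p, -)\<close> and g is locally \<open>\<beta>(q, -)\<close>, the composite is locally \<open>\<gamma>((q,p), -)\<close> with
  \<open>\<gamma>((q,p),x) = \<beta>(q, \<alpha>(p,x))\<close>. This is defined only where \<open>\<alpha>\<close> takes values in the domain V of
  \<open>\<beta>(q, -)\<close>, which by continuity is the case on a cube around the standard part of (p,x).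
\<close>

lemma qs_smooth_compose:
  assumes A: "A \<subseteq> fermat n (Rn n)" and B: "B \<subseteq> fermat m (Rn m)"
    and f: "f \<in> qs_smooth_maps (n, A) (m, B)" and g: "g \<in> qs_smooth_maps (m, B) (r, C)"
  shows "compose A g f \<in> qs_smooth_maps (n, A) (r, C)"
proof -
  have fB: "f \<in> A \<rightarrow>\<^sub>E B" and gC: "g \<in> B \<rightarrow>\<^sub>E C"
    using f g by (simp_all add: qs_smooth_maps_def)
  have "parametrised_at n A r (compose A g f) x" if x: "little_oh_poly n (Rn n) x" "fermat_class n x \<in> A" for x
  proof -
    have "parametrised_at n A m f x" using f x unfolding qs_smooth_maps_iff[OF A] by blast
    then obtain U k P \<alpha> u where a: "openin (Euclidean_space n) U" "x 0 \<in> U" "openin (Euclidean_space k) P"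
      "little_oh_poly k P u" "smooth_into (k + n) (vprod k P U) m (Rn m) \<alpha>"
      "\<And>y. little_oh_poly n U y \<Longrightarrow> fermat_class n y \<in> A \<Longrightarrow> f (fermat_class n y) = fermat_class m (\<lambda>t. \<alpha> (vjoin k (u t) (y t)))"
      unfolding parametrised_at_def by blast
    define z where "z y t = \<alpha> (vjoin k (u t) (y t))" for y :: "real \<Rightarrow> vec" and t
    have xU: "little_oh_poly n U x" by (rule little_oh_poly_openI[OF a(1) x(1) a(2)])
    have fx: "f (fermat_class n x) = fermat_class m (z x)" unfolding z_def using a(6)[OF xU x(2)] .
    note open1 = openin_vprod[OF a(3,1)]
    have zx: "little_oh_poly m (Rn m) (z x)"
      unfolding z_def by (rule smooth_into_little_oh_poly[OF open1 a(5) little_oh_poly_vjoin[OF a(4) xU]])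
    have "fermat_class m (z x) \<in> B" using fB x(2) fx by (metis PiE_mem)
    then have "parametrised_at m B r g (z x)" using g zx unfolding qs_smooth_maps_iff[OF B] by blast
    then obtain V l Q \<beta> q where b: "openin (Euclidean_space m) V" "z x 0 \<in> V" "openin (Euclidean_space l) Q"
      "little_oh_poly l Q q" "smooth_into (l + m) (vprod l Q V) r (Rn r) \<beta>"
      "\<And>y. little_oh_poly m V y \<Longrightarrow> fermat_class m y \<in> B \<Longrightarrow> g (fermat_class m y) = fermat_class r (\<lambda>t. \<beta> (vjoin l (q t) (y t)))"
      unfolding parametrised_at_def by blast
    have u0: "u 0 \<in> Rn k" using little_oh_poly_start[OF a(4)] subset_Rn[OF a(3)] by blast
    have x0: "x 0 \<in> Rn n" by (rule little_oh_poly_start[OF x(1)])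
    have "openin (Euclidean_space (k + n)) {w \<in> vprod k P U. \<alpha> w \<in> V}"
      by (rule smooth_into_preimage_open[OF open1 b(1) subset_refl a(5)])
    moreover have "vjoin k (u 0) (x 0) \<in> {w \<in> vprod k P U. \<alpha> w \<in> V}"
      using b(2) little_oh_poly_start[OF a(4)] a(2) by (simp add: z_def vjoin_in_vprod)
    ultimately obtain d where d: "d > 0" "open_cube (k + n) (vjoin k (u 0) (x 0)) d \<subseteq> {w \<in> vprod k P U. \<alpha> w \<in> V}"
      unfolding openin_iff_open_cube by blast
    \<comment> \<open>a cube in the product is the product of the two cubes, so both factors shrink at once\<close>
    define P' U' where "P' = open_cube k (u 0) d" and "U' = open_cube n (x 0) d"
    have sub: "vprod k P' U' \<subseteq> {w \<in> vprod k P U. \<alpha> w \<in> V}"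
      using d(2) unfolding P'_def U'_def vprod_open_cube[OF u0] .
    have oP': "openin (Euclidean_space k) P'" and oU': "openin (Euclidean_space n) U'"
      unfolding P'_def U'_def by (rule openin_open_cube)+
    have uP': "little_oh_poly k P' u"
      by (rule little_oh_poly_openI[OF oP' little_oh_poly_Rn[OF a(3,4)]])
         (simp add: P'_def centre_in_open_cube u0 d(1))
    have xU': "x 0 \<in> U'" unfolding U'_def by (rule centre_in_open_cube[OF x0 d(1)])
    have \<alpha>V: "smooth_into (k + n) (vprod k P' U') m V \<alpha>"
      using sub by (intro smooth_into_subset[OF a(5)]) auto
    have QR: "Q \<subseteq> Rn l" by (rule subset_Rn[OF b(3)])
    define \<gamma> where "\<gamma> w = \<beta> (vjoin l (vtake l w) (\<alpha> (vdrop l w)))" for w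
    have "smooth_into (l + (k + n)) (vprod l Q (vprod k P' U')) r (Rn r) \<gamma>"
    proof -
      note oD = openin_vprod[OF b(3) openin_vprod[OF oP' oU']]
      have "smooth_into (l + (k + n)) (vprod l Q (vprod k P' U')) m V (\<lambda>w. \<alpha> (vdrop l w))"
        by (rule smooth_into_compose[OF oD openin_vprod[OF oP' oU'] smooth_into_vdrop[OF QR] \<alpha>V])
      from smooth_into_vjoin[OF smooth_into_vtake[OF QR] this]
      show ?thesis unfolding \<gamma>_def
        by (rule smooth_into_compose[OF oD openin_vprod[OF b(3,1)] _ b(5)])
    qed
    then have \<gamma>: "smooth_into ((l + k) + n) (vprod (l + k) (vprod l Q P') U') r (Rn r) \<gamma>"
      by (simp add: vprod_assoc add.assoc)
    show ?thesis
      unfolding parametrised_at_def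
    proof (intro exI conjI allI impI)
      show "openin (Euclidean_space (l + k)) (vprod l Q P')" by (rule openin_vprod[OF b(3) oP'])
      show "little_oh_poly (l + k) (vprod l Q P') (\<lambda>t. vjoin l (q t) (u t))"
        by (rule little_oh_poly_vjoin[OF b(4) uP'])
      fix y assume y: "little_oh_poly n U' y" "fermat_class n y \<in> A"
      have "y 0 \<in> U"
      proof -
        have "vjoin k (u 0) (y 0) \<in> vprod k P' U'"
          using little_oh_poly_start[OF y(1)] little_oh_poly_start[OF uP'] by (rule vjoin_in_vprod[rotated])
        then have "vjoin k (u 0) (y 0) \<in> vprod k P U" using sub by blast
        then show ?thesis using mem_vprod_iff[OF subset_Rn[OF a(3)]] by (simp add: vdrop_vjoin)
      qed
      then have yU: "little_oh_poly n U y"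
        by (rule little_oh_poly_openI[OF a(1) little_oh_poly_Rn[OF oU' y(1)]])
      have fy: "f (fermat_class n y) = fermat_class m (z y)" unfolding z_def by (rule a(6)[OF yU y(2)])
      have zy: "little_oh_poly m V (z y)"
        unfolding z_def
        by (rule smooth_into_little_oh_poly[OF openin_vprod[OF oP' oU'] \<alpha>V little_oh_poly_vjoin[OF uP' y(1)]])
      have "fermat_class m (z y) \<in> B" using fB y(2) fy by (metis PiE_mem)
      then have "compose A g f (fermat_class n y) = fermat_class r (\<lambda>t. \<beta> (vjoin l (q t) (z y t)))"
        using b(6)[OF zy] y(2) fy by (simp add: compose_def)
      also have "\<dots> = fermat_class r (\<lambda>t. \<gamma> (vjoin (l + k) (vjoin l (q t) (u t)) (y t)))"
      proof (rule fermat_class_cong[OF b(4)])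
        show "\<beta> (vjoin l (q t) (z y t)) = \<gamma> (vjoin (l + k) (vjoin l (q t) (u t)) (y t))" if "q t \<in> Q" for t
          using that QR by (simp add: \<gamma>_def vjoin_assoc vdrop_vjoin vtake_vjoin subsetD z_def)
        show "little_oh_poly r (Rn r) (\<lambda>t. \<beta> (vjoin l (q t) (z y t)))"
          by (rule smooth_into_little_oh_poly[OF openin_vprod[OF b(3,1)] b(5) little_oh_poly_vjoin[OF b(4) zy]])
      qed
      finally show "compose A g f (fermat_class n y) = fermat_class r (\<lambda>t. \<gamma> (vjoin (l + k) (vjoin l (q t) (u t)) (y t)))" .
    qed (fact oU' xU' \<gamma>)+
  qed
  moreover have "compose A g f \<in> A \<rightarrow>\<^sub>E C"
    using fB gC by (auto simp: compose_def)
  ultimately show ?thesis unfolding qs_smooth_maps_iff[OF A] by blast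
qed

text \<open>
  Where f is \<open>\<alpha>(p, -)\<close>, the standard part of \<open>f x\<close> is the value of \<open>\<alpha>\<close> at the standard parts of p and
  x. Whether \<open>f x\<close> lies over W thus depends only on the standard part of x, through a continuous
  function.
\<close>

lemma qs_smooth_preimage_open:
  assumes A: "A \<subseteq> fermat n (Rn n)"
    and f: "f \<in> qs_smooth_maps (n, A) (m, B)" and W: "openin (Euclidean_space m) W"
  shows "openin (subtopology (fermat_topology n) A) {a \<in> A. f a \<in> fermat m W}"
proof (subst openin_subopen, intro ballI)
  fix a assume "a \<in> {a \<in> A. f a \<in> fermat m W}"
  then have a: "a \<in> A" "f a \<in> fermat m W" by auto
  obtain x where x: "little_oh_poly n (Rn n) x" "a = fermat_class n x"
    using a(1) A mem_fermat_iff[OF openin_Rn] by blast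
  have "parametrised_at n A m f x" using f x a(1) unfolding qs_smooth_maps_iff[OF A] by blast
  then obtain U k P \<alpha> u where *: "openin (Euclidean_space n) U" "x 0 \<in> U" "openin (Euclidean_space k) P"
    "little_oh_poly k P u" "smooth_into (k + n) (vprod k P U) m (Rn m) \<alpha>"
    "\<And>y. little_oh_poly n U y \<Longrightarrow> fermat_class n y \<in> A \<Longrightarrow> f (fermat_class n y) = fermat_class m (\<lambda>t. \<alpha> (vjoin k (u t) (y t)))"
    unfolding parametrised_at_def by blast
  have val: "f (fermat_class n y) \<in> fermat m W \<longleftrightarrow> \<alpha> (vjoin k (u 0) (y 0)) \<in> W"
    if y: "little_oh_poly n U y" "fermat_class n y \<in> A" for y
  proof -
    have "little_oh_poly m (Rn m) (\<lambda>t. \<alpha> (vjoin k (u t) (y t)))"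
      by (rule smooth_into_little_oh_poly[OF openin_vprod[OF *(3,1)] *(5) little_oh_poly_vjoin[OF *(4) y(1)]])
    then show ?thesis
      unfolding *(6)[OF y] using fermat_class_in_fermat_iff[OF W] little_oh_poly_open[OF W] by simp
  qed
  have xU: "little_oh_poly n U x" by (rule little_oh_poly_openI[OF *(1) x(1) *(2)])
  define U' where "U' = {y \<in> U. \<alpha> (vjoin k (u 0) y) \<in> W}"
  have "smooth_into n U (k + n) (vprod k P U) (\<lambda>y. vjoin k (u 0) y)"
    by (rule smooth_into_vjoin[OF smooth_into_const[OF little_oh_poly_start[OF *(4)]] smooth_into_ident])
  from smooth_into_compose[OF *(1) openin_vprod[OF *(3,1)] this *(5)]
  have oU': "openin (Euclidean_space n) U'"
    unfolding U'_def by (intro smooth_into_preimage_open[OF *(1) W subset_refl])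
  have "x 0 \<in> U'" using val[OF xU] a x(2) *(2) by (simp add: U'_def)
  then have "a \<in> fermat n U'"
    using little_oh_poly_openI[OF oU' x(1)] mem_fermat_iff[OF oU'] x(2) by blast
  moreover have "A \<inter> fermat n U' \<subseteq> {a \<in> A. f a \<in> fermat m W}"
  proof
    fix b assume b: "b \<in> A \<inter> fermat n U'"
    then obtain y where y: "little_oh_poly n U' y" "b = fermat_class n y" using mem_fermat_iff[OF oU'] by blast
    have y0: "y 0 \<in> U'" by (rule little_oh_poly_start[OF y(1)])
    then have "little_oh_poly n U y"
      by (intro little_oh_poly_openI[OF *(1) little_oh_poly_Rn[OF oU' y(1)]]) (simp add: U'_def)
    then show "b \<in> {a \<in> A. f a \<in> fermat m W}" using val b y(2) y0 by (simp add: U'_def)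
  qed
  moreover have "openin (subtopology (fermat_topology n) A) (A \<inter> fermat n U')"
    unfolding openin_subtopology openin_fermat_topology using oU' by blast
  ultimately show "\<exists>T. openin (subtopology (fermat_topology n) A) T \<and> a \<in> T \<and> T \<subseteq> {a \<in> A. f a \<in> fermat m W}"
    using a(1) by blast
qed

section \<open>Colimits of concrete sheaves\<close>

lemma csheaf_Sec_fun: "is_csheaf \<A> X \<Longrightarrow> A \<in> Obj \<A> \<Longrightarrow> s \<in> Sec X A \<Longrightarrow> s \<in> snd A \<rightarrow>\<^sub>E Pts X"
  unfolding is_csheaf_def by (elim conjE) (drule (1) bspec, drule (1) subsetD, assumption)

lemma csheaf_glue:
  assumes "is_csheaf \<A> X" "A \<in> Obj \<A>" "\<C> \<in> Cov \<A> A" "s \<in> snd A \<rightarrow>\<^sub>E Pts X"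
    and "\<And>B. B \<in> \<C> \<Longrightarrow> restrict s (snd B) \<in> Sec X B"
  shows "s \<in> Sec X A"
  by (rule assms(1)[unfolded is_csheaf_def, THEN conjunct2, THEN conjunct2, THEN conjunct2, THEN conjunct2,
        rule_format, OF assms(2-4)]) (rule assms(5))

lemma is_category_csheaf_category: "is_category (csheaf_category \<A>)"
  unfolding is_category_def csheaf_category_def category.simps
proof (intro conjI ballI)
  fix X :: "('a, 'b) csheaf" assume "X \<in> {X. is_csheaf \<A> X}"
  then have "compose (snd A) (\<lambda>x\<in>Pts X. x) s = s" if "A \<in> Obj \<A>" "s \<in> Sec X A" for A s
    using csheaf_Sec_fun[OF _ that] by (intro Id_compose) (auto simp: PiE_def)
  then show "(\<lambda>x\<in>Pts X. x) \<in> csheaf_maps \<A> X X" by (simp add: csheaf_maps_def)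
next
  fix X Y Z :: "('a, 'b) csheaf" and f g
  assume X: "X \<in> {X. is_csheaf \<A> X}" and f: "f \<in> csheaf_maps \<A> X Y" and g: "g \<in> csheaf_maps \<A> Y Z"
  have "compose (snd A) (compose (Pts X) g f) s = compose (snd A) g (compose (snd A) f s)"
    if "A \<in> Obj \<A>" "s \<in> Sec X A" for A s
  proof -
    have "s \<in> snd A \<rightarrow> Pts X" using csheaf_Sec_fun[OF _ that] X by (auto simp: PiE_def)
    then show ?thesis by (auto simp: compose_def fun_eq_iff Pi_iff)
  qed
  moreover have "compose (Pts X) g f \<in> Pts X \<rightarrow>\<^sub>E Pts Z"
    using f g by (auto simp: csheaf_maps_def PiE_def compose_def Pi_iff)
  ultimately show "compose (Pts X) g f \<in> csheaf_maps \<A> X Z"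
    using f g by (simp add: csheaf_maps_def)
next
  fix X Y :: "('a, 'b) csheaf" and f assume f: "f \<in> csheaf_maps \<A> X Y"
  then have *: "f \<in> Pts X \<rightarrow> Pts Y" "f \<in> extensional (Pts X)" by (auto simp: csheaf_maps_def PiE_def)
  show "compose (Pts X) f (\<lambda>x\<in>Pts X. x) = f" by (rule compose_Id[OF *])
  show "compose (Pts X) (\<lambda>x\<in>Pts Y. x) f = f" by (rule Id_compose[OF *])
next
  fix W X Y Z :: "('a, 'b) csheaf" and f g h
  assume "f \<in> csheaf_maps \<A> W X"
  then have "f \<in> Pts W \<rightarrow> Pts X" by (auto simp: csheaf_maps_def PiE_def)
  from compose_assoc[OF this, of h g]
  show "compose (Pts W) (compose (Pts X) h g) f = compose (Pts W) h (compose (Pts W) g f)" ..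
qed

text \<open>
  A site of sets and functions: morphisms are functions, among them the constants, and coverings
  consist of subobjects. Every object covers itself, covers of the members of a cover unite to a cover,
  and covers can be pulled back along morphisms.
\<close>

locale concrete_site =
  fixes \<A> :: "'p site"
  assumes Ident_eq: "Ident \<A> A = (\<lambda>x\<in>snd A. x)"
    and Comp_eq: "Comp \<A> A B C g f = compose (snd A) g f"
    and Hom_fun: "A \<in> Obj \<A> \<Longrightarrow> B \<in> Obj \<A> \<Longrightarrow> Hom \<A> A B \<subseteq> snd A \<rightarrow>\<^sub>E snd B"
    and Hom_compose: "A \<in> Obj \<A> \<Longrightarrow> B \<in> Obj \<A> \<Longrightarrow> C \<in> Obj \<A> \<Longrightarrow> f \<in> Hom \<A> A B \<Longrightarrow> g \<in> Hom \<A> B C \<Longrightarrow>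
      compose (snd A) g f \<in> Hom \<A> A C"
    and Hom_const: "A \<in> Obj \<A> \<Longrightarrow> B \<in> Obj \<A> \<Longrightarrow> c \<in> snd B \<Longrightarrow> (\<lambda>_\<in>snd A. c) \<in> Hom \<A> A B"
    and cover_member: "A \<in> Obj \<A> \<Longrightarrow> \<C> \<in> Cov \<A> A \<Longrightarrow> B \<in> \<C> \<Longrightarrow> B \<in> Obj \<A> \<and> (\<lambda>x\<in>snd B. x) \<in> Hom \<A> B A"
    and cover_union: "A \<in> Obj \<A> \<Longrightarrow> \<C> \<in> Cov \<A> A \<Longrightarrow> (\<Union>B\<in>\<C>. snd B) = snd A"
    and cover_self: "A \<in> Obj \<A> \<Longrightarrow> {A} \<in> Cov \<A> A"
    and cover_pullback: "A \<in> Obj \<A> \<Longrightarrow> B \<in> Obj \<A> \<Longrightarrow> \<C> \<in> Cov \<A> A \<Longrightarrow> f \<in> Hom \<A> B A \<Longrightarrow>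
      \<exists>\<D>\<in>Cov \<A> B. \<forall>B'\<in>\<D>. \<exists>A'\<in>\<C>. restrict f (snd B') \<in> Hom \<A> B' A'"
    and cover_trans: "A \<in> Obj \<A> \<Longrightarrow> \<C> \<in> Cov \<A> A \<Longrightarrow> (\<And>B. B \<in> \<C> \<Longrightarrow> \<D> B \<in> Cov \<A> B) \<Longrightarrow>
      (\<Union>B\<in>\<C>. \<D> B) \<in> Cov \<A> A"
begin

lemma Hom_ident: "A \<in> Obj \<A> \<Longrightarrow> (\<lambda>x\<in>snd A. x) \<in> Hom \<A> A A"
  using cover_member[OF _ cover_self, of A A] by simp

lemma is_category: "is_category \<A>"
  unfolding is_category_def Ident_eq Comp_eq
proof (intro conjI ballI)
  fix A B f assume A: "A \<in> Obj \<A>" "B \<in> Obj \<A>" "f \<in> Hom \<A> A B"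
  have "f \<in> snd A \<rightarrow>\<^sub>E snd B" using Hom_fun[OF A(1,2)] A(3) by blast
  then have *: "f \<in> snd A \<rightarrow> snd B" "f \<in> extensional (snd A)" by (auto simp: PiE_def)
  show "compose (snd A) f (\<lambda>x\<in>snd A. x) = f" by (rule compose_Id[OF *])
  show "compose (snd A) (\<lambda>x\<in>snd B. x) f = f" by (rule Id_compose[OF *])
next
  fix A B C D f g h
  assume A: "A \<in> Obj \<A>" "B \<in> Obj \<A>" "f \<in> Hom \<A> A B"
  have "f \<in> snd A \<rightarrow>\<^sub>E snd B" using Hom_fun[OF A(1,2)] A(3) by blast
  then have "f \<in> snd A \<rightarrow> snd B" by (simp add: PiE_def)
  from compose_assoc[OF this, of h g]
  show "compose (snd A) (compose (snd B) h g) f = compose (snd A) h (compose (snd A) g f)" ..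
qed (auto intro: Hom_ident Hom_compose)

lemma cover_member_subset:
  assumes "A \<in> Obj \<A>" "\<C> \<in> Cov \<A> A" "B \<in> \<C>"
  shows "B \<in> Obj \<A>" "snd B \<subseteq> snd A"
  using cover_member[OF assms] cover_union[OF assms(1,2)] assms(3) by auto

end

text \<open>
  A diagram of concrete presheaves; the sections of its colimit will be glued by construction.
\<close>

locale concrete_diagram = concrete_site \<A> for \<A> :: "'p site" +
  fixes J :: "('o, 'm) category" and Do :: "'o \<Rightarrow> ('p, 'd) csheaf" and Dm :: "'o \<Rightarrow> 'o \<Rightarrow> 'm \<Rightarrow> 'd \<Rightarrow> 'd"
  assumes Sec_fun: "i \<in> Obj J \<Longrightarrow> A \<in> Obj \<A> \<Longrightarrow> Sec (Do i) A \<subseteq> snd A \<rightarrow>\<^sub>E Pts (Do i)"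
    and Sec_const: "i \<in> Obj J \<Longrightarrow> A \<in> Obj \<A> \<Longrightarrow> c \<in> Pts (Do i) \<Longrightarrow> (\<lambda>_\<in>snd A. c) \<in> Sec (Do i) A"
    and Sec_compose: "i \<in> Obj J \<Longrightarrow> A \<in> Obj \<A> \<Longrightarrow> B \<in> Obj \<A> \<Longrightarrow> f \<in> Hom \<A> B A \<Longrightarrow> s \<in> Sec (Do i) A \<Longrightarrow>
      compose (snd B) s f \<in> Sec (Do i) B"
    and Dm_fun: "i \<in> Obj J \<Longrightarrow> j \<in> Obj J \<Longrightarrow> d \<in> Hom J i j \<Longrightarrow> Dm i j d \<in> Pts (Do i) \<rightarrow> Pts (Do j)"
begin

abbreviation "S \<equiv> SIGMA i:Obj J. Pts (Do i)"
abbreviation "R \<equiv> colim_rel J Do Dm"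
abbreviation "L \<equiv> colim \<A> J Do Dm"
abbreviation "\<iota> \<equiv> colim_in J Do Dm"

lemma colim_rel_step:
  assumes "i \<in> Obj J" "j \<in> Obj J" "x \<in> Pts (Do i)" "f \<in> Hom J i j"
  shows "((i, x), (j, Dm i j f x)) \<in> R"
  unfolding colim_rel_def using assms by (auto intro!: r_into_equivclp)

lemma equiv_colim_rel: "equiv UNIV R"
  by (rule equivI) (auto simp: colim_rel_def refl_on_def sym_def trans_def intro: equivclp_sym equivclp_trans)

text \<open>
  Equivalent points are connected by a zigzag of transition maps, which never leaves the disjoint
  union of the diagram. A function k that is compatible with the transition maps is constant along
  it.
\<close>

lemma colim_rel_invariant:
  assumes uv: "(u, v) \<in> R" and u: "u \<in> S"
    and step: "\<And>i j x f. i \<in> Obj J \<Longrightarrow> j \<in> Obj J \<Longrightarrow> x \<in> Pts (Do i) \<Longrightarrow> f \<in> Hom J i j \<Longrightarrow>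
      k (j, Dm i j f x) = k (i, x)"
  shows "v \<in> S \<and> k v = k u"
proof -
  let ?r = "\<lambda>(i, x) (j, y). i \<in> Obj J \<and> j \<in> Obj J \<and> x \<in> Pts (Do i) \<and> (\<exists>f\<in>Hom J i j. y = Dm i j f x)"
  have "equivclp ?r u v" using uv by (simp add: colim_rel_def)
  then show ?thesis
  proof (induction rule: equivclp_induct)
    case base
    show ?case using u by simp
  next
    case (step y z)
    have *: "q \<in> S \<and> p \<in> S \<and> k q = k p" if pq: "?r p q" for p q
    proof -
      obtain i x j w where "p = (i, x)" "q = (j, w)" by (metis surj_pair)
      with pq show ?thesis using Dm_fun assms(3) by auto
    qed
    from step(2) consider "?r y z" | "?r z y" by blast
    then show ?case
    proof cases
      case 1
      from *[OF this] step.IH show ?thesis by metis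
    next
      case 2
      from *[OF this] step.IH show ?thesis by metis
    qed
  qed
qed

lemma colim_in_eq_iff:
  assumes "x \<in> Pts (Do i)" "y \<in> Pts (Do j)"
  shows "\<iota> i x = \<iota> j y \<longleftrightarrow> ((i, x), (j, y)) \<in> R"
  using assms eq_equiv_class_iff[OF equiv_colim_rel] by (simp add: colim_in_def)

lemma colim_in_Pts: "i \<in> Obj J \<Longrightarrow> x \<in> Pts (Do i) \<Longrightarrow> \<iota> i x \<in> Pts L"
  by (auto simp: colim_def colim_in_def intro: quotientI)

lemma colim_Pts_cases:
  assumes "c \<in> Pts L" obtains i x where "i \<in> Obj J" "x \<in> Pts (Do i)" "c = \<iota> i x"
  using assms by (auto simp: colim_def colim_in_def elim!: quotientE)

lemma colim_in_natural:
  "i \<in> Obj J \<Longrightarrow> j \<in> Obj J \<Longrightarrow> x \<in> Pts (Do i) \<Longrightarrow> f \<in> Hom J i j \<Longrightarrow> \<iota> j (Dm i j f x) = \<iota> i x"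
  using colim_in_eq_iff[of x i "Dm i j f x" j] colim_rel_step[of i j x f] Dm_fun[of i j f] by fastforce

lemma mem_Sec_colim:
  "s \<in> Sec L A \<longleftrightarrow> A \<in> Obj \<A> \<and> s \<in> extensional (snd A) \<and>
    (\<exists>\<C>\<in>Cov \<A> A. \<forall>B\<in>\<C>. \<exists>i\<in>Obj J. \<exists>\<sigma>\<in>Sec (Do i) B. \<forall>x\<in>snd B. s x = \<iota> i (\<sigma> x))"
proof -
  have *: "restrict s (snd B) = compose (snd B) (\<iota> i) \<sigma> \<longleftrightarrow> (\<forall>x\<in>snd B. s x = \<iota> i (\<sigma> x))"
    for B :: "nat \<times> 'p set" and i \<sigma>
    by (auto simp: fun_eq_iff compose_def restrict_def)
  show ?thesis
  proof (cases "A \<in> Obj \<A>")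
    case True
    then have "s \<in> Sec L A \<longleftrightarrow> s \<in> extensional (snd A) \<and> (\<exists>\<C>\<in>Cov \<A> A. \<forall>B\<in>\<C>. \<exists>i\<in>Obj J. \<exists>\<sigma>\<in>Sec (Do i) B.
        restrict s (snd B) = compose (snd B) (\<iota> i) \<sigma>)"
      unfolding colim_def csheaf.simps by (simp only: if_True mem_Collect_eq)
    with True show ?thesis unfolding * by blast
  qed (simp add: colim_def)
qed

lemma Sec_colimI:
  assumes "A \<in> Obj \<A>" "s \<in> extensional (snd A)" "\<C> \<in> Cov \<A> A"
    and "\<And>B. B \<in> \<C> \<Longrightarrow> \<exists>i\<in>Obj J. \<exists>\<sigma>\<in>Sec (Do i) B. \<forall>x\<in>snd B. s x = \<iota> i (\<sigma> x)"
  shows "s \<in> Sec L A"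
  unfolding mem_Sec_colim using assms(1,2) by (intro conjI bexI[OF _ assms(3)] ballI assms(4))

lemma Sec_colim_fun:
  assumes "s \<in> Sec L A" shows "s \<in> snd A \<rightarrow>\<^sub>E Pts L"
proof -
  obtain \<C> where A: "A \<in> Obj \<A>" "s \<in> extensional (snd A)" and C: "\<C> \<in> Cov \<A> A"
    "\<And>B. B \<in> \<C> \<Longrightarrow> \<exists>i\<in>Obj J. \<exists>\<sigma>\<in>Sec (Do i) B. \<forall>x\<in>snd B. s x = \<iota> i (\<sigma> x)"
    using assms unfolding mem_Sec_colim by blast
  have "s x \<in> Pts L" if x: "x \<in> snd A" for x
  proof -
    obtain B where B: "B \<in> \<C>" "x \<in> snd B" using cover_union[OF A(1) C(1)] x by blast
    obtain i \<sigma> where i: "i \<in> Obj J" "\<sigma> \<in> Sec (Do i) B" "s x = \<iota> i (\<sigma> x)" using C(2) B by blast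
    have "\<sigma> x \<in> Pts (Do i)"
      using Sec_fun[OF i(1) cover_member_subset(1)[OF A(1) C(1) B(1)]] i(2) B(2) by blast
    then show ?thesis using colim_in_Pts i by simp
  qed
  then show ?thesis using A(2) by (auto simp: PiE_def)
qed

text \<open>
  Sections are the functions that lift on some cover. Locality of this condition is transitivity of
  covers, and stability under precomposition is their stability under pullback.
\<close>

lemma is_csheaf_colim: "is_csheaf \<A> L"
  unfolding is_csheaf_def
proof (intro conjI allI ballI impI)
  show "Sec L A = {}" if "A \<notin> Obj \<A>" for A using that by (simp add: colim_def)
  show "Sec L A \<subseteq> snd A \<rightarrow>\<^sub>E Pts L" for A using Sec_colim_fun by blast
  fix A assume A: "A \<in> Obj \<A>"
  show "(\<lambda>_\<in>snd A. c) \<in> Sec L A" if "c \<in> Pts L" for c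
  proof -
    from that obtain i x where ix: "i \<in> Obj J" "x \<in> Pts (Do i)" "c = \<iota> i x" by (rule colim_Pts_cases)
    show ?thesis
    proof (rule Sec_colimI[OF A _ cover_self[OF A]])
      show "\<exists>i\<in>Obj J. \<exists>\<sigma>\<in>Sec (Do i) B. \<forall>y\<in>snd B. (\<lambda>_\<in>snd A. c) y = \<iota> i (\<sigma> y)" if "B \<in> {A}" for B
        using that ix(3) by (intro bexI[OF _ ix(1)] bexI[OF _ Sec_const[OF ix(1) _ ix(2)]]) (auto simp: A)
    qed simp
  qed
  show "s \<in> Sec L A" if C: "\<C> \<in> Cov \<A> A" and s: "s \<in> snd A \<rightarrow>\<^sub>E Pts L"
    and loc: "\<forall>B\<in>\<C>. restrict s (snd B) \<in> Sec L B" for \<C> s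
  proof -
    have "\<forall>B\<in>\<C>. \<exists>\<D>. \<D> \<in> Cov \<A> B \<and> (\<forall>B'\<in>\<D>. \<exists>i\<in>Obj J. \<exists>\<sigma>\<in>Sec (Do i) B'. \<forall>x\<in>snd B'. s x = \<iota> i (\<sigma> x))"
    proof
      fix B assume B: "B \<in> \<C>"
      obtain \<D> where D: "\<D> \<in> Cov \<A> B"
        "\<forall>B'\<in>\<D>. \<exists>i\<in>Obj J. \<exists>\<sigma>\<in>Sec (Do i) B'. \<forall>x\<in>snd B'. restrict s (snd B) x = \<iota> i (\<sigma> x)"
        using loc B unfolding mem_Sec_colim by blast
      have "restrict s (snd B) x = s x" if "B' \<in> \<D>" "x \<in> snd B'" for B' x
        using cover_member_subset(2)[OF cover_member_subset(1)[OF A C B] D(1) that(1)] that(2) by auto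
      with D show "\<exists>\<D>. \<D> \<in> Cov \<A> B \<and> (\<forall>B'\<in>\<D>. \<exists>i\<in>Obj J. \<exists>\<sigma>\<in>Sec (Do i) B'. \<forall>x\<in>snd B'. s x = \<iota> i (\<sigma> x))"
        by (metis (no_types, lifting))
    qed
    from bchoice[OF this] obtain \<D> where D: "\<And>B. B \<in> \<C> \<Longrightarrow> \<D> B \<in> Cov \<A> B"
      "\<And>B B'. B \<in> \<C> \<Longrightarrow> B' \<in> \<D> B \<Longrightarrow> \<exists>i\<in>Obj J. \<exists>\<sigma>\<in>Sec (Do i) B'. \<forall>x\<in>snd B'. s x = \<iota> i (\<sigma> x)"
      by blast
    have "s \<in> extensional (snd A)" using s by (simp add: PiE_def)
    from Sec_colimI[OF A this cover_trans[OF A C D(1)]] D(2) show ?thesis by blast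
  qed
  show "compose (snd B) s f \<in> Sec L B" if B: "B \<in> Obj \<A>" and f: "f \<in> Hom \<A> B A" and s: "s \<in> Sec L A" for B f s
  proof -
    obtain \<C> where C: "\<C> \<in> Cov \<A> A"
      "\<And>A'. A' \<in> \<C> \<Longrightarrow> \<exists>i\<in>Obj J. \<exists>\<sigma>\<in>Sec (Do i) A'. \<forall>x\<in>snd A'. s x = \<iota> i (\<sigma> x)"
      using s unfolding mem_Sec_colim by blast
    obtain \<D> where D: "\<D> \<in> Cov \<A> B" "\<And>B'. B' \<in> \<D> \<Longrightarrow> \<exists>A'\<in>\<C>. restrict f (snd B') \<in> Hom \<A> B' A'"
      using cover_pullback[OF A B C(1) f] by blast
    have "\<exists>i\<in>Obj J. \<exists>\<sigma>\<in>Sec (Do i) B'. \<forall>x\<in>snd B'. compose (snd B) s f x = \<iota> i (\<sigma> x)" if B': "B' \<in> \<D>" for B'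
    proof -
      obtain A' where A': "A' \<in> \<C>" "restrict f (snd B') \<in> Hom \<A> B' A'" using D(2)[OF B'] by blast
      note objs = cover_member_subset[OF A C(1) A'(1)] cover_member_subset[OF B D(1) B']
      obtain i \<sigma> where i: "i \<in> Obj J" "\<sigma> \<in> Sec (Do i) A'" "\<forall>x\<in>snd A'. s x = \<iota> i (\<sigma> x)" using C(2)[OF A'(1)] by blast
      have "f x \<in> snd A'" if "x \<in> snd B'" for x
        using Hom_fun[OF objs(3,1)] A'(2) that by (auto simp: PiE_def Pi_iff)
      then have "\<forall>x\<in>snd B'. compose (snd B) s f x = \<iota> i (compose (snd B') \<sigma> (restrict f (snd B')) x)"
        using i(3) objs(4) by (auto simp: compose_def)
      moreover have "compose (snd B') \<sigma> (restrict f (snd B')) \<in> Sec (Do i) B'"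
        by (rule Sec_compose[OF i(1) objs(1,3) A'(2) i(2)])
      ultimately show ?thesis using i(1) by blast
    qed
    then show ?thesis by (intro Sec_colimI[OF B _ D(1)]) (simp_all add: compose_def)
  qed
qed

lemma colim_in_map:
  assumes i: "i \<in> Obj J" shows "\<iota> i \<in> csheaf_maps \<A> (Do i) L"
  unfolding csheaf_maps_def
proof (intro CollectI conjI ballI)
  show "\<iota> i \<in> Pts (Do i) \<rightarrow>\<^sub>E Pts L" using colim_in_Pts[OF i] by (auto simp: colim_in_def)
  fix A s assume A: "A \<in> Obj \<A>" and s: "s \<in> Sec (Do i) A"
  show "compose (snd A) (\<iota> i) s \<in> Sec L A"
  proof (rule Sec_colimI[OF A _ cover_self[OF A]])
    show "\<exists>j\<in>Obj J. \<exists>\<sigma>\<in>Sec (Do j) B. \<forall>x\<in>snd B. compose (snd A) (\<iota> i) s x = \<iota> j (\<sigma> x)" if "B \<in> {A}" for B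
      using that s by (intro bexI[OF _ i] bexI[of _ s]) (auto simp: compose_def)
  qed (simp add: compose_def)
qed

text \<open>
  The map induced by a cocone \<open>\<kappa>\<close> is forced to send the class of (i,x) to \<open>\<kappa> i x\<close>, and this is well
  defined by invariance along zigzags. It preserves sections: on each member of a suitable cover a
  section lifts to a section \<open>\<sigma>\<close> of some member of the diagram and is sent to \<open>\<kappa> i \<circ> \<sigma>\<close>, and these
  glue.
\<close>

theorem colim_is_colimit: "is_colimit TYPE('c) \<A> J Do Dm L \<iota>"
  unfolding is_colimit_def
proof (intro conjI allI impI)
  have "compose (Pts (Do i)) (\<iota> j) (Dm i j f) = \<iota> i" if "i \<in> Obj J" "j \<in> Obj J" "f \<in> Hom J i j" for i j f
    using colim_in_natural[OF that(1,2) _ that(3)] by (auto simp: compose_def fun_eq_iff colim_in_def)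
  then show "is_cocone \<A> J Do Dm L \<iota>"
    unfolding is_cocone_def using is_csheaf_colim colim_in_map by blast
next
  fix Z :: "('p, 'c) csheaf" and \<kappa> assume "is_cocone \<A> J Do Dm Z \<kappa>"
  then have Z: "is_csheaf \<A> Z" and \<kappa>: "\<And>i. i \<in> Obj J \<Longrightarrow> \<kappa> i \<in> csheaf_maps \<A> (Do i) Z"
    and nat: "\<And>i j f. i \<in> Obj J \<Longrightarrow> j \<in> Obj J \<Longrightarrow> f \<in> Hom J i j \<Longrightarrow> compose (Pts (Do i)) (\<kappa> j) (Dm i j f) = \<kappa> i"
    unfolding is_cocone_def by auto
  have step: "\<kappa> j (Dm i j f x) = \<kappa> i x" if "i \<in> Obj J" "j \<in> Obj J" "x \<in> Pts (Do i)" "f \<in> Hom J i j" for i j x f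
    using fun_cong[OF nat[OF that(1,2,4)], of x] that(3) by (simp add: compose_def)
  have wd: "\<kappa> j y = \<kappa> i x" if "i \<in> Obj J" "x \<in> Pts (Do i)" "y \<in> Pts (Do j)" "\<iota> i x = \<iota> j y" for i j x y
    using colim_rel_invariant[of "(i, x)" "(j, y)" "\<lambda>(i, x). \<kappa> i x"] that step
    by (simp add: colim_in_eq_iff)
  define h where "h = (\<lambda>c\<in>Pts L. THE z. \<exists>i\<in>Obj J. \<exists>x\<in>Pts (Do i). c = \<iota> i x \<and> z = \<kappa> i x)"
  have h: "h (\<iota> i x) = \<kappa> i x" if ix: "i \<in> Obj J" "x \<in> Pts (Do i)" for i x
  proof -
    have "(THE z. \<exists>j\<in>Obj J. \<exists>y\<in>Pts (Do j). \<iota> i x = \<iota> j y \<and> z = \<kappa> j y) = \<kappa> i x"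
    proof (rule the_equality)
      show "\<exists>j\<in>Obj J. \<exists>y\<in>Pts (Do j). \<iota> i x = \<iota> j y \<and> \<kappa> i x = \<kappa> j y" using ix by blast
      show "z = \<kappa> i x" if "\<exists>j\<in>Obj J. \<exists>y\<in>Pts (Do j). \<iota> i x = \<iota> j y \<and> z = \<kappa> j y" for z
        using that wd[OF ix] by blast
    qed
    then show ?thesis using colim_in_Pts[OF ix] by (simp add: h_def)
  qed
  have hL: "h c \<in> Pts Z" if "c \<in> Pts L" for c
  proof -
    from that obtain i x where ix: "i \<in> Obj J" "x \<in> Pts (Do i)" "c = \<iota> i x" by (rule colim_Pts_cases)
    then show ?thesis using h \<kappa>[OF ix(1)] by (auto simp: csheaf_maps_def)
  qed
  have "compose (snd A) h s \<in> Sec Z A" if A: "A \<in> Obj \<A>" and s: "s \<in> Sec L A" for A s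
  proof -
    obtain \<C> where C: "\<C> \<in> Cov \<A> A"
      "\<And>B. B \<in> \<C> \<Longrightarrow> \<exists>i\<in>Obj J. \<exists>\<sigma>\<in>Sec (Do i) B. \<forall>x\<in>snd B. s x = \<iota> i (\<sigma> x)"
      using s unfolding mem_Sec_colim by blast
    have "restrict (compose (snd A) h s) (snd B) \<in> Sec Z B" if B: "B \<in> \<C>" for B
    proof -
      note objB = cover_member_subset[OF A C(1) B]
      obtain i \<sigma> where i: "i \<in> Obj J" "\<sigma> \<in> Sec (Do i) B" "\<forall>x\<in>snd B. s x = \<iota> i (\<sigma> x)" using C(2)[OF B] by blast
      have "\<sigma> x \<in> Pts (Do i)" if "x \<in> snd B" for x using Sec_fun[OF i(1) objB(1)] i(2) that by blast
      then have "restrict (compose (snd A) h s) (snd B) = compose (snd B) (\<kappa> i) \<sigma>"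
        using objB(2) i(3) h[OF i(1)] by (auto simp: compose_def fun_eq_iff subset_iff)
      then show ?thesis using \<kappa>[OF i(1)] objB(1) i(2) by (simp add: csheaf_maps_def)
    qed
    moreover have "compose (snd A) h s \<in> snd A \<rightarrow>\<^sub>E Pts Z"
      using Sec_colim_fun[OF s] hL by (auto simp: compose_def)
    ultimately show ?thesis by (intro csheaf_glue[OF Z A C(1)])
  qed
  then have hmap: "h \<in> csheaf_maps \<A> L Z"
    using hL unfolding csheaf_maps_def by (simp add: h_def PiE_def extensional_def)
  show "\<exists>!h. h \<in> csheaf_maps \<A> L Z \<and> (\<forall>i\<in>Obj J. compose (Pts (Do i)) h (\<iota> i) = \<kappa> i)"
  proof (rule ex1I[of _ h], intro conjI ballI hmap)
    show "compose (Pts (Do i)) h (\<iota> i) = \<kappa> i" if i: "i \<in> Obj J" for i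
    proof
      fix x
      have "\<kappa> i \<in> extensional (Pts (Do i))" using \<kappa>[OF i] unfolding csheaf_maps_def by (simp add: PiE_def)
      then show "compose (Pts (Do i)) h (\<iota> i) x = \<kappa> i x"
        using h[OF i] by (simp add: compose_def extensional_def)
    qed
    fix h' assume h': "h' \<in> csheaf_maps \<A> L Z \<and> (\<forall>i\<in>Obj J. compose (Pts (Do i)) h' (\<iota> i) = \<kappa> i)"
    show "h' = h"
    proof (rule PiE_ext)
      show "h' \<in> Pts L \<rightarrow>\<^sub>E Pts Z" "h \<in> Pts L \<rightarrow>\<^sub>E Pts Z" using h' hmap unfolding csheaf_maps_def by blast+
      fix c assume "c \<in> Pts L"
      then obtain i x where ix: "i \<in> Obj J" "x \<in> Pts (Do i)" "c = \<iota> i x" by (rule colim_Pts_cases)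
      have "compose (Pts (Do i)) h' (\<iota> i) x = \<kappa> i x" using h' ix(1) by simp
      then show "h' c = h c" using ix h by (simp add: compose_def)
    qed
  qed
qed

end

section \<open>The smooth site, the Fermat site and the functor between them\<close>

lemma smooth_site_simps:
  "Obj smooth_site = {(n, U). openin (Euclidean_space n) U}" "Hom smooth_site = smooth_maps"
  "Cov smooth_site (n, U) = {Pair n ` \<U> | \<U>. (\<forall>V\<in>\<U>. openin (Euclidean_space n) V) \<and> \<Union>\<U> = U}"
  by (simp_all add: smooth_site_def)

lemma fermat_site_simps:
  "Obj fermat_site = {(n, A). A \<subseteq> fermat n (Rn n)}" "Hom fermat_site = qs_smooth_maps"
  "Cov fermat_site (n, A) = {Pair n ` \<B> | \<B>.
     (\<forall>B\<in>\<B>. openin (subtopology (fermat_topology n) A) B) \<and> \<Union>\<B> = A}"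
  by (simp_all add: fermat_site_def)

interpretation smooth: concrete_site smooth_site
proof
  fix A B C f g and c :: vec
  show "Ident smooth_site A = (\<lambda>x\<in>snd A. x)" "Comp smooth_site A B C g f = compose (snd A) g f"
    by (simp_all add: smooth_site_def)
  show "Hom smooth_site A B \<subseteq> snd A \<rightarrow>\<^sub>E snd B"
    by (auto simp: smooth_site_simps smooth_maps_def)
  show "(\<lambda>_\<in>snd A. c) \<in> Hom smooth_site A B" if "A \<in> Obj smooth_site" "c \<in> snd B"
  proof -
    obtain n U m V where "A = (n, U)" "B = (m, V)" by (metis surj_pair)
    then show ?thesis
      using that smooth_into_restrict[OF _ smooth_into_const[of c V n U m]] by (auto simp: smooth_site_simps)
  qed
  show "compose (snd A) g f \<in> Hom smooth_site A C"
    if "A \<in> Obj smooth_site" "B \<in> Obj smooth_site" "f \<in> Hom smooth_site A B" "g \<in> Hom smooth_site B C"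
  proof -
    obtain n U m V l W where eq: "A = (n, U)" "B = (m, V)" "C = (l, W)" by (metis surj_pair)
    have op: "openin (Euclidean_space n) U" "openin (Euclidean_space m) V"
      and f: "smooth_into n U m V f" and g: "smooth_into m V l W g"
      using that by (auto simp: eq smooth_site_simps smooth_maps_iff)
    from smooth_into_restrict[OF op(1) smooth_into_compose[OF op f g]]
    show ?thesis by (simp add: eq smooth_site_simps compose_def)
  qed
next
  fix A :: "nat \<times> vec set" assume "A \<in> Obj smooth_site"
  then obtain n U where A: "A = (n, U)" "openin (Euclidean_space n) U" by (auto simp: smooth_site_simps)
  show "{A} \<in> Cov smooth_site A"
    using A(2) by (auto simp: A(1) smooth_site_simps intro!: exI[of _ "{U}"])
  fix \<C> assume "\<C> \<in> Cov smooth_site A"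
  then obtain \<U> where U: "\<C> = Pair n ` \<U>" "\<forall>V\<in>\<U>. openin (Euclidean_space n) V" "\<Union>\<U> = U"
    by (auto simp: A(1) smooth_site_simps)
  show "(\<Union>B\<in>\<C>. snd B) = snd A" using U by (simp add: A(1))
  have incl: "(\<lambda>x\<in>V. x) \<in> smooth_maps (n, V) (n, U)" if "V \<in> \<U>" for V
    using smooth_into_restrict[OF bspec[OF U(2) that]] smooth_into_subset[OF smooth_into_ident[of n V] subset_refl, of U]
      that U(3) by auto
  show "B \<in> Obj smooth_site \<and> (\<lambda>x\<in>snd B. x) \<in> Hom smooth_site B A" if "B \<in> \<C>" for B
    using that U incl by (auto simp: A(1) smooth_site_simps)
  show "(\<Union>B\<in>\<C>. \<D> B) \<in> Cov smooth_site A" if D: "\<And>B. B \<in> \<C> \<Longrightarrow> \<D> B \<in> Cov smooth_site B" for \<D>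
  proof -
    have "\<forall>V\<in>\<U>. \<exists>\<V>. \<D> (n, V) = Pair n ` \<V> \<and> (\<forall>V\<in>\<V>. openin (Euclidean_space n) V) \<and> \<Union>\<V> = V"
      using D by (auto simp: U(1) smooth_site_simps)
    from bchoice[OF this] obtain \<V> where V: "\<forall>V\<in>\<U>. \<D> (n, V) = Pair n ` \<V> V \<and>
        (\<forall>V\<in>\<V> V. openin (Euclidean_space n) V) \<and> \<Union>(\<V> V) = V" by blast
    then have "(\<Union>B\<in>\<C>. \<D> B) = Pair n ` (\<Union>V\<in>\<U>. \<V> V)" by (auto simp: U(1))
    moreover have "\<Union>(\<Union>V\<in>\<U>. \<V> V) = U"
    proof -
      have "\<Union>(\<Union>V\<in>\<U>. \<V> V) = (\<Union>V\<in>\<U>. \<Union>(\<V> V))" by blast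
      also have "\<dots> = \<Union>\<U>" using V by simp
      finally show ?thesis by (simp add: U(3))
    qed
    moreover have "\<forall>V\<in>(\<Union>V\<in>\<U>. \<V> V). openin (Euclidean_space n) V" using V by blast
    ultimately show ?thesis unfolding A(1) smooth_site_simps by blast
  qed
  fix B f assume B: "B \<in> Obj smooth_site" and f: "f \<in> Hom smooth_site B A"
  obtain m W where W: "B = (m, W)" "openin (Euclidean_space m) W" using B by (auto simp: smooth_site_simps)
  have fs: "smooth_into m W n U f" using f by (simp add: A(1) W(1) smooth_site_simps smooth_maps_iff)
  define pre where "pre V = {x \<in> W. f x \<in> V}" for V
  have op: "openin (Euclidean_space m) (pre V)" if "V \<in> \<U>" for V
    unfolding pre_def using U(2) that by (intro smooth_into_preimage_open[OF W(2) _ subset_Rn[OF A(2)] fs]) blast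
  have "Pair m ` pre ` \<U> \<in> Cov smooth_site B"
    unfolding W(1) smooth_site_simps
  proof (intro CollectI exI[of _ "pre ` \<U>"] conjI refl)
    show "\<forall>V\<in>pre ` \<U>. openin (Euclidean_space m) V" using op by blast
    show "\<Union>(pre ` \<U>) = W" using fs U(3) by (auto simp: pre_def smooth_into_def)
  qed
  moreover have "restrict f (pre V) \<in> smooth_maps (m, pre V) (n, V)" if "V \<in> \<U>" for V
    by (intro smooth_into_restrict op that smooth_into_subset[OF fs]) (auto simp: pre_def)
  ultimately show "\<exists>\<D>\<in>Cov smooth_site B. \<forall>B'\<in>\<D>. \<exists>A'\<in>\<C>. restrict f (snd B') \<in> Hom smooth_site B' A'"
    by (intro bexI[of _ "Pair m ` pre ` \<U>"]) (auto simp: U(1) smooth_site_simps)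
qed

text \<open>
  Preimages of a cover form a cover because quasi-standard smooth maps are continuous for the Fermat
  topology.
\<close>

interpretation fermat: concrete_site fermat_site
proof
  fix A B C f g and c :: fpoint
  show "Ident fermat_site A = (\<lambda>x\<in>snd A. x)" "Comp fermat_site A B C g f = compose (snd A) g f"
    by (simp_all add: fermat_site_def)
  show "Hom fermat_site A B \<subseteq> snd A \<rightarrow>\<^sub>E snd B"
    by (auto simp: fermat_site_simps qs_smooth_maps_def)
  show "(\<lambda>_\<in>snd A. c) \<in> Hom fermat_site A B" if "A \<in> Obj fermat_site" "B \<in> Obj fermat_site" "c \<in> snd B"
    using that qs_smooth_const by (auto simp: fermat_site_simps)
  show "compose (snd A) g f \<in> Hom fermat_site A C"
    if "A \<in> Obj fermat_site" "B \<in> Obj fermat_site" "f \<in> Hom fermat_site A B" "g \<in> Hom fermat_site B C"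
  proof -
    obtain n U m V l W where eq: "A = (n, U)" "B = (m, V)" "C = (l, W)" by (metis surj_pair)
    show ?thesis using that qs_smooth_compose[of U n V m f g l W] by (simp add: eq fermat_site_simps)
  qed
next
  fix A :: "nat \<times> fpoint set" assume "A \<in> Obj fermat_site"
  then obtain n U where A: "A = (n, U)" "U \<subseteq> fermat n (Rn n)" by (auto simp: fermat_site_simps)
  have top: "topspace (fermat_topology n) = fermat n (Rn n)" for n
  proof (rule antisym)
    show "topspace (fermat_topology n) \<subseteq> fermat n (Rn n)"
      using openin_topspace[of "fermat_topology n"] fermat_subset unfolding openin_fermat_topology by metis
    show "fermat n (Rn n) \<subseteq> topspace (fermat_topology n)"
      using openin_Rn by (intro openin_subset) (auto simp: openin_fermat_topology)
  qed
  have topU: "openin (subtopology (fermat_topology n) U) U"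
    using A(2) by (simp add: openin_subtopology_refl top)
  show "{A} \<in> Cov fermat_site A"
    unfolding A(1) fermat_site_simps using topU by (auto intro!: exI[of _ "{U}"])
  fix \<C> assume "\<C> \<in> Cov fermat_site A"
  then obtain \<U> where U: "\<C> = Pair n ` \<U>" "\<forall>V\<in>\<U>. openin (subtopology (fermat_topology n) U) V" "\<Union>\<U> = U"
    by (auto simp: A(1) fermat_site_simps)
  have sub: "V \<subseteq> fermat n (Rn n)" if "V \<in> \<U>" for V using that U(3) A(2) by blast
  show "(\<Union>B\<in>\<C>. snd B) = snd A" using U by (simp add: A(1))
  have incl: "(\<lambda>x\<in>V. x) \<in> qs_smooth_maps (n, V) (n, U)" if "V \<in> \<U>" for V
    using qs_smooth_inclusion[OF sub[OF that], of U] that U(3) by blast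
  show "B \<in> Obj fermat_site \<and> (\<lambda>x\<in>snd B. x) \<in> Hom fermat_site B A" if "B \<in> \<C>" for B
    using that sub incl by (auto simp: A(1) U(1) fermat_site_simps)
  show "(\<Union>B\<in>\<C>. \<D> B) \<in> Cov fermat_site A" if D: "\<And>B. B \<in> \<C> \<Longrightarrow> \<D> B \<in> Cov fermat_site B" for \<D>
  proof -
    have "\<forall>V\<in>\<U>. \<exists>\<V>. \<D> (n, V) = Pair n ` \<V> \<and>
        (\<forall>W\<in>\<V>. openin (subtopology (fermat_topology n) V) W) \<and> \<Union>\<V> = V"
      using D by (auto simp: U(1) fermat_site_simps)
    from bchoice[OF this] obtain \<V> where V: "\<forall>V\<in>\<U>. \<D> (n, V) = Pair n ` \<V> V \<and>
        (\<forall>W\<in>\<V> V. openin (subtopology (fermat_topology n) V) W) \<and> \<Union>(\<V> V) = V" by blast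
    then have "(\<Union>B\<in>\<C>. \<D> B) = Pair n ` (\<Union>V\<in>\<U>. \<V> V)" by (auto simp: U(1))
    moreover have "\<Union>(\<Union>V\<in>\<U>. \<V> V) = U"
    proof -
      have "\<Union>(\<Union>V\<in>\<U>. \<V> V) = (\<Union>V\<in>\<U>. \<Union>(\<V> V))" by blast
      also have "\<dots> = \<Union>\<U>" using V by simp
      finally show ?thesis by (simp add: U(3))
    qed
    moreover have "\<forall>W\<in>(\<Union>V\<in>\<U>. \<V> V). openin (subtopology (fermat_topology n) U) W"
    proof
      fix W assume "W \<in> (\<Union>V\<in>\<U>. \<V> V)"
      then obtain V' where V': "V' \<in> \<U>" "W \<in> \<V> V'" by blast
      have "openin (subtopology (fermat_topology n) V') W" using V V' by blast
      moreover have "subtopology (fermat_topology n) V' = subtopology (subtopology (fermat_topology n) U) V'"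
      proof -
        have "U \<inter> V' = V'" using V'(1) U(3) by blast
        then show ?thesis by (simp add: subtopology_subtopology)
      qed
      ultimately show "openin (subtopology (fermat_topology n) U) W"
        using U(2) V'(1) openin_trans_full by metis
    qed
    ultimately show ?thesis unfolding A(1) fermat_site_simps by blast
  qed
  fix B f assume B: "B \<in> Obj fermat_site" and f: "f \<in> Hom fermat_site B A"
  obtain m W where W: "B = (m, W)" "W \<subseteq> fermat m (Rn m)" using B by (auto simp: fermat_site_simps)
  have fs: "f \<in> qs_smooth_maps (m, W) (n, U)" using f by (simp add: A(1) W(1) fermat_site_simps)
  then have fW: "f \<in> W \<rightarrow>\<^sub>E U" by (simp add: qs_smooth_maps_def)
  define pre where "pre V = {x \<in> W. f x \<in> V}" for V
  have op: "openin (subtopology (fermat_topology m) W) (pre V)" if V: "V \<in> \<U>" for V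
  proof -
    obtain V' where "openin (Euclidean_space n) V'" "V = fermat n V' \<inter> U"
      using U(2) V unfolding openin_subtopology openin_fermat_topology by blast
    moreover have "pre (fermat n V' \<inter> U) = {x \<in> W. f x \<in> fermat n V'}"
      using fW by (auto simp: pre_def)
    ultimately show ?thesis using qs_smooth_preimage_open[OF W(2) fs] by simp
  qed
  have "Pair m ` pre ` \<U> \<in> Cov fermat_site B"
    unfolding W(1) fermat_site_simps
  proof (intro CollectI exI[of _ "pre ` \<U>"] conjI refl)
    show "\<forall>V\<in>pre ` \<U>. openin (subtopology (fermat_topology m) W) V" using op by blast
    show "\<Union>(pre ` \<U>) = W" using fW U(3) by (auto simp: pre_def)
  qed
  moreover have "restrict f (pre V) \<in> qs_smooth_maps (m, pre V) (n, V)" if V: "V \<in> \<U>" for V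
  proof -
    have preW: "pre V \<subseteq> W" "pre V \<subseteq> fermat m (Rn m)" using W(2) by (auto simp: pre_def)
    have "compose (pre V) f (\<lambda>x\<in>pre V. x) \<in> qs_smooth_maps (m, pre V) (n, U)"
      by (rule qs_smooth_compose[OF preW(2) W(2) qs_smooth_inclusion[OF preW(2,1)] fs])
    moreover have "compose (pre V) f (\<lambda>x\<in>pre V. x) = restrict f (pre V)"
      by (simp add: compose_def restrict_def fun_eq_iff)
    moreover have "restrict f (pre V) \<in> pre V \<rightarrow>\<^sub>E V" by (auto simp: pre_def)
    ultimately show ?thesis unfolding qs_smooth_maps_iff[OF preW(2)] by simp
  qed
  ultimately show "\<exists>\<D>\<in>Cov fermat_site B. \<forall>B'\<in>\<D>. \<exists>A'\<in>\<C>. restrict f (snd B') \<in> Hom fermat_site B' A'"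
    by (intro bexI[of _ "Pair m ` pre ` \<U>"]) (auto simp: U(1) fermat_site_simps)
qed

lemma fermat_obj_in_site: "U \<in> Obj smooth_site \<Longrightarrow> fermat_obj U \<in> Obj fermat_site"
  by (auto simp: smooth_site_simps fermat_site_simps fermat_obj_def dest: subsetD[OF fermat_subset])

lemma fermat_ext_in_Hom:
  assumes "U \<in> Obj smooth_site" "V \<in> Obj smooth_site" "f \<in> Hom smooth_site U V"
  shows "fermat_ext U V f \<in> Hom fermat_site (fermat_obj U) (fermat_obj V)"
proof -
  obtain n A m B where eq: "U = (n, A)" "V = (m, B)" by (metis surj_pair)
  then show ?thesis using assms qs_smooth_fermat_ext[of n A m B f]
    by (auto simp: smooth_site_simps fermat_site_simps fermat_obj_def smooth_maps_iff)
qed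

text \<open>
  On representatives the extension is composition, so identities and composites are preserved up to
  the values outside the domains, which do not affect classes.
\<close>

lemma is_functor_fermat_ext: "is_functor smooth_site fermat_site fermat_obj fermat_ext"
  unfolding is_functor_def smooth.Ident_eq smooth.Comp_eq fermat.Ident_eq fermat.Comp_eq
proof (intro conjI ballI smooth.is_category fermat.is_category fermat_obj_in_site fermat_ext_in_Hom)
  fix X assume "X \<in> Obj smooth_site"
  then obtain n U where X: "X = (n, U)" "openin (Euclidean_space n) U" by (auto simp: smooth_site_simps)
  have sm: "smooth_into n U n U (\<lambda>x\<in>U. x)"
    using smooth_into_restrict[OF X(2) smooth_into_ident] by (simp add: smooth_maps_iff)
  have "fermat_ext (n, U) (n, U) (\<lambda>x\<in>U. x) a = a" if "a \<in> fermat n U" for a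
  proof -
    obtain x where x: "little_oh_poly n U x" "a = fermat_class n x" using \<open>a \<in> fermat n U\<close> mem_fermat_iff[OF X(2)] by blast
    have "fermat_class n x = fermat_class n (\<lambda>t. (\<lambda>x\<in>U. x) (x t))"
      by (rule fermat_class_cong[OF x(1) _ little_oh_poly_Rn[OF X(2) x(1)]]) simp
    then show ?thesis using fermat_ext_fermat_class[OF X(2,2) sm x(1)] by (simp add: x(2))
  qed
  then show "fermat_ext X X (\<lambda>x\<in>snd X. x) = (\<lambda>x\<in>snd (fermat_obj X). x)"
    by (auto simp: X(1) fermat_obj_def fermat_ext_def fun_eq_iff)
next
  fix X Y Z f g
  assume obj: "X \<in> Obj smooth_site" "Y \<in> Obj smooth_site" "Z \<in> Obj smooth_site"
    and fg: "f \<in> Hom smooth_site X Y" "g \<in> Hom smooth_site Y Z"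
  obtain n U m V l W where eq: "X = (n, U)" "Y = (m, V)" "Z = (l, W)" by (metis surj_pair)
  have op: "openin (Euclidean_space n) U" "openin (Euclidean_space m) V" "openin (Euclidean_space l) W"
    and f: "smooth_into n U m V f" and g: "smooth_into m V l W g"
    using obj fg by (auto simp: eq smooth_site_simps smooth_maps_iff)
  have gf: "smooth_into n U l W (compose U g f)"
    using smooth_into_restrict[OF op(1) smooth_into_compose[OF op(1,2) f g]] by (simp add: smooth_maps_iff compose_def)
  have "fermat_ext (n, U) (l, W) (compose U g f) a = fermat_ext (m, V) (l, W) g (fermat_ext (n, U) (m, V) f a)"
    if a: "a \<in> fermat n U" for a
  proof -
    obtain x where x: "little_oh_poly n U x" "a = fermat_class n x" using a mem_fermat_iff[OF op(1)] by blast
    have fx: "little_oh_poly m V (\<lambda>t. f (x t))" by (rule smooth_into_little_oh_poly[OF op(1) f x(1)])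
    have "fermat_class l (\<lambda>t. g (f (x t))) = fermat_class l (\<lambda>t. compose U g f (x t))"
      by (rule fermat_class_cong[OF x(1) _ little_oh_poly_Rn[OF op(3) smooth_into_little_oh_poly[OF op(2) g fx]]])
         (simp add: compose_def)
    then show ?thesis
      using fermat_ext_fermat_class[OF op(1,3) gf x(1)] fermat_ext_fermat_class[OF op(1,2) f x(1)] fermat_ext_fermat_class[OF op(2,3) g fx]
      by (simp add: x(2))
  qed
  then show "fermat_ext X Z (compose (snd X) g f) =
      compose (snd (fermat_obj X)) (fermat_ext Y Z g) (fermat_ext X Y f)"
    unfolding eq fermat_obj_def fst_conv snd_conv
    by (intro ext) (simp add: compose_def fermat_ext_def[of "(n, U)" "(l, W)"])
qed

section \<open>The Fermat extension of a diffeological space\<close>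

lemma plot_category_simps:
  "Obj (plot_category X) = {(U, p). U \<in> Obj smooth_site \<and> p \<in> Sec X U}"
  "f \<in> Hom (plot_category X) i j \<longleftrightarrow> f \<in> Hom smooth_site (fst i) (fst j) \<and> compose (snd (fst i)) (snd j) f = snd i"
  by (auto simp: plot_category_def case_prod_beta)

lemma representable_simps:
  "Pts (representable \<A> A) = snd A" "B \<in> Obj \<A> \<Longrightarrow> Sec (representable \<A> A) B = Hom \<A> B A"
  by (simp_all add: representable_def)

interpretation fermat_plots: concrete_diagram fermat_site "plot_category X" fermat_plot_dom fermat_plot_map
  for X :: "'a diffeology"
proof
  fix i :: "'a plot" and A B f s c assume "i \<in> Obj (plot_category X)"
  then have fi: "fst i \<in> Obj smooth_site" "fermat_obj (fst i) \<in> Obj fermat_site"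
    using fermat_obj_in_site by (auto simp: plot_category_simps)
  assume A: "A \<in> Obj fermat_site"
  show "Sec (fermat_plot_dom i) A \<subseteq> snd A \<rightarrow>\<^sub>E Pts (fermat_plot_dom i)"
    using fermat.Hom_fun[OF A fi(2)] by (simp add: fermat_plot_dom_def representable_simps A)
  show "(\<lambda>_\<in>snd A. c) \<in> Sec (fermat_plot_dom i) A" if "c \<in> Pts (fermat_plot_dom i)"
    using fermat.Hom_const[OF A fi(2)] that by (simp add: fermat_plot_dom_def representable_simps A)
  show "compose (snd B) s f \<in> Sec (fermat_plot_dom i) B"
    if "B \<in> Obj fermat_site" "f \<in> Hom fermat_site B A" "s \<in> Sec (fermat_plot_dom i) A"
    using fermat.Hom_compose[OF that(1) A fi(2) that(2)] that by (simp add: fermat_plot_dom_def representable_simps A)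
next
  fix i j :: "'a plot" and d
  assume "i \<in> Obj (plot_category X)" "j \<in> Obj (plot_category X)" "d \<in> Hom (plot_category X) i j"
  then have "fst i \<in> Obj smooth_site" "fst j \<in> Obj smooth_site" "d \<in> Hom smooth_site (fst i) (fst j)"
    by (auto simp: plot_category_simps)
  from fermat_ext_in_Hom[OF this] fermat.Hom_fun[OF fermat_obj_in_site[OF this(1)] fermat_obj_in_site[OF this(2)]]
  have "fermat_ext (fst i) (fst j) d \<in> snd (fermat_obj (fst i)) \<rightarrow>\<^sub>E snd (fermat_obj (fst j))" by blast
  then show "fermat_plot_map i j d \<in> Pts (fermat_plot_dom i) \<rightarrow> Pts (fermat_plot_dom j)"
    by (simp add: fermat_plot_map_def fermat_plot_dom_def representable_simps PiE_def)
qed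

lemma is_colimit_fermat_space:
  "is_colimit TYPE('c) fermat_site (plot_category X) fermat_plot_dom fermat_plot_map (fermat_space X) (fermat_in X)"
  unfolding fermat_space_def fermat_in_def by (rule fermat_plots.colim_is_colimit)

text \<open>
  Let \<open>\<kappa>\<close> be a cocone. A point x of X is the value of the constant plot on the one-point space, which
  forces the induced map to send x to the value of \<open>\<kappa>\<close> at that plot. For a plot p on U and a point u
  of U, the constant map u is a morphism from the constant plot \<open>p u\<close> to p, so that the induced map
  composed with p is \<open>\<kappa>\<close> at p, and this is a section, being the image of the identity section
  of U.
\<close>

lemma is_colimit_plots:
  fixes X :: "'a diffeology"
  assumes X: "is_csheaf smooth_site X"
  shows "is_colimit TYPE('c) smooth_site (plot_category X) plot_dom (\<lambda>_ _ f. f) X snd"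
  unfolding is_colimit_def
proof (intro conjI allI impI)
  have Sec_compose: "compose (snd B) s f \<in> Sec X B"
    if "A \<in> Obj smooth_site" "B \<in> Obj smooth_site" "f \<in> Hom smooth_site B A" "s \<in> Sec X A" for A B f s
    using X that unfolding is_csheaf_def by blast
  show "is_cocone smooth_site (plot_category X) plot_dom (\<lambda>_ _ f. f) X snd"
    unfolding is_cocone_def
  proof (intro conjI ballI X)
    fix i assume i: "i \<in> Obj (plot_category X)"
    then have "fst i \<in> Obj smooth_site" "snd i \<in> Sec X (fst i)" by (auto simp: plot_category_simps)
    then show "snd i \<in> csheaf_maps smooth_site (plot_dom i) X"
      using csheaf_Sec_fun[OF X] Sec_compose
      unfolding csheaf_maps_def plot_dom_def by (auto simp: representable_simps simp del: split_paired_All)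
  next
    fix i j f assume "f \<in> Hom (plot_category X) i j"
    then show "compose (Pts (plot_dom i)) (snd j) f = snd i"
      by (simp add: plot_category_simps plot_dom_def representable_simps)
  qed
  fix Z :: "'c diffeology" and \<kappa>
  assume "is_cocone smooth_site (plot_category X) plot_dom (\<lambda>_ _ f. f) Z \<kappa>"
  then have \<kappa>: "\<And>i. i \<in> Obj (plot_category X) \<Longrightarrow> \<kappa> i \<in> csheaf_maps smooth_site (plot_dom i) Z"
    and nat: "\<And>i j f. i \<in> Obj (plot_category X) \<Longrightarrow> j \<in> Obj (plot_category X) \<Longrightarrow> f \<in> Hom (plot_category X) i j \<Longrightarrow>
      compose (Pts (plot_dom i)) (\<kappa> j) f = \<kappa> i"
    unfolding is_cocone_def by blast+
  define z0 :: vec where "z0 = (\<lambda>_. 0)"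
  define pt :: "nat \<times> vec set" where "pt = (0, {z0})"
  have "Rn 0 = {z0}" by (auto simp: Rn_iff z0_def fun_eq_iff)
  then have pt: "pt \<in> Obj smooth_site" "snd pt = {z0}"
    using openin_Rn[of 0] by (auto simp: pt_def smooth_site_simps)
  \<comment> \<open>the constant plots on the space of dimension 0\<close>
  define q where "q x = (pt, \<lambda>_\<in>{z0}. x)" for x :: 'a
  have q: "q x \<in> Obj (plot_category X)" if "x \<in> Pts X" for x
    using X pt that unfolding is_csheaf_def q_def plot_category_simps by fastforce
  define h where "h = (\<lambda>x\<in>Pts X. \<kappa> (q x) z0)"
  have h: "h (p u) = \<kappa> (U, p) u" if U: "U \<in> Obj smooth_site" and p: "p \<in> Sec X U" and u: "u \<in> snd U" for U p u
  proof -
    have pu: "p u \<in> Pts X" using csheaf_Sec_fun[OF X U p] u by blast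
    have j: "(U, p) \<in> Obj (plot_category X)" using U p by (simp add: plot_category_simps)
    have "(\<lambda>_\<in>{z0}. u) \<in> Hom (plot_category X) (q (p u)) (U, p)"
      using smooth.Hom_const[OF pt(1) U u] by (auto simp: plot_category_simps q_def pt(2) compose_def)
    from fun_cong[OF nat[OF q[OF pu] j this], of z0]
    have "\<kappa> (U, p) u = \<kappa> (q (p u)) z0"
      by (simp add: compose_def plot_dom_def representable_simps q_def pt(2))
    then show ?thesis using pu by (simp add: h_def)
  qed
  have comp: "compose (snd U) h p = \<kappa> (U, p)" if U: "U \<in> Obj smooth_site" and p: "p \<in> Sec X U" for U p
  proof
    fix u
    have "\<kappa> (U, p) \<in> extensional (snd U)"
      using \<kappa>[of "(U, p)"] U p unfolding csheaf_maps_def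
      by (simp add: plot_category_simps plot_dom_def representable_simps PiE_def)
    then show "compose (snd U) h p u = \<kappa> (U, p) u"
      using h[OF U p, of u] by (simp add: compose_def extensional_def)
  qed
  have \<kappa>_Sec: "\<kappa> (U, p) \<in> Sec Z U" if U: "U \<in> Obj smooth_site" and p: "p \<in> Sec X U" for U p
  proof -
    have "\<kappa> (U, p) \<in> csheaf_maps smooth_site (representable smooth_site U) Z"
      using \<kappa>[of "(U, p)"] U p by (simp add: plot_category_simps plot_dom_def)
    then have K: "\<kappa> (U, p) \<in> snd U \<rightarrow>\<^sub>E Pts Z"
        "compose (snd U) (\<kappa> (U, p)) (\<lambda>x\<in>snd U. x) \<in> Sec Z U"
      using smooth.Hom_ident[OF U] U unfolding csheaf_maps_def by (auto simp: representable_simps)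
    have "compose (snd U) (\<kappa> (U, p)) (\<lambda>x\<in>snd U. x) = \<kappa> (U, p)"
      using K(1) by (intro compose_Id) (auto simp: PiE_def)
    with K(2) show ?thesis by simp
  qed
  have "\<kappa> (q x) z0 \<in> Pts Z" if "x \<in> Pts X" for x
    using \<kappa>[OF q[OF that]] pt(2) unfolding csheaf_maps_def by (auto simp: plot_dom_def representable_simps q_def)
  then have hmap: "h \<in> csheaf_maps smooth_site X Z"
    unfolding csheaf_maps_def using \<kappa>_Sec comp by (simp add: h_def[symmetric] del: split_paired_All) (simp add: h_def)
  show "\<exists>!h. h \<in> csheaf_maps smooth_site X Z \<and>
    (\<forall>i\<in>Obj (plot_category X). compose (Pts (plot_dom i)) h (snd i) = \<kappa> i)"
  proof (rule ex1I[of _ h], intro conjI ballI hmap)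
    show "compose (Pts (plot_dom i)) h (snd i) = \<kappa> i" if "i \<in> Obj (plot_category X)" for i
      using comp[of "fst i" "snd i"] that by (auto simp: plot_category_simps plot_dom_def representable_simps)
    fix h' assume h': "h' \<in> csheaf_maps smooth_site X Z \<and>
      (\<forall>i\<in>Obj (plot_category X). compose (Pts (plot_dom i)) h' (snd i) = \<kappa> i)"
    show "h' = h"
    proof (rule PiE_ext)
      show "h' \<in> Pts X \<rightarrow>\<^sub>E Pts Z" "h \<in> Pts X \<rightarrow>\<^sub>E Pts Z" using h' hmap unfolding csheaf_maps_def by blast+
      fix x assume x: "x \<in> Pts X"
      have "compose (Pts (plot_dom (q x))) h' (snd (q x)) = \<kappa> (q x)" using h' q[OF x] by blast
      from fun_cong[OF this, of z0] show "h' x = h x"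
        by (simp add: compose_def plot_dom_def representable_simps q_def pt(2) h_def x)
    qed
  qed
qed

lemma plot_fun:
  assumes "is_csheaf smooth_site X" "j \<in> Obj (plot_category X)"
  shows "snd j \<in> snd (fst j) \<rightarrow>\<^sub>E Pts X"
proof -
  have "fst j \<in> Obj smooth_site" "snd j \<in> Sec X (fst j)" using assms(2) by (auto simp: plot_category_simps)
  then show ?thesis by (rule csheaf_Sec_fun[OF assms(1)])
qed

lemma plot_comp_in:
  assumes "g \<in> csheaf_maps smooth_site X Y" "j \<in> Obj (plot_category X)"
  shows "plot_comp g j \<in> Obj (plot_category Y)"
  using assms by (auto simp: plot_category_simps plot_comp_def csheaf_maps_def)

text \<open>
  A morphism between plots of X is also a morphism between their composites with g. The inclusions at
  these plots of Y therefore form a cocone over the diagram of X, and the universal property applies.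
\<close>

lemma fermat_map_ex1:
  fixes X :: "'a diffeology" and Y :: "'b diffeology"
  assumes X: "is_csheaf smooth_site X" and g: "g \<in> csheaf_maps smooth_site X Y"
  shows "\<exists>!h. h \<in> csheaf_maps fermat_site (fermat_space X) (fermat_space Y) \<and>
    (\<forall>j\<in>Obj (plot_category X).
       compose (Pts (fermat_plot_dom j)) h (fermat_in X j) = fermat_in Y (plot_comp g j))"
proof -
  have coneY: "is_cocone fermat_site (plot_category Y) fermat_plot_dom fermat_plot_map (fermat_space Y) (fermat_in Y)"
    using is_colimit_fermat_space unfolding is_colimit_def by blast
  have dom: "fermat_plot_dom (plot_comp g j) = fermat_plot_dom j" for j
    by (simp add: fermat_plot_dom_def plot_comp_def)
  have hom: "f \<in> Hom (plot_category Y) (plot_comp g i) (plot_comp g j)"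
    if i: "i \<in> Obj (plot_category X)" and j: "j \<in> Obj (plot_category X)" and f: "f \<in> Hom (plot_category X) i j" for i j f
  proof -
    have s: "fst i \<in> Obj smooth_site" "fst j \<in> Obj smooth_site"
      and f': "f \<in> Hom smooth_site (fst i) (fst j)" "compose (snd (fst i)) (snd j) f = snd i"
      using i j f by (auto simp: plot_category_simps)
    have "f \<in> snd (fst i) \<rightarrow> snd (fst j)" using smooth.Hom_fun[OF s] f'(1) by blast
    from compose_assoc[OF this, of g "snd j"] f'
    show ?thesis by (simp add: plot_category_simps plot_comp_def)
  qed
  have "is_cocone fermat_site (plot_category X) fermat_plot_dom fermat_plot_map (fermat_space Y)
    (\<lambda>j. fermat_in Y (plot_comp g j))"
    unfolding is_cocone_def
  proof (intro conjI ballI)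
    show "is_csheaf fermat_site (fermat_space Y)" using coneY unfolding is_cocone_def by blast
    show "fermat_in Y (plot_comp g i) \<in> csheaf_maps fermat_site (fermat_plot_dom i) (fermat_space Y)"
      if "i \<in> Obj (plot_category X)" for i
      using coneY plot_comp_in[OF g that] unfolding is_cocone_def by (metis dom)
    show "compose (Pts (fermat_plot_dom i)) (fermat_in Y (plot_comp g j)) (fermat_plot_map i j f) = fermat_in Y (plot_comp g i)"
      if "i \<in> Obj (plot_category X)" "j \<in> Obj (plot_category X)" "f \<in> Hom (plot_category X) i j" for i j f
    proof -
      have "compose (Pts (fermat_plot_dom (plot_comp g i))) (fermat_in Y (plot_comp g j))
          (fermat_plot_map (plot_comp g i) (plot_comp g j) f) = fermat_in Y (plot_comp g i)"
        using coneY plot_comp_in[OF g that(1)] plot_comp_in[OF g that(2)] hom[OF that] unfolding is_cocone_def by blast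
      moreover have "fermat_plot_map (plot_comp g i) (plot_comp g j) f = fermat_plot_map i j f"
        by (simp add: fermat_plot_map_def plot_comp_def)
      ultimately show ?thesis by (simp add: dom)
    qed
  qed
  then show ?thesis
    using is_colimit_fermat_space[where 'c = "('b plot \<times> fpoint) set", of X] unfolding is_colimit_def by blast
qed

lemma fermat_map_universal:
  assumes "is_csheaf smooth_site X" "g \<in> csheaf_maps smooth_site X Y"
  shows "fermat_map X Y g \<in> csheaf_maps fermat_site (fermat_space X) (fermat_space Y)"
    and "j \<in> Obj (plot_category X) \<Longrightarrow>
      compose (Pts (fermat_plot_dom j)) (fermat_map X Y g) (fermat_in X j) = fermat_in Y (plot_comp g j)"
  using theI'[OF fermat_map_ex1[OF assms]] unfolding fermat_map_def by blast+

lemma fermat_map_unique: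
  assumes "is_csheaf smooth_site X" "g \<in> csheaf_maps smooth_site X Y"
    and "h \<in> csheaf_maps fermat_site (fermat_space X) (fermat_space Y)"
    and "\<And>j. j \<in> Obj (plot_category X) \<Longrightarrow>
      compose (Pts (fermat_plot_dom j)) h (fermat_in X j) = fermat_in Y (plot_comp g j)"
  shows "fermat_map X Y g = h"
  unfolding fermat_map_def using assms by (intro the1_equality fermat_map_ex1) auto

lemma csheaf_category_simps:
  "Obj (csheaf_category \<A>) = {X. is_csheaf \<A> X}" "Hom (csheaf_category \<A>) = csheaf_maps \<A>"
  "Ident (csheaf_category \<A>) X = (\<lambda>x\<in>Pts X. x)" "Comp (csheaf_category \<A>) X Y Z g f = compose (Pts X) g f"
  by (simp_all add: csheaf_category_def)

lemma fermat_in_fun: "j \<in> Obj (plot_category X) \<Longrightarrow> fermat_in X j \<in> Pts (fermat_plot_dom j) \<rightarrow>\<^sub>E Pts (fermat_space X)"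
  using fermat_plots.colim_in_map[of j X] unfolding csheaf_maps_def fermat_in_def fermat_space_def by blast

text \<open>
  Identities and composites of induced maps satisfy the equations that characterise the map induced
  by the identity and by the composite.
\<close>

lemma is_functor_fermat_map:
  "is_functor (Diff :: ('a diffeology, 'a \<Rightarrow> 'a) category) FermatSpaces fermat_space fermat_map"
  unfolding is_functor_def csheaf_category_simps mem_Collect_eq
proof (intro conjI ballI is_category_csheaf_category)
  have csheaf: "is_csheaf fermat_site (fermat_space X)" for X :: "'a diffeology"
    unfolding fermat_space_def by (rule fermat_plots.is_csheaf_colim)
  then show "is_csheaf fermat_site (fermat_space X)" for X :: "'a diffeology" .
  have catD: "is_category (csheaf_category smooth_site :: ('a diffeology, 'a \<Rightarrow> 'a) category)"
    and catF: "is_category (csheaf_category fermat_site :: (('a plot \<times> fpoint) set fermat_space, _) category)"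
    by (rule is_category_csheaf_category)+
  fix X :: "'a diffeology" assume "X \<in> {X. is_csheaf smooth_site X}"
  then have X: "is_csheaf smooth_site X" by simp
  show "fermat_map X Y f \<in> csheaf_maps fermat_site (fermat_space X) (fermat_space Y)"
    if "f \<in> csheaf_maps smooth_site X Y" for Y :: "'a diffeology" and f
    by (rule fermat_map_universal(1)[OF X that])
  show "fermat_map X X (\<lambda>x\<in>Pts X. x) = (\<lambda>x\<in>Pts (fermat_space X). x)"
  proof (rule fermat_map_unique[OF X])
    show "(\<lambda>x\<in>Pts X. x) \<in> csheaf_maps smooth_site X X"
      using catD X unfolding is_category_def csheaf_category_simps by blast
    show "(\<lambda>x\<in>Pts (fermat_space X). x) \<in> csheaf_maps fermat_site (fermat_space X) (fermat_space X)"
      using catF csheaf unfolding is_category_def csheaf_category_simps by blast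
    fix j :: "'a plot" assume j: "j \<in> Obj (plot_category X)"
    have "compose (snd (fst j)) (\<lambda>x\<in>Pts X. x) (snd j) = snd j"
      using plot_fun[OF X j] by (intro Id_compose) (auto simp: PiE_def)
    then have "plot_comp (\<lambda>x\<in>Pts X. x) j = j" by (simp add: plot_comp_def)
    moreover have "compose (Pts (fermat_plot_dom j)) (\<lambda>x\<in>Pts (fermat_space X). x) (fermat_in X j) = fermat_in X j"
      using fermat_in_fun[OF j] by (intro Id_compose) (auto simp: PiE_def)
    ultimately show "compose (Pts (fermat_plot_dom j)) (\<lambda>x\<in>Pts (fermat_space X). x) (fermat_in X j) =
        fermat_in X (plot_comp (\<lambda>x\<in>Pts X. x) j)" by simp
  qed
  fix Y Z :: "'a diffeology" and f g
  assume "Y \<in> {X. is_csheaf smooth_site X}" "Z \<in> {X. is_csheaf smooth_site X}"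
    and f: "f \<in> csheaf_maps smooth_site X Y" and g: "g \<in> csheaf_maps smooth_site Y Z"
  then have Y: "is_csheaf smooth_site Y" and Z: "is_csheaf smooth_site Z" by simp_all
  show "fermat_map X Z (compose (Pts X) g f) =
      compose (Pts (fermat_space X)) (fermat_map Y Z g) (fermat_map X Y f)"
  proof (rule fermat_map_unique[OF X])
    show "compose (Pts X) g f \<in> csheaf_maps smooth_site X Z"
      using catD X Y Z f g unfolding is_category_def csheaf_category_simps by blast
    show "compose (Pts (fermat_space X)) (fermat_map Y Z g) (fermat_map X Y f)
        \<in> csheaf_maps fermat_site (fermat_space X) (fermat_space Z)"
      using catF csheaf fermat_map_universal(1)[OF X f] fermat_map_universal(1)[OF Y g]
      unfolding is_category_def csheaf_category_simps by blast
    fix j :: "'a plot" assume j: "j \<in> Obj (plot_category X)"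
    let ?D = "Pts (fermat_plot_dom j)"
    have inj: "fermat_in X j \<in> ?D \<rightarrow> Pts (fermat_space X)" using fermat_in_fun[OF j] by (simp add: PiE_def)
    have sj: "snd j \<in> snd (fst j) \<rightarrow> Pts X"
      using plot_fun[OF X j] by (simp add: PiE_def)
    have dom: "fermat_plot_dom (plot_comp f j) = fermat_plot_dom j"
      by (simp add: fermat_plot_dom_def plot_comp_def)
    have "compose ?D (compose (Pts (fermat_space X)) (fermat_map Y Z g) (fermat_map X Y f)) (fermat_in X j) =
        compose ?D (fermat_map Y Z g) (fermat_in Y (plot_comp f j))"
      using compose_assoc[OF inj, of "fermat_map Y Z g" "fermat_map X Y f"] fermat_map_universal(2)[OF X f j] by simp
    also have "\<dots> = fermat_in Z (plot_comp g (plot_comp f j))"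
      using fermat_map_universal(2)[OF Y g plot_comp_in[OF f j]] by (simp add: dom)
    also have "plot_comp g (plot_comp f j) = plot_comp (compose (Pts X) g f) j"
      using compose_assoc[OF sj, of g f] by (simp add: plot_comp_def)
    finally show "compose ?D (compose (Pts (fermat_space X)) (fermat_map Y Z g) (fermat_map X Y f)) (fermat_in X j) =
        fermat_in Z (plot_comp (compose (Pts X) g f) j)" .
  qed
qed

theorem proposition4:
  shows "is_functor smooth_site fermat_site fermat_obj fermat_ext \<and>
    is_functor (Diff :: ('a diffeology, 'a \<Rightarrow> 'a) category) FermatSpaces fermat_space fermat_map \<and>
    (\<forall>X::'a diffeology. is_csheaf smooth_site X \<longrightarrow>
       is_colimit TYPE('c) smooth_site (plot_category X) plot_dom (\<lambda>_ _ f. f) X snd \<and>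
       is_colimit TYPE('c) fermat_site (plot_category X) fermat_plot_dom fermat_plot_map
         (fermat_space X) (fermat_in X)) \<and>
    (\<forall>(X::'a diffeology) (Y::'b diffeology) g.
       is_csheaf smooth_site X \<longrightarrow> is_csheaf smooth_site Y \<longrightarrow> g \<in> csheaf_maps smooth_site X Y \<longrightarrow>
       fermat_map X Y g \<in> csheaf_maps fermat_site (fermat_space X) (fermat_space Y) \<and>
       (\<forall>j\<in>Obj (plot_category X).
          compose (Pts (fermat_plot_dom j)) (fermat_map X Y g) (fermat_in X j)
            = fermat_in Y (plot_comp g j)))"
proof (intro conjI allI impI ballI)
  show "compose (Pts (fermat_plot_dom j)) (fermat_map X Y g) (fermat_in X j) = fermat_in Y (plot_comp g j)"
    if "is_csheaf smooth_site X" "g \<in> csheaf_maps smooth_site X Y" "j \<in> Obj (plot_category X)"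
    for X :: "'a diffeology" and Y :: "'b diffeology" and g j
    by (rule fermat_map_universal(2)[OF that])
  show "fermat_map X Y g \<in> csheaf_maps fermat_site (fermat_space X) (fermat_space Y)"
    if "is_csheaf smooth_site X" "g \<in> csheaf_maps smooth_site X Y"
    for X :: "'a diffeology" and Y :: "'b diffeology" and g
    by (rule fermat_map_universal(1)[OF that])
qed (fact is_functor_fermat_ext is_functor_fermat_map | rule is_colimit_plots is_colimit_fermat_space, assumption?)+

end
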